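(* Under the observation scheme and assumptions (A1)–(A7) described in the context, let $\hat\theta_{1,n}$ be a (measurable) estimator satisfying $$g_n(\hat\theta_{1,n})=\inf_{\theta_1} g_n(\theta_1),$$ where the infimum is over all admissible values of $\theta_1$ and $$g_n(\theta_1)=\sum_{i=1}^n\left\{\log\sigma^2(X_{i-1},\theta_1)+\frac{(X_i-X_{i-1})^2}{\sigma^2(X_{i-1},\theta_1)\,h_n}\right\}\chi_{\{X_{i-1}>\tau_n,\;X_i>\tau\}} .$$ Then, as $n\to\infty$, $\hat\theta_{1,n}\to\theta_{1,0}$ in probability (under the law of $X$ with true parameter $\theta_0$).
   Context: Model. $X=\{X(t)\}$ is a real-valued diffusion process satisfying $$dX(t)=b(X(t),\theta_2)\,dt+\sigma(X(t),\theta_1)\,dW_t,\qquad X(0)=x_0,\qquad t\in[0,T],$$ where $W$ is a one-dimensional standard Brownian motion. The parameter is $\theta=(\theta_1,\theta_2)\in\Theta$, where $\Theta$ is a compact rectangle in $\mathbf{R}^2$ (a product of two compact intervals, one for $\theta_1$ and one for $\theta_2$). The true value is $\theta_0=(\theta_{1,0},\theta_{2,0})\in\mathrm{Int}(\Theta)$; the data are generated by the equation with $\theta=\theta_0$. Observation scheme. $h_n>0$, $t_i=ih_n$ for $i=0,\dots,n$, $T=nh_n$, $X_i=X(t_i)$. The asymptotics are $h_n\to0$, $nh_n\to\infty$, $nh_n^2\to0$ as $n\to\infty$. A known threshold $\tau\in\mathbf{R}$ is fixed; $X_i$ is observed if $X_i>\tau$ and unobserved if $X_i\le\tau$. Fix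 $\alpha\in(0,1/2)$ and a sequence $\tau_n>\tau$ with $\tau_n\to\tau$ and $h_n^\alpha/(\tau_n-\tau)=O(1)$ (for example $\tau_n=\tau+h_n^\alpha$). $\chi_A$ denotes the indicator function of $A$. Assumptions. (A1) There is $K>0$ such that $|b(x,\theta_{2,0})-b(y,\theta_{2,0})|+|\sigma(x,\theta_{1,0})-\sigma(y,\theta_{1,0})|\le K|x-y|$ for all $x,y$ (so the equation has a unique solution for $\theta=\theta_0$). (A2) For $\theta=\theta_0$ the process $X$ is stationary and ergodic, with invariant measure $\nu_{\theta_0}$. (A3) For all $p\ge0$, $\sup_t \mathrm{E}|X(t)|^p<\infty$. (A4) $\inf_{x,\theta_1}\sigma^2(x,\theta_1)=K_4>0$. (A5) $b$ and $\sigma$ are continuously differentiable with respect to $x$ up to order 2 for all $\theta_1,\theta_2$; they and their $x$-derivatives up to order 2 are of polynomial growth in $x$, uniformly in $\theta$. (A6) $b$, $\sigma$ and all their $x$-derivatives up to order 2 are three times continuously differentiable with respect to $\theta$ for all $x$; these $\theta$-derivatives are of polynomial growth in $x$, uniformly in $\theta$. (A7) (identifiability) $b(\cdot,\theta_2)=b(\cdot,\theta_{2,0})$ and $\sigma(\cdot,\theta_1)=\sigma(\cdot,\theta_{1,0})$ if and only if $\theta=\theta_0$.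
   Formalization: Added to (A7): for admissible θ₁, σ(x,θ₁)=σ(x,θ_{1,0}) for all x>τ only if θ₁=θ_{1,0}; without it the claim fails, e.g. if σ depends on θ₁ only for x below τ, when g_n is constant in θ₁. *)

theory Defs
  imports "HOL-Probability.Probability"
begin

section \<open>Brownian motion and the Ito integral\<close>

text \<open>Time is \<open>{0..}\<close>; values of processes and filtrations at negative times are irrelevant.\<close>

definition filtered_prob_space :: "'a measure \<Rightarrow> (real \<Rightarrow> 'a measure) \<Rightarrow> bool" where
  "filtered_prob_space M F \<longleftrightarrow>
     prob_space M \<and> filtration (space M) F \<and> (\<forall>t. subalgebra M (F t))"

definition adapted :: "(real \<Rightarrow> 'a measure) \<Rightarrow> (real \<Rightarrow> 'a \<Rightarrow> real) \<Rightarrow> bool" where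
  "adapted F X \<longleftrightarrow> (\<forall>t\<ge>0. X t \<in> borel_measurable (F t))"

definition brownian_motion ::
  "'a measure \<Rightarrow> (real \<Rightarrow> 'a measure) \<Rightarrow> (real \<Rightarrow> 'a \<Rightarrow> real) \<Rightarrow> bool" where
  "brownian_motion M F W \<longleftrightarrow>
     adapted F W \<and>
     (AE \<omega> in M. W 0 \<omega> = 0) \<and>
     (AE \<omega> in M. continuous_on {0..} (\<lambda>t. W t \<omega>)) \<and>
     (\<forall>s t. 0 \<le> s \<and> s < t \<longrightarrow>
        distributed M lborel (\<lambda>\<omega>. W t \<omega> - W s \<omega>) (normal_density 0 (sqrt (t - s))) \<and>
        prob_space.indep_set M (sets (F s))
          (sets (vimage_algebra (space M) (\<lambda>\<omega>. W t \<omega> - W s \<omega>) borel)))"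

text \<open>
  An elementary process on \<open>[0,t]\<close> takes the bounded \<open>F (p j)\<close>-measurable value \<open>\<xi> j\<close> on
  \<open>[p j, p (j + 1))\<close>, where \<open>0 = p 0 \<le> \<dots> \<le> p m = t\<close>.
\<close>

definition elementary :: "'a measure \<Rightarrow> (real \<Rightarrow> 'a measure) \<Rightarrow> real
    \<Rightarrow> nat \<Rightarrow> (nat \<Rightarrow> real) \<Rightarrow> (nat \<Rightarrow> 'a \<Rightarrow> real) \<Rightarrow> bool" where
  "elementary M F t m p \<xi> \<longleftrightarrow>
     p 0 = 0 \<and> p m = t \<and>
     (\<forall>j<m. p j \<le> p (Suc j) \<and> \<xi> j \<in> borel_measurable (F (p j)) \<and> bounded (\<xi> j ` space M))"

definition elementary_process ::
  "nat \<Rightarrow> (nat \<Rightarrow> real) \<Rightarrow> (nat \<Rightarrow> 'a \<Rightarrow> real) \<Rightarrow> real \<Rightarrow> 'a \<Rightarrow> real" where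
  "elementary_process m p \<xi> s \<omega> = (\<Sum>j<m. \<xi> j \<omega> * indicator {p j..<p (Suc j)} s)"

definition elementary_integral ::
  "(real \<Rightarrow> 'a \<Rightarrow> real) \<Rightarrow> nat \<Rightarrow> (nat \<Rightarrow> real) \<Rightarrow> (nat \<Rightarrow> 'a \<Rightarrow> real) \<Rightarrow> 'a \<Rightarrow> real" where
  "elementary_integral W m p \<xi> \<omega> = (\<Sum>j<m. \<xi> j \<omega> * (W (p (Suc j)) \<omega> - W (p j) \<omega>))"

text \<open>
  \<open>I\<close> is a version of the Ito integral of \<open>H\<close> over \<open>[0,t]\<close> with respect to \<open>W\<close>, for
  integrands with \<open>E \<integral>\<^sub>0\<^sup>t H\<^sup>2 ds < \<infinity>\<close>: the mean-square limit of the integrals of elementary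
  processes that approximate \<open>H\<close> in \<open>L\<^sup>2(P \<otimes> ds)\<close>.
\<close>

definition has_ito_integral :: "'a measure \<Rightarrow> (real \<Rightarrow> 'a measure) \<Rightarrow> (real \<Rightarrow> 'a \<Rightarrow> real)
    \<Rightarrow> (real \<Rightarrow> 'a \<Rightarrow> real) \<Rightarrow> real \<Rightarrow> ('a \<Rightarrow> real) \<Rightarrow> bool" where
  "has_ito_integral M F W H t I \<longleftrightarrow>
     I \<in> borel_measurable M \<and>
     (\<exists>m p \<xi>. (\<forall>k. elementary M F t (m k) (p k) (\<xi> k)) \<and>
        (\<lambda>k. \<integral>\<^sup>+\<omega>. (\<integral>\<^sup>+s\<in>{0..t}.
            ennreal ((H s \<omega> - elementary_process (m k) (p k) (\<xi> k) s \<omega>)\<^sup>2) \<partial>lborel) \<partial>M)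
          \<longlonglongrightarrow> 0 \<and>
        (\<lambda>k. \<integral>\<^sup>+\<omega>. ennreal ((I \<omega> - elementary_integral W (m k) (p k) (\<xi> k) \<omega>)\<^sup>2) \<partial>M)
          \<longlonglongrightarrow> 0)"

text \<open>
  \<open>dX = b(X) dt + \<sigma>(X) dW\<close>, \<open>X(0) = x\<^sub>0\<close>. The initial value is \<open>F 0\<close>-measurable and may be random,
  as it has to be for a stationary solution. For Lipschitz \<open>\<sigma>\<close> and \<open>sup\<^sub>t E|X(t)|\<^sup>2 < \<infinity>\<close> the
  integrand \<open>\<sigma>(X)\<close> is square integrable on \<open>[0,t]\<close>, so that the mean-square Ito integral
  is no restriction.
\<close>

definition diffusion_solution :: "'a measure \<Rightarrow> (real \<Rightarrow> 'a measure) \<Rightarrow> (real \<Rightarrow> 'a \<Rightarrow> real)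
    \<Rightarrow> (real \<Rightarrow> real) \<Rightarrow> (real \<Rightarrow> real) \<Rightarrow> ('a \<Rightarrow> real) \<Rightarrow> (real \<Rightarrow> 'a \<Rightarrow> real) \<Rightarrow> bool" where
  "diffusion_solution M F W b \<sigma> x\<^sub>0 X \<longleftrightarrow>
     adapted F X \<and>
     (\<forall>\<omega>\<in>space M. continuous_on {0..} (\<lambda>t. X t \<omega>)) \<and>
     x\<^sub>0 \<in> borel_measurable (F 0) \<and>
     (AE \<omega> in M. X 0 \<omega> = x\<^sub>0 \<omega>) \<and>
     (\<forall>t\<ge>0. has_ito_integral M F W (\<lambda>s \<omega>. \<sigma> (X s \<omega>)) t
        (\<lambda>\<omega>. X t \<omega> - X 0 \<omega> - (LBINT s:{0..t}. b (X s \<omega>))))"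


section \<open>Stationarity and ergodicity\<close>

definition path_space :: "(real \<Rightarrow> real) measure" where
  "path_space = PiM {0..} (\<lambda>_. borel)"

definition shifted_path :: "(real \<Rightarrow> 'a \<Rightarrow> real) \<Rightarrow> real \<Rightarrow> 'a \<Rightarrow> real \<Rightarrow> real" where
  "shifted_path X t \<omega> = (\<lambda>s\<in>{0..}. X (t + s) \<omega>)"

definition stationary :: "'a measure \<Rightarrow> (real \<Rightarrow> 'a \<Rightarrow> real) \<Rightarrow> bool" where
  "stationary M X \<longleftrightarrow>
     (\<forall>t\<ge>0. distr M path_space (shifted_path X t) = distr M path_space (shifted_path X 0))"

text \<open>
  Ergodicity of the shift on the law of \<open>X\<close>. Invariance of an event is required modulo null
  sets: every event of the product sigma-algebra is determined by countably many coordinates,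
  so the only strictly invariant ones are the empty set and the whole space, and strict
  invariance would make the condition void.
\<close>

definition ergodic :: "'a measure \<Rightarrow> (real \<Rightarrow> 'a \<Rightarrow> real) \<Rightarrow> bool" where
  "ergodic M X \<longleftrightarrow>
     (\<forall>A\<in>sets path_space.
        (\<forall>t\<ge>0. AE \<omega> in M. shifted_path X t \<omega> \<in> A \<longleftrightarrow> shifted_path X 0 \<omega> \<in> A) \<longrightarrow>
        measure M {\<omega>\<in>space M. shifted_path X 0 \<omega> \<in> A} \<in> {0, 1})"


section \<open>Regularity of the coefficients\<close>

text \<open>Coefficients are functions \<open>f x \<theta>\<close> of the state and of a scalar parameter.\<close>

definition polynomial_growth :: "real set \<Rightarrow> (real \<Rightarrow> real \<Rightarrow> real) \<Rightarrow> bool" where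
  "polynomial_growth \<Theta> f \<longleftrightarrow> (\<exists>C k. \<forall>\<theta>\<in>\<Theta>. \<forall>x. \<bar>f x \<theta>\<bar> \<le> C * (1 + \<bar>x\<bar>) ^ k)"

text \<open>
  \<open>f\<close> is \<open>k\<close> times continuously differentiable on \<open>S\<close> with derivatives \<open>D 0 = f, D 1, \<dots>, D k\<close>;
  at an end point of an interval \<open>S\<close> the derivatives are one-sided.
\<close>

definition continuous_derivatives ::
  "nat \<Rightarrow> real set \<Rightarrow> (real \<Rightarrow> real) \<Rightarrow> (nat \<Rightarrow> real \<Rightarrow> real) \<Rightarrow> bool" where
  "continuous_derivatives k S f D \<longleftrightarrow>
     (\<forall>x\<in>S. D 0 x = f x) \<and>
     (\<forall>i<k. \<forall>x\<in>S. (D i has_real_derivative D (Suc i) x) (at x within S)) \<and>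
     (\<forall>i\<le>k. continuous_on S (D i))"

definition state_deriv :: "nat \<Rightarrow> (real \<Rightarrow> real \<Rightarrow> real) \<Rightarrow> real \<Rightarrow> real \<Rightarrow> real" where
  "state_deriv i f x \<theta> = (deriv ^^ i) (\<lambda>y. f y \<theta>) x"

definition state_smooth :: "real set \<Rightarrow> (real \<Rightarrow> real \<Rightarrow> real) \<Rightarrow> bool" where
  "state_smooth \<Theta> f \<longleftrightarrow>
     (\<forall>\<theta>\<in>\<Theta>. continuous_derivatives 2 UNIV (\<lambda>x. f x \<theta>) (\<lambda>i x. state_deriv i f x \<theta>)) \<and>
     (\<forall>i\<le>2. polynomial_growth \<Theta> (state_deriv i f))"

definition parameter_smooth :: "real set \<Rightarrow> (real \<Rightarrow> real \<Rightarrow> real) \<Rightarrow> bool" where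
  "parameter_smooth \<Theta> f \<longleftrightarrow>
     (\<forall>i\<le>2. \<exists>D.
        (\<forall>x. continuous_derivatives 3 \<Theta> (\<lambda>\<theta>. state_deriv i f x \<theta>) (\<lambda>j \<theta>. D j x \<theta>)) \<and>
        (\<forall>j\<in>{1..3}. polynomial_growth \<Theta> (D j)))"


section \<open>The contrast function\<close>

definition sampled :: "(real \<Rightarrow> 'a \<Rightarrow> real) \<Rightarrow> real \<Rightarrow> nat \<Rightarrow> 'a \<Rightarrow> real" where
  "sampled X h i \<omega> = X (real i * h) \<omega>"

definition contrast :: "(real \<Rightarrow> real \<Rightarrow> real) \<Rightarrow> (real \<Rightarrow> 'a \<Rightarrow> real) \<Rightarrow> (nat \<Rightarrow> real)
    \<Rightarrow> real \<Rightarrow> (nat \<Rightarrow> real) \<Rightarrow> nat \<Rightarrow> real \<Rightarrow> 'a \<Rightarrow> real" where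
  "contrast \<sigma> X h \<tau> \<tau>s n \<theta> \<omega> =
     (\<Sum>i=1..n.
        (ln ((\<sigma> (sampled X (h n) (i - 1) \<omega>) \<theta>)\<^sup>2)
         + (sampled X (h n) i \<omega> - sampled X (h n) (i - 1) \<omega>)\<^sup>2
             / ((\<sigma> (sampled X (h n) (i - 1) \<omega>) \<theta>)\<^sup>2 * h n))
        * of_bool (sampled X (h n) (i - 1) \<omega> > \<tau>s n \<and> sampled X (h n) i \<omega> > \<tau>))"

definition tendsto_in_prob :: "'a measure \<Rightarrow> (nat \<Rightarrow> 'a \<Rightarrow> real) \<Rightarrow> real \<Rightarrow> bool" where
  "tendsto_in_prob M Y c \<longleftrightarrow>
     (\<forall>\<epsilon>>0. (\<lambda>n. measure M {\<omega>\<in>space M. \<bar>Y n \<omega> - c\<bar> > \<epsilon>}) \<longlonglongrightarrow> 0)"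


section \<open>Identifiability\<close>

text \<open>
  Identification within the rectangle by the coefficients on the whole state space.
\<close>

definition identifiable :: "real set \<Rightarrow> real set \<Rightarrow> (real \<Rightarrow> real \<Rightarrow> real)
    \<Rightarrow> (real \<Rightarrow> real \<Rightarrow> real) \<Rightarrow> real \<Rightarrow> real \<Rightarrow> bool" where
  "identifiable \<Theta>1 \<Theta>2 b \<sigma> \<theta>10 \<theta>20 \<longleftrightarrow>
     (\<forall>\<theta>1\<in>\<Theta>1. \<forall>\<theta>2\<in>\<Theta>2.
        ((\<forall>x. b x \<theta>2 = b x \<theta>20) \<and> (\<forall>x. \<sigma> x \<theta>1 = \<sigma> x \<theta>10))
        \<longleftrightarrow> (\<theta>1, \<theta>2) = (\<theta>10, \<theta>20))"

text \<open>
  Observations at or below \<open>\<tau>\<close> are lost and the contrast depends on \<open>\<sigma>(x, \<theta>\<^sub>1)\<close> for \<open>x > \<tau>\<close> only.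
  If \<open>\<sigma>(x, \<theta>\<^sub>1)\<close> depends on \<open>\<theta>\<^sub>1\<close> only for \<open>x \<le> \<tau>\<close>, which \<open>identifiable\<close> allows, the contrast
  is constant in \<open>\<theta>\<^sub>1\<close> and no minimizer can be expected to be consistent. Hence \<open>\<theta>\<^sub>1\<close> has to be
  identified on the observed part of the state space.
\<close>

definition identifiable_above ::
  "real \<Rightarrow> real set \<Rightarrow> (real \<Rightarrow> real \<Rightarrow> real) \<Rightarrow> real \<Rightarrow> bool" where
  "identifiable_above \<tau> \<Theta>1 \<sigma> \<theta>10 \<longleftrightarrow>
     (\<forall>\<theta>1\<in>\<Theta>1. (\<forall>x>\<tau>. \<sigma> x \<theta>1 = \<sigma> x \<theta>10) \<longleftrightarrow> \<theta>1 = \<theta>10)"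

end

theory Submission
  imports Defs
begin

text \<open>
  Write \<open>v(x,\<theta>) = \<sigma>(x,\<theta>)\<^sup>2\<close> and \<open>v\<^sub>0(x) = v(x,\<theta>\<^sub>0)\<close> with \<open>\<theta>\<^sub>0\<close> the true parameter. Over a short step,
  \<open>(\<Delta>X)\<^sup>2 / h\<close> behaves like \<open>v\<^sub>0 (\<Delta>W)\<^sup>2 / h\<close>, whose mean is \<open>v\<^sub>0\<close>. Replacing it by \<open>v\<^sub>0\<close> turns the difference of
  the contrasts at \<open>\<theta>\<close> and \<open>\<theta>\<^sub>0\<close> into the sum of the divergences \<open>ln v - ln v\<^sub>0 + v\<^sub>0 / v - 1 \<ge> 0\<close> over
  the retained observations, plus a fluctuation (\<open>contrast_difference\<close>). It therefore suffices that
  the fluctuation is \<open>o(n)\<close> uniformly in \<open>\<theta>\<close>, and that the divergences add up to a positive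
  multiple of \<open>n\<close>, uniformly for \<open>\<theta>\<close> away from \<open>\<theta>\<^sub>0\<close>.

  The fluctuation is treated in \<open>uniform_error\<close>. The Ito isometry shows that
  \<open>X t - X s = \<sigma>(X s) (W t - W s) + O(t - s)\<close> in mean square, so that squared increments may be
  replaced by Gaussian ones (\<open>squared_increment\<close>). The requirement that the right end point of a
  step be above \<open>\<tau>\<close> destroys the martingale structure; but if the left end point is above \<open>\<tau>\<^sub>n\<close>, it
  fails with probability \<open>O(h / (\<tau>\<^sub>n - \<tau>)\<^sup>2)\<close> only, which tends to zero because \<open>\<alpha> < 1/2\<close>.
  The remaining martingale sums have second moment \<open>O(n)\<close> for each \<open>\<theta>\<close>, and the coefficients are
  Lipschitz in \<open>\<theta>\<close>.

  For the divergences a lower bound is enough. Identifiability on the half line above \<open>\<tau>\<close>,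
  continuity and compactness yield finitely many intervals above \<open>\<tau>\<close> such that every \<open>\<theta>\<close> away from
  \<open>\<theta>\<^sub>0\<close> has divergence bounded below on one of them (\<open>separating_intervals\<close>). The process spends a
  positive fraction of the time in each interval. This has two sources. The invariant law charges
  every interval: at the edge of a gap of its support, the nondegenerate noise dominates the
  drift for a convex test function concentrated near the edge, which contradicts stationarity
  (\<open>full_support\<close>). And averages along the path are bounded below by means: the maximal ergodic
  inequality shows that integrals of a bounded continuous function with negative mean are almost
  surely bounded above (\<open>negative_mean_bounded_integrals\<close>), and the sampled path inherits this
  because the mesh tends to zero (\<open>occupation_lower_bound\<close>).
\<close>

section \<open>Square integrable functions\<close>

lemma integrable_of_nn_integral_le:
  fixes f :: "'a \<Rightarrow> real"
  assumes "f \<in> borel_measurable M" "\<And>x. x \<in> space M \<Longrightarrow> 0 \<le> f x"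
    and "(\<integral>\<^sup>+x. ennreal (f x) \<partial>M) \<le> ennreal c" "0 \<le> c"
  shows "integrable M f" "(\<integral>x. f x \<partial>M) \<le> c"
proof -
  show *: "integrable M f"
    using assms by (intro integrableI_nonneg) (auto simp: less_top[symmetric] top_unique)
  show "(\<integral>x. f x \<partial>M) \<le> c"
    using assms nn_integral_eq_integral[OF *] by simp
qed

lemma abs_mult_le_sum_squares: "\<bar>x * y\<bar> \<le> x\<^sup>2 + (y::real)\<^sup>2"
proof -
  have "2 * \<bar>x\<bar> * \<bar>y\<bar> \<le> x\<^sup>2 + y\<^sup>2"
    using sum_squares_bound[of "\<bar>x\<bar>" "\<bar>y\<bar>"] by simp
  moreover have "0 \<le> \<bar>x\<bar> * \<bar>y\<bar>" by simp
  ultimately show ?thesis unfolding abs_mult by linarith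
qed

lemma abs_mult_le_weighted: "0 < c \<Longrightarrow> \<bar>x * y\<bar> \<le> c * x\<^sup>2 + (y::real)\<^sup>2 / c"
proof -
  assume c: "0 < c"
  have "\<bar>(sqrt c * x) * (y / sqrt c)\<bar> \<le> (sqrt c * x)\<^sup>2 + (y / sqrt c)\<^sup>2"
    by (rule abs_mult_le_sum_squares)
  then show ?thesis using c by (simp add: power_mult_distrib power_divide)
qed

text \<open>
  With \<open>c\<close> of the order of the square root of the second moment, this takes the place of the
  Cauchy-Schwarz inequality in the estimates below.
\<close>

lemma (in prob_space) first_moment_le:
  fixes f :: "'a \<Rightarrow> real"
  assumes f: "f \<in> borel_measurable M" "integrable M (\<lambda>x. (f x)\<^sup>2)" and c: "0 < c"
  shows "integrable M f" "expectation (\<lambda>x. \<bar>f x\<bar>) \<le> c + expectation (\<lambda>x. (f x)\<^sup>2) / c"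
proof -
  have pt: "\<bar>y\<bar> \<le> c + y\<^sup>2 / c" for y
    using abs_mult_le_weighted[OF c, of 1 y] by simp
  have B: "integrable M (\<lambda>x. c + (f x)\<^sup>2 / c)" using f by simp
  show i: "integrable M f"
    by (rule Bochner_Integration.integrable_bound[OF B f(1)])
       (use order_trans[OF pt abs_ge_self] in \<open>simp only: real_norm_def AE_I2\<close>)
  have "expectation (\<lambda>x. \<bar>f x\<bar>) \<le> expectation (\<lambda>x. c + (f x)\<^sup>2 / c)"
    by (rule integral_mono[OF integrable_abs[OF i] B pt])
  also have "\<dots> = c + expectation (\<lambda>x. (f x)\<^sup>2) / c" using f by (simp add: prob_space)
  finally show "expectation (\<lambda>x. \<bar>f x\<bar>) \<le> c + expectation (\<lambda>x. (f x)\<^sup>2) / c" .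
qed

lemma integrable_mult_of_squares:
  fixes f g :: "'a \<Rightarrow> real"
  assumes "f \<in> borel_measurable M" "g \<in> borel_measurable M"
    and "integrable M (\<lambda>x. (f x)\<^sup>2)" "integrable M (\<lambda>x. (g x)\<^sup>2)"
  shows "integrable M (\<lambda>x. f x * g x)"
  by (rule Bochner_Integration.integrable_bound[of _ "\<lambda>x. (f x)\<^sup>2 + (g x)\<^sup>2"])
     (use assms abs_mult_le_sum_squares in \<open>auto intro!: AE_I2\<close>)

lemma square_add_le: "(x + y)\<^sup>2 \<le> 2 * x\<^sup>2 + 2 * (y::real)\<^sup>2"
  using sum_squares_bound[of x y] by (simp add: power2_sum)

lemma square_add3_le: "(x + y + z)\<^sup>2 \<le> 3 * x\<^sup>2 + 3 * y\<^sup>2 + 3 * (z::real)\<^sup>2"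
  using sum_squares_bound[of x y] sum_squares_bound[of x z] sum_squares_bound[of y z]
  by (simp add: power2_eq_square algebra_simps)

lemma ennreal_square_add3_le:
  "ennreal ((x + y + z)\<^sup>2) \<le> 3 * ennreal (x\<^sup>2) + 3 * ennreal (y\<^sup>2) + 3 * ennreal (z\<^sup>2)"
proof -
  have "ennreal ((x + y + z)\<^sup>2) \<le> ennreal (3 * x\<^sup>2 + 3 * y\<^sup>2 + 3 * z\<^sup>2)"
    by (intro ennreal_leI square_add3_le)
  also have "\<dots> = 3 * ennreal (x\<^sup>2) + 3 * ennreal (y\<^sup>2) + 3 * ennreal (z\<^sup>2)"
    by (simp add: ennreal_plus ennreal_mult)
  finally show ?thesis .
qed

section \<open>Brownian increments and the Ito isometry\<close>

locale brownian_filtration = prob_space M for M :: "'a measure" +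
  fixes F :: "real \<Rightarrow> 'a measure" and W :: "real \<Rightarrow> 'a \<Rightarrow> real"
  assumes filtered: "filtered_prob_space M F" and brownian: "brownian_motion M F W"
begin

lemma space_F [simp]: "space (F t) = space M"
  using filtered unfolding filtered_prob_space_def subalgebra_def by auto

lemma measurable_from_F:
  assumes "f \<in> borel_measurable (F t)"
  shows "f \<in> borel_measurable M"
proof -
  have "subalgebra M (F t)" using filtered unfolding filtered_prob_space_def by (elim conjE) (erule spec)
  from measurable_from_subalg[OF this assms] show ?thesis .
qed

lemma measurable_F_mono:
  assumes "s \<le> t" "f \<in> borel_measurable (F s)"
  shows "f \<in> borel_measurable (F t)"
proof -
  have "filtration (space M) F" using filtered unfolding filtered_prob_space_def by (elim conjE)
  from filtration.sets_F_mono[OF this assms(1)] have "subalgebra (F t) (F s)"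
    unfolding subalgebra_def by simp
  from measurable_from_subalg[OF this assms(2)] show ?thesis .
qed

lemma W_measurable_F: "0 \<le> t \<Longrightarrow> t \<le> u \<Longrightarrow> W t \<in> borel_measurable (F u)"
  using brownian measurable_F_mono[of t u "W t"] unfolding brownian_motion_def adapted_def by (elim conjE) simp

lemma W_measurable: "0 \<le> t \<Longrightarrow> W t \<in> borel_measurable M"
  using measurable_from_F[OF W_measurable_F[of t t]] by simp

lemma increment_moment:
  assumes "0 \<le> s" "s \<le> t"
  shows "integrable M (\<lambda>\<omega>. (W t \<omega> - W s \<omega>) ^ k)"
    and "expectation (\<lambda>\<omega>. W t \<omega> - W s \<omega>) = 0"
    and "expectation (\<lambda>\<omega>. (W t \<omega> - W s \<omega>)\<^sup>2) = t - s"
    and "expectation (\<lambda>\<omega>. (W t \<omega> - W s \<omega>) ^ 4) = 3 * (t - s)\<^sup>2"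
proof -
  have D: "distributed M lborel (\<lambda>\<omega>. W t \<omega> - W s \<omega>) (normal_density 0 (sqrt (t - s)))" if "s < t"
    using brownian that assms unfolding brownian_motion_def by auto
  have E: "expectation (\<lambda>\<omega>. (W t \<omega> - W s \<omega>) ^ k) =
      (\<integral>x. normal_density 0 (sqrt (t - s)) x * x ^ k \<partial>lborel)" if "s < t" for k
    using distributed_integral[OF D[OF that], of "\<lambda>x. x ^ k"] by simp
  show "integrable M (\<lambda>\<omega>. (W t \<omega> - W s \<omega>) ^ k)"
  proof (cases "s < t")
    case True
    then show ?thesis
      using distributed_integrable[OF D[OF True], of "\<lambda>x. x ^ k"]
        integrable_normal_moment[of "sqrt (t - s)" 0 k] by simp
  qed (use assms in simp)
  show "expectation (\<lambda>\<omega>. W t \<omega> - W s \<omega>) = 0"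
  proof (cases "s < t")
    case True
    then show ?thesis
      using E[of 1] integral_normal_moment_odd[of "sqrt (t - s)" 0 0] by simp
  qed (use assms in simp)
  show "expectation (\<lambda>\<omega>. (W t \<omega> - W s \<omega>)\<^sup>2) = t - s"
  proof (cases "s < t")
    case True
    then show ?thesis
      using E[of 2] integral_normal_moment_even[of "sqrt (t - s)" 0 1] by simp
  qed (use assms in simp)
  show "expectation (\<lambda>\<omega>. (W t \<omega> - W s \<omega>) ^ 4) = 3 * (t - s)\<^sup>2"
  proof (cases "s < t")
    case True
    then show ?thesis
      using E[of 4] integral_normal_moment_even[of "sqrt (t - s)" 0 2]
      by (simp add: fact_numeral power_divide field_simps power2_eq_square)
  qed (use assms in simp)
qed

lemma increment_indep:
  assumes "0 \<le> s" "s < t" and Y: "Y \<in> borel_measurable (F s)"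
  shows "indep_var borel Y borel (\<lambda>\<omega>. W t \<omega> - W s \<omega>)"
proof -
  have i: "indep_set (sets (F s))
          (sets (vimage_algebra (space M) (\<lambda>\<omega>. W t \<omega> - W s \<omega>) borel))"
    using brownian assms unfolding brownian_motion_def by auto
  have sub: "sigma_sets (space M) {Y -` A \<inter> space M | A. A \<in> sets borel} \<subseteq> sets (F s)"
  proof -
    have "{Y -` A \<inter> space M | A. A \<in> sets borel} \<subseteq> sets (F s)"
      using measurable_sets[OF Y] by auto
    from sets.sigma_sets_subset[OF this] show ?thesis by simp
  qed
  have "indep_set (sigma_sets (space M) {Y -` A \<inter> space M | A. A \<in> sets borel})
     (sigma_sets (space M) {(\<lambda>\<omega>. W t \<omega> - W s \<omega>) -` A \<inter> space M | A. A \<in> sets borel})"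
    using i sub unfolding indep_set_def sets_vimage_algebra
    by (elim indep_sets_mono_sets) (auto split: bool.split)
  then show ?thesis
    unfolding indep_var_eq using measurable_from_F[OF Y] W_measurable assms by auto
qed

lemma expectation_times_increment:
  fixes g :: "real \<Rightarrow> real"
  assumes "0 \<le> s" "s \<le> t" and Y: "Y \<in> borel_measurable (F s)" "integrable M Y"
    and g: "g \<in> borel_measurable borel" "integrable M (\<lambda>\<omega>. g (W t \<omega> - W s \<omega>))"
  shows "integrable M (\<lambda>\<omega>. Y \<omega> * g (W t \<omega> - W s \<omega>))"
    and "expectation (\<lambda>\<omega>. Y \<omega> * g (W t \<omega> - W s \<omega>)) =
      expectation Y * expectation (\<lambda>\<omega>. g (W t \<omega> - W s \<omega>))"
proof -
  have I: "indep_var borel Y borel (\<lambda>\<omega>. g (W t \<omega> - W s \<omega>))" if "s < t"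
    using indep_var_compose[OF increment_indep[OF assms(1) that Y(1)], of "\<lambda>x. x" borel g borel] g
    by (simp add: comp_def)
  show "integrable M (\<lambda>\<omega>. Y \<omega> * g (W t \<omega> - W s \<omega>))"
  proof (cases "s < t")
    case True
    from indep_var_integrable[OF I[OF this] Y(2) g(2)] show ?thesis .
  qed (use assms in simp)
  show "expectation (\<lambda>\<omega>. Y \<omega> * g (W t \<omega> - W s \<omega>)) =
      expectation Y * expectation (\<lambda>\<omega>. g (W t \<omega> - W s \<omega>))"
  proof (cases "s < t")
    case True
    from indep_var_lebesgue_integral[OF I[OF this] Y(2) g(2)] show ?thesis .
  qed (use assms in \<open>simp add: prob_space\<close>)
qed

lemma integrable_bounded_mult:
  fixes \<xi> Y :: "'a \<Rightarrow> real"
  assumes "\<xi> \<in> borel_measurable M" "bounded (\<xi> ` space M)" "integrable M Y"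
  shows "integrable M (\<lambda>\<omega>. \<xi> \<omega> * Y \<omega>)"
proof -
  obtain B where B: "\<And>\<omega>. \<omega> \<in> space M \<Longrightarrow> \<bar>\<xi> \<omega>\<bar> \<le> B"
    using assms(2) unfolding bounded_real by auto
  show ?thesis
    by (rule Bochner_Integration.integrable_bound[of _ "\<lambda>\<omega>. B * Y \<omega>"])
       (use assms in \<open>auto intro!: AE_I2 mult_right_mono order_trans[OF B abs_ge_self] simp: abs_mult\<close>)
qed

lemma integrable_increment_mult:
  assumes "0 \<le> a" "a \<le> b" "0 \<le> c" "c \<le> d"
  shows "integrable M (\<lambda>\<omega>. (W b \<omega> - W a \<omega>) * (W d \<omega> - W c \<omega>))"
  using assms increment_moment(1)[of a b 2] increment_moment(1)[of c d 2] W_measurable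
  by (intro integrable_mult_of_squares) auto

lemma bounded_image_mult:
  fixes f g :: "'a \<Rightarrow> real"
  assumes "bounded (f ` S)" "bounded (g ` S)"
  shows "bounded ((\<lambda>x. f x * g x) ` S)"
proof -
  obtain B C where "\<forall>x\<in>S. \<bar>f x\<bar> \<le> B" "\<forall>x\<in>S. \<bar>g x\<bar> \<le> C"
    using assms unfolding bounded_real by auto
  then show ?thesis
    unfolding bounded_real by (intro exI[of _ "B * C"]) (auto simp: abs_mult intro!: mult_mono order_trans[OF abs_ge_zero])
qed

text \<open>
  Split the longer increment at \<open>u\<close>: its remainder is independent of everything known at time \<open>u\<close>
  and has mean zero, so that only the square of the common part contributes.
\<close>

lemma expectation_increment_product_from_start:
  assumes "0 \<le> c" "c \<le> u" "u \<le> v"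
    and \<zeta>: "\<zeta> \<in> borel_measurable (F c)" "bounded (\<zeta> ` space M)"
  shows "expectation (\<lambda>\<omega>. \<zeta> \<omega> * ((W u \<omega> - W c \<omega>) * (W v \<omega> - W c \<omega>))) = expectation \<zeta> * (u - c)"
proof -
  have \<zeta>M: "\<zeta> \<in> borel_measurable M" using \<zeta>(1) by (rule measurable_from_F)
  have \<zeta>i: "integrable M \<zeta>"
    using integrable_bounded_mult[OF \<zeta>M \<zeta>(2), of "\<lambda>_. 1"] by simp
  have Y: "(\<lambda>\<omega>. \<zeta> \<omega> * (W u \<omega> - W c \<omega>)) \<in> borel_measurable (F u)"
    using assms by (intro borel_measurable_times borel_measurable_diff
        measurable_F_mono[OF assms(2) \<zeta>(1)] W_measurable_F) auto
  have Yi: "integrable M (\<lambda>\<omega>. \<zeta> \<omega> * (W u \<omega> - W c \<omega>))"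
    using increment_moment(1)[of c u 1] assms by (intro integrable_bounded_mult \<zeta>M \<zeta>) auto
  note e1 = expectation_times_increment[OF _ assms(3) Y Yi, of "\<lambda>x. x"]
  note e2 = expectation_times_increment[OF assms(1,2) \<zeta>(1) \<zeta>i, of "\<lambda>x. x\<^sup>2"]
  have "expectation (\<lambda>\<omega>. \<zeta> \<omega> * ((W u \<omega> - W c \<omega>) * (W v \<omega> - W c \<omega>))) =
    expectation (\<lambda>\<omega>. \<zeta> \<omega> * (W u \<omega> - W c \<omega>) * (W v \<omega> - W u \<omega>) + \<zeta> \<omega> * (W u \<omega> - W c \<omega>)\<^sup>2)"
    by (intro Bochner_Integration.integral_cong) (auto simp: algebra_simps power2_eq_square)
  also have "\<dots> = expectation \<zeta> * (u - c)"
    using e1 e2 assms increment_moment[of c u] increment_moment[of u v] increment_moment(1)[of u v 1]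
    by (subst Bochner_Integration.integral_add) auto
  finally show ?thesis .
qed

lemma expectation_increment_product_ordered:
  assumes "0 \<le> a" "a \<le> b" "a \<le> c" "c \<le> d"
    and \<xi>: "\<xi> \<in> borel_measurable (F a)" "bounded (\<xi> ` space M)"
    and \<eta>: "\<eta> \<in> borel_measurable (F c)" "bounded (\<eta> ` space M)"
  shows "expectation (\<lambda>\<omega>. (\<xi> \<omega> * (W b \<omega> - W a \<omega>)) * (\<eta> \<omega> * (W d \<omega> - W c \<omega>)))
    = expectation (\<lambda>\<omega>. \<xi> \<omega> * \<eta> \<omega>) * max 0 (min b d - c)"
proof -
  have \<xi>c: "\<xi> \<in> borel_measurable (F c)" using \<xi> assms measurable_F_mono by blast
  have P: "(\<lambda>\<omega>. \<xi> \<omega> * \<eta> \<omega>) \<in> borel_measurable (F c)" "bounded ((\<lambda>\<omega>. \<xi> \<omega> * \<eta> \<omega>) ` space M)"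
    using \<xi>c \<eta> \<xi> bounded_image_mult by auto
  have PM: "(\<lambda>\<omega>. \<xi> \<omega> * \<eta> \<omega>) \<in> borel_measurable M" using P(1) by (rule measurable_from_F)
  have I: "integrable M (\<lambda>\<omega>. (\<xi> \<omega> * \<eta> \<omega>) * ((W e \<omega> - W a' \<omega>) * (W d' \<omega> - W c' \<omega>)))"
    if "0 \<le> a'" "a' \<le> e" "0 \<le> c'" "c' \<le> d'" for e a' c' d'
    using that by (intro integrable_bounded_mult PM P integrable_increment_mult) auto
  have orth: "expectation (\<lambda>\<omega>. (\<xi> \<omega> * \<eta> \<omega>) * ((W e \<omega> - W a \<omega>) * (W d \<omega> - W c \<omega>))) = 0"
    if "a \<le> e" "e \<le> c" for e
  proof -
    have Y: "(\<lambda>\<omega>. (\<xi> \<omega> * \<eta> \<omega>) * (W e \<omega> - W a \<omega>)) \<in> borel_measurable (F c)"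
      using assms that by (intro borel_measurable_times[OF P(1)] borel_measurable_diff W_measurable_F) auto
    have Yi: "integrable M (\<lambda>\<omega>. (\<xi> \<omega> * \<eta> \<omega>) * (W e \<omega> - W a \<omega>))"
      using increment_moment(1)[of a e 1] assms that by (intro integrable_bounded_mult PM P) auto
    show ?thesis
      using expectation_times_increment(2)[OF _ _ Y Yi, of d "\<lambda>x. x"] assms
        increment_moment(1)[of c d 1] increment_moment(2)[of c d] by (simp add: mult.assoc)
  qed
  have eq: "expectation (\<lambda>\<omega>. (\<xi> \<omega> * (W b \<omega> - W a \<omega>)) * (\<eta> \<omega> * (W d \<omega> - W c \<omega>)))
    = expectation (\<lambda>\<omega>. (\<xi> \<omega> * \<eta> \<omega>) * ((W b \<omega> - W a \<omega>) * (W d \<omega> - W c \<omega>)))"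
    by (simp add: mult_ac)
  show ?thesis
  proof (cases "b \<le> c")
    case True
    then show ?thesis using orth[of b] eq assms by (simp add: max_def min_def)
  next
    case False
    have "expectation (\<lambda>\<omega>. (\<xi> \<omega> * \<eta> \<omega>) * ((W b \<omega> - W a \<omega>) * (W d \<omega> - W c \<omega>)))
      = expectation (\<lambda>\<omega>. (\<xi> \<omega> * \<eta> \<omega>) * ((W c \<omega> - W a \<omega>) * (W d \<omega> - W c \<omega>))
          + (\<xi> \<omega> * \<eta> \<omega>) * ((W b \<omega> - W c \<omega>) * (W d \<omega> - W c \<omega>)))"
      by (simp add: algebra_simps)
    also have "\<dots> = 0 + expectation (\<lambda>\<omega>. (\<xi> \<omega> * \<eta> \<omega>) * ((W b \<omega> - W c \<omega>) * (W d \<omega> - W c \<omega>)))"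
      using I assms False orth[of c] by (subst Bochner_Integration.integral_add) auto
    also have "\<dots> = expectation (\<lambda>\<omega>. \<xi> \<omega> * \<eta> \<omega>) * (min b d - c)"
    proof (cases "b \<le> d")
      case True
      then show ?thesis
        using expectation_increment_product_from_start[OF _ _ _ P, of b d] assms False by simp
    next
      case f: False
      then show ?thesis
        using expectation_increment_product_from_start[OF _ _ _ P, of d b] assms False
        by (simp add: mult.commute[of "W b _ - W c _"])
    qed
    finally show ?thesis using eq False assms by simp
  qed
qed

text \<open>
  The Ito isometry in bilinear form. The two intervals may overlap in any way; hence sums of
  elementary integrals over different partitions can be treated without a common refinement.
\<close>

lemma expectation_increment_product:
  assumes "0 \<le> a" "a \<le> b" "0 \<le> c" "c \<le> d"
    and \<xi>: "\<xi> \<in> borel_measurable (F a)" "bounded (\<xi> ` space M)"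
    and \<eta>: "\<eta> \<in> borel_measurable (F c)" "bounded (\<eta> ` space M)"
  shows "expectation (\<lambda>\<omega>. (\<xi> \<omega> * (W b \<omega> - W a \<omega>)) * (\<eta> \<omega> * (W d \<omega> - W c \<omega>)))
    = expectation (\<lambda>\<omega>. \<xi> \<omega> * \<eta> \<omega>) * measure lborel ({a..<b} \<inter> {c..<d})"
proof -
  have m: "measure lborel ({a..<b} \<inter> {c..<d}) = max 0 (min b d - max a c)"
  proof -
    have "{a..<b} \<inter> {c..<d} = {max a c..<min b d}" by auto
    then show ?thesis by (cases "max a c \<le> min b d") auto
  qed
  show ?thesis
  proof (cases "a \<le> c")
    case True
    then show ?thesis
      using expectation_increment_product_ordered[OF assms(1,2) True assms(4) \<xi> \<eta>] m by (simp add: max_def)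
  next
    case False
    then show ?thesis
      using expectation_increment_product_ordered[OF assms(3,4) _ assms(2) \<eta> \<xi>] m
      by (simp add: mult.commute min.commute max_def)
  qed
qed

text \<open>
  Both sides are the same double sum over pairs of intervals. The intervals need not be disjoint,
  which is what makes differences of elementary integrals instances of this lemma.
\<close>

lemma simple_isometry:
  assumes J: "finite J"
    and ab: "\<And>j. j \<in> J \<Longrightarrow> 0 \<le> a j \<and> a j \<le> b j"
    and \<xi>: "\<And>j. j \<in> J \<Longrightarrow> \<xi> j \<in> borel_measurable (F (a j))"
      "\<And>j. j \<in> J \<Longrightarrow> bounded (\<xi> j ` space M)"
  shows "(\<integral>\<^sup>+\<omega>. ennreal ((\<Sum>j\<in>J. \<xi> j \<omega> * (W (b j) \<omega> - W (a j) \<omega>))\<^sup>2) \<partial>M) =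
    (\<integral>\<^sup>+\<omega>. \<integral>\<^sup>+s. ennreal ((\<Sum>j\<in>J. \<xi> j \<omega> * indicator {a j..<b j} s)\<^sup>2) \<partial>lborel \<partial>M)"
proof -
  let ?l = "\<lambda>i j. measure lborel ({a i..<b i} \<inter> {a j..<b j})"
  have \<xi>M: "\<xi> j \<in> borel_measurable M" if "j \<in> J" for j
    using \<xi> that measurable_from_F by blast
  have int: "integrable M (\<lambda>\<omega>. (\<xi> i \<omega> * (W (b i) \<omega> - W (a i) \<omega>)) * (\<xi> j \<omega> * (W (b j) \<omega> - W (a j) \<omega>)))"
    if "i \<in> J" "j \<in> J" for i j
  proof -
    have "integrable M (\<lambda>\<omega>. (\<xi> i \<omega> * \<xi> j \<omega>) * ((W (b i) \<omega> - W (a i) \<omega>) * (W (b j) \<omega> - W (a j) \<omega>)))"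
      using that ab by (intro integrable_bounded_mult borel_measurable_times bounded_image_mult \<xi>M \<xi> integrable_increment_mult) auto
    then show ?thesis by (simp add: mult_ac)
  qed
  have int2: "integrable M (\<lambda>\<omega>. \<xi> i \<omega> * \<xi> j \<omega>)" if "i \<in> J" "j \<in> J" for i j
    using that integrable_bounded_mult[OF \<xi>M \<xi>(2) integrable_bounded_mult[OF \<xi>M \<xi>(2), of _ "\<lambda>_. 1"]] by auto
  have "(\<integral>\<^sup>+\<omega>. ennreal ((\<Sum>j\<in>J. \<xi> j \<omega> * (W (b j) \<omega> - W (a j) \<omega>))\<^sup>2) \<partial>M) =
    ennreal (expectation (\<lambda>\<omega>. (\<Sum>j\<in>J. \<xi> j \<omega> * (W (b j) \<omega> - W (a j) \<omega>))\<^sup>2))"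
    by (intro nn_integral_eq_integral AE_I2 zero_le_power2)
       (auto simp: power2_eq_square sum_product intro!: Bochner_Integration.integrable_sum int)
  also have "expectation (\<lambda>\<omega>. (\<Sum>j\<in>J. \<xi> j \<omega> * (W (b j) \<omega> - W (a j) \<omega>))\<^sup>2) =
    (\<Sum>i\<in>J. \<Sum>j\<in>J. expectation (\<lambda>\<omega>. (\<xi> i \<omega> * (W (b i) \<omega> - W (a i) \<omega>)) * (\<xi> j \<omega> * (W (b j) \<omega> - W (a j) \<omega>))))"
    using int by (simp add: power2_eq_square sum_product Bochner_Integration.integral_sum Bochner_Integration.integrable_sum)
  also have "\<dots> = (\<Sum>i\<in>J. \<Sum>j\<in>J. expectation (\<lambda>\<omega>. \<xi> i \<omega> * \<xi> j \<omega>) * ?l i j)"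
    using ab \<xi> by (intro sum.cong refl expectation_increment_product) auto
  also have "\<dots> = expectation (\<lambda>\<omega>. \<Sum>i\<in>J. \<Sum>j\<in>J. \<xi> i \<omega> * \<xi> j \<omega> * ?l i j)"
    using int2 by (simp add: Bochner_Integration.integral_sum Bochner_Integration.integrable_sum)
  finally have L: "(\<integral>\<^sup>+\<omega>. ennreal ((\<Sum>j\<in>J. \<xi> j \<omega> * (W (b j) \<omega> - W (a j) \<omega>))\<^sup>2) \<partial>M) =
    ennreal (expectation (\<lambda>\<omega>. \<Sum>i\<in>J. \<Sum>j\<in>J. \<xi> i \<omega> * \<xi> j \<omega> * ?l i j))" .
  have inner: "integrable lborel (\<lambda>s. (\<Sum>j\<in>J. \<xi> j \<omega> * indicator {a j..<b j} s)\<^sup>2)"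
    "(\<integral>s. (\<Sum>j\<in>J. \<xi> j \<omega> * indicator {a j..<b j} s)\<^sup>2 \<partial>lborel) = (\<Sum>i\<in>J. \<Sum>j\<in>J. \<xi> i \<omega> * \<xi> j \<omega> * ?l i j)" for \<omega>
  proof -
    have eq: "(\<Sum>j\<in>J. \<xi> j \<omega> * indicator {a j..<b j} s)\<^sup>2 =
      (\<Sum>i\<in>J. \<Sum>j\<in>J. (\<xi> i \<omega> * \<xi> j \<omega>) * indicator ({a i..<b i} \<inter> {a j..<b j}) s)" for s :: real
      by (simp add: power2_eq_square sum_product indicator_inter_arith mult_ac del: Int_atLeastLessThan)
    have fin: "integrable lborel (indicator ({a i..<b i} \<inter> {a j..<b j}) :: real \<Rightarrow> real)" for i j
    proof -
      have "emeasure lborel ({a i..<b i} \<inter> {a j..<b j}) \<le> emeasure lborel {a i..b i}"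
        by (intro emeasure_mono) auto
      also have "\<dots> < \<infinity>" by (simp add: emeasure_lborel_Icc_eq)
      finally show ?thesis by (subst integrable_indicator_iff) auto
    qed
    show "integrable lborel (\<lambda>s. (\<Sum>j\<in>J. \<xi> j \<omega> * indicator {a j..<b j} s)\<^sup>2)"
      unfolding eq using fin by (intro Bochner_Integration.integrable_sum integrable_mult_right) auto
    show "(\<integral>s. (\<Sum>j\<in>J. \<xi> j \<omega> * indicator {a j..<b j} s)\<^sup>2 \<partial>lborel) = (\<Sum>i\<in>J. \<Sum>j\<in>J. \<xi> i \<omega> * \<xi> j \<omega> * ?l i j)"
      unfolding eq using fin
      by (simp add: Bochner_Integration.integral_sum Bochner_Integration.integrable_sum)
  qed
  have "(\<integral>\<^sup>+\<omega>. \<integral>\<^sup>+s. ennreal ((\<Sum>j\<in>J. \<xi> j \<omega> * indicator {a j..<b j} s)\<^sup>2) \<partial>lborel \<partial>M)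
    = (\<integral>\<^sup>+\<omega>. ennreal (\<Sum>i\<in>J. \<Sum>j\<in>J. \<xi> i \<omega> * \<xi> j \<omega> * ?l i j) \<partial>M)"
    using inner by (simp add: nn_integral_eq_integral)
  also have "\<dots> = ennreal (expectation (\<lambda>\<omega>. \<Sum>i\<in>J. \<Sum>j\<in>J. \<xi> i \<omega> * \<xi> j \<omega> * ?l i j))"
  proof (intro nn_integral_eq_integral AE_I2)
    show "0 \<le> (\<Sum>i\<in>J. \<Sum>j\<in>J. \<xi> i \<omega> * \<xi> j \<omega> * ?l i j)" for \<omega>
      unfolding inner(2)[symmetric] by (intro integral_nonneg_AE) auto
  qed (use int2 in \<open>auto intro!: Bochner_Integration.integrable_sum\<close>)
  finally show ?thesis using L by simp
qed

lemma elementary_nodes: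
  assumes "elementary M F t m p \<xi>" "j < m"
  shows "0 \<le> p j" "p j \<le> p (Suc j)" "p (Suc j) \<le> t"
proof -
  have step: "\<And>j. j < m \<Longrightarrow> p j \<le> p (Suc j)" and ends: "p 0 = 0" "p m = t"
    using assms(1) unfolding elementary_def by auto
  have mono: "p i \<le> p k" if "i \<le> k" "k \<le> m" for i k
    using that
  proof (induction k rule: dec_induct)
    case (step n)
    then show ?case using \<open>\<And>j. j < m \<Longrightarrow> p j \<le> p (Suc j)\<close>[of n] by simp
  qed simp
  show "0 \<le> p j" "p j \<le> p (Suc j)" "p (Suc j) \<le> t"
    using mono[of 0 j] mono[of "Suc j" m] step[OF assms(2)] ends assms(2) by auto
qed

lemma elementary_value:
  assumes "elementary M F t m p \<xi>" "j < m"
  shows "\<xi> j \<in> borel_measurable (F (p j))" "bounded (\<xi> j ` space M)" "\<xi> j \<in> borel_measurable M"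
  using assms measurable_from_F[of "\<xi> j" "p j"] unfolding elementary_def by auto

lemma elementary_process_outside:
  assumes "elementary M F t m p \<xi>" "r \<notin> {0..<t}"
  shows "elementary_process m p \<xi> r \<omega> = 0"
  unfolding elementary_process_def
proof (intro sum.neutral ballI)
  fix j assume "j \<in> {..<m}"
  then have "r \<notin> {p j..<p (Suc j)}"
    using elementary_nodes[OF assms(1), of j] assms(2) by auto
  then show "\<xi> j \<omega> * indicator {p j..<p (Suc j)} r = 0" by simp
qed

lemma elementary_process_measurable:
  assumes "elementary M F t m p \<xi>"
  shows "(\<lambda>z. elementary_process m p \<xi> (snd z) (fst z)) \<in> borel_measurable (M \<Otimes>\<^sub>M lborel)"
  unfolding elementary_process_def
  using elementary_value(3)[OF assms]
  by (intro borel_measurable_sum borel_measurable_times) (auto intro!: measurable_compose[OF measurable_fst])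

lemma elementary_integral_measurable:
  assumes el: "elementary M F t m p \<xi>"
  shows "elementary_integral W m p \<xi> \<in> borel_measurable M"
  unfolding elementary_integral_def
proof (intro borel_measurable_sum borel_measurable_times borel_measurable_diff W_measurable)
  fix j assume "j \<in> {..<m}"
  then show "\<xi> j \<in> borel_measurable M" "0 \<le> p j" "0 \<le> p (Suc j)"
    using elementary_value(3)[OF el, of j] elementary_nodes(1,2)[OF el, of j] by auto
qed

text \<open>
  Approximate the integrals over \<open>[0,t]\<close> and \<open>[0,s]\<close> separately by elementary ones. The
  difference of the two approximations minus \<open>\<xi> (W t - W s)\<close> is a finite sum to which the
  isometry applies, and its integrand tends to \<open>(H - \<xi>) 1\<^bsub>[s,t)\<^esub>\<close>. The factor \<open>9\<close> stems from two
  applications of \<open>(x + y + z)\<^sup>2 \<le> 3 x\<^sup>2 + 3 y\<^sup>2 + 3 z\<^sup>2\<close>.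
\<close>

lemma ito_increment_bound:
  assumes H [measurable]: "(\<lambda>z. H (snd z) (fst z)) \<in> borel_measurable (M \<Otimes>\<^sub>M lborel)"
    and st: "0 \<le> s" "s \<le> t"
    and I: "has_ito_integral M F W H t I" and J: "has_ito_integral M F W H s J"
    and \<xi>: "\<xi> \<in> borel_measurable (F s)" "bounded (\<xi> ` space M)"
  shows "(\<integral>\<^sup>+\<omega>. ennreal ((I \<omega> - J \<omega> - \<xi> \<omega> * (W t \<omega> - W s \<omega>))\<^sup>2) \<partial>M) \<le>
    9 * (\<integral>\<^sup>+\<omega>. (\<integral>\<^sup>+r\<in>{s..t}. ennreal ((H r \<omega> - \<xi> \<omega>)\<^sup>2) \<partial>lborel) \<partial>M)" (is "?L \<le> 9 * ?Q")
proof -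
  have [measurable]: "\<xi> \<in> borel_measurable M" "I \<in> borel_measurable M" "J \<in> borel_measurable M"
    using \<xi> measurable_from_F I J unfolding has_ito_integral_def by auto
  have [measurable]: "W t \<in> borel_measurable M" "W s \<in> borel_measurable M"
    using W_measurable st by auto
  obtain m p x where el: "\<And>k. elementary M F t (m k) (p k) (x k)"
    and a0: "(\<lambda>k. \<integral>\<^sup>+\<omega>. (\<integral>\<^sup>+r\<in>{0..t}.
            ennreal ((H r \<omega> - elementary_process (m k) (p k) (x k) r \<omega>)\<^sup>2) \<partial>lborel) \<partial>M) \<longlonglongrightarrow> 0"
    and d0: "(\<lambda>k. \<integral>\<^sup>+\<omega>. ennreal ((I \<omega> - elementary_integral W (m k) (p k) (x k) \<omega>)\<^sup>2) \<partial>M) \<longlonglongrightarrow> 0"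
    using I unfolding has_ito_integral_def by blast
  obtain m' p' x' where el': "\<And>k. elementary M F s (m' k) (p' k) (x' k)"
    and a'0: "(\<lambda>k. \<integral>\<^sup>+\<omega>. (\<integral>\<^sup>+r\<in>{0..s}.
            ennreal ((H r \<omega> - elementary_process (m' k) (p' k) (x' k) r \<omega>)\<^sup>2) \<partial>lborel) \<partial>M) \<longlonglongrightarrow> 0"
    and d'0: "(\<lambda>k. \<integral>\<^sup>+\<omega>. ennreal ((J \<omega> - elementary_integral W (m' k) (p' k) (x' k) \<omega>)\<^sup>2) \<partial>M) \<longlonglongrightarrow> 0"
    using J unfolding has_ito_integral_def by blast
  define e where "e k = elementary_process (m k) (p k) (x k)" for k
  define e' where "e' k = elementary_process (m' k) (p' k) (x' k)" for k
  define E where "E k = elementary_integral W (m k) (p k) (x k)" for k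
  define E' where "E' k = elementary_integral W (m' k) (p' k) (x' k)" for k
  have em [measurable]: "(\<lambda>z. e k (snd z) (fst z)) \<in> borel_measurable (M \<Otimes>\<^sub>M lborel)"
    "(\<lambda>z. e' k (snd z) (fst z)) \<in> borel_measurable (M \<Otimes>\<^sub>M lborel)" for k
    unfolding e_def e'_def using el el' by (auto intro!: elementary_process_measurable)
  have [measurable]: "E k \<in> borel_measurable M" "E' k \<in> borel_measurable M" for k
    unfolding E_def E'_def by (rule elementary_integral_measurable[OF el], rule elementary_integral_measurable[OF el'])
  let ?a = "\<lambda>k. \<integral>\<^sup>+\<omega>. (\<integral>\<^sup>+r\<in>{0..t}. ennreal ((H r \<omega> - e k r \<omega>)\<^sup>2) \<partial>lborel) \<partial>M"
  let ?a' = "\<lambda>k. \<integral>\<^sup>+\<omega>. (\<integral>\<^sup>+r\<in>{0..s}. ennreal ((H r \<omega> - e' k r \<omega>)\<^sup>2) \<partial>lborel) \<partial>M"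
  let ?d = "\<lambda>k. \<integral>\<^sup>+\<omega>. ennreal ((I \<omega> - E k \<omega>)\<^sup>2) \<partial>M"
  let ?d' = "\<lambda>k. \<integral>\<^sup>+\<omega>. ennreal ((J \<omega> - E' k \<omega>)\<^sup>2) \<partial>M"
  let ?i = "\<lambda>k \<omega> r. e k r \<omega> - e' k r \<omega> - \<xi> \<omega> * indicator {s..<t} r"
  let ?S = "\<lambda>k. \<integral>\<^sup>+\<omega>. ennreal ((E k \<omega> - E' k \<omega> - \<xi> \<omega> * (W t \<omega> - W s \<omega>))\<^sup>2) \<partial>M"
  have iso: "?S k = (\<integral>\<^sup>+\<omega>. \<integral>\<^sup>+r. ennreal ((?i k \<omega> r)\<^sup>2) \<partial>lborel \<partial>M)" for k
  proof -
    (* The two approximants and the single step on [s,t), with their signs, as one family indexed by a disjoint sum. *)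
    let ?J = "{..<m k} <+> ({..<m' k} <+> {()})"
    let ?A = "case_sum (p k) (case_sum (p' k) (\<lambda>_. s))"
    let ?B = "case_sum (\<lambda>j. p k (Suc j)) (case_sum (\<lambda>j. p' k (Suc j)) (\<lambda>_. t))"
    let ?X = "case_sum (x k) (case_sum (\<lambda>j \<omega>. - x' k j \<omega>) (\<lambda>_ \<omega>. - \<xi> \<omega>))"
    have neg: "bounded ((\<lambda>\<omega>. - f \<omega>) ` space M)" if "bounded (f ` space M)" for f :: "'a \<Rightarrow> real"
      using that unfolding bounded_real by auto
    have isoJ: "(\<integral>\<^sup>+\<omega>. ennreal ((\<Sum>j\<in>?J. ?X j \<omega> * (W (?B j) \<omega> - W (?A j) \<omega>))\<^sup>2) \<partial>M) =
      (\<integral>\<^sup>+\<omega>. \<integral>\<^sup>+r. ennreal ((\<Sum>j\<in>?J. ?X j \<omega> * indicator {?A j..<?B j} r)\<^sup>2) \<partial>lborel \<partial>M)"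
      using elementary_nodes[OF el[of k]] elementary_nodes[OF el'[of k]] st \<xi> neg
        elementary_value[OF el[of k]] elementary_value[OF el'[of k]]
      by (intro simple_isometry) (auto intro!: borel_measurable_uminus)
    have split: "(\<Sum>j\<in>?J. f j) =
      (\<Sum>j<m k. f (Inl j)) + ((\<Sum>j<m' k. f (Inr (Inl j))) + f (Inr (Inr ())))" for f :: "_ \<Rightarrow> real"
      by (simp add: sum.Plus)
    have dW: "(\<Sum>j\<in>?J. ?X j \<omega> * (W (?B j) \<omega> - W (?A j) \<omega>)) =
      E k \<omega> - E' k \<omega> - \<xi> \<omega> * (W t \<omega> - W s \<omega>)" for \<omega>
      unfolding split by (simp add: E_def E'_def elementary_integral_def sum_negf)
    have ind: "(\<Sum>j\<in>?J. ?X j \<omega> * indicator {?A j..<?B j} r) = ?i k \<omega> r" for \<omega> r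
      unfolding split by (simp add: e_def e'_def elementary_process_def sum_negf)
    show ?thesis using isoJ unfolding dW ind .
  qed
  have S: "?S k \<le> 3 * ?a k + 3 * ?a' k + 3 * ?Q" for k
  proof -
    have pt: "ennreal ((?i k \<omega> r)\<^sup>2) \<le> 3 * (ennreal ((H r \<omega> - e k r \<omega>)\<^sup>2) * indicator {0..t} r)
      + 3 * (ennreal ((H r \<omega> - e' k r \<omega>)\<^sup>2) * indicator {0..s} r)
      + 3 * (ennreal ((H r \<omega> - \<xi> \<omega>)\<^sup>2) * indicator {s..t} r)" for \<omega> r
    proof -
      consider "r \<in> {0..<s}" | "r \<in> {s..<t}" | "r \<notin> {0..<t}" by force
      then show ?thesis
      proof cases
        case 1
        then show ?thesis
          using ennreal_square_add3_le[of "-(H r \<omega> - e k r \<omega>)" "H r \<omega> - e' k r \<omega>" 0] st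
          by (simp add: power2_commute)
      next
        case 2
        then have "e' k r \<omega> = 0"
          unfolding e'_def using elementary_process_outside[OF el'] by auto
        have "ennreal ((?i k \<omega> r)\<^sup>2) \<le> 3 * ennreal ((H r \<omega> - e k r \<omega>)\<^sup>2) + 3 * ennreal ((H r \<omega> - \<xi> \<omega>)\<^sup>2)"
          using ennreal_square_add3_le[of "-(H r \<omega> - e k r \<omega>)" 0 "H r \<omega> - \<xi> \<omega>"] 2 \<open>e' k r \<omega> = 0\<close>
          by (simp add: power2_commute)
        also have "\<dots> \<le> 3 * ennreal ((H r \<omega> - e k r \<omega>)\<^sup>2)
            + 3 * (ennreal ((H r \<omega> - e' k r \<omega>)\<^sup>2) * indicator {0..s} r) + 3 * ennreal ((H r \<omega> - \<xi> \<omega>)\<^sup>2)"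
          by (intro add_right_mono) simp
        finally show ?thesis using 2 st by simp
      next
        case 3
        then have "e' k r \<omega> = 0" "e k r \<omega> = 0"
          unfolding e_def e'_def using elementary_process_outside[OF el'] elementary_process_outside[OF el] st by auto
        then show ?thesis using 3 st by (simp add: indicator_def)
      qed
    qed
    have "?S k \<le> (\<integral>\<^sup>+\<omega>. \<integral>\<^sup>+r. 3 * (ennreal ((H r \<omega> - e k r \<omega>)\<^sup>2) * indicator {0..t} r)
      + 3 * (ennreal ((H r \<omega> - e' k r \<omega>)\<^sup>2) * indicator {0..s} r)
      + 3 * (ennreal ((H r \<omega> - \<xi> \<omega>)\<^sup>2) * indicator {s..t} r) \<partial>lborel \<partial>M)"
      unfolding iso by (intro nn_integral_mono pt)
    also have "\<dots> = (\<integral>\<^sup>+\<omega>. 3 * (\<integral>\<^sup>+r\<in>{0..t}. ennreal ((H r \<omega> - e k r \<omega>)\<^sup>2) \<partial>lborel)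
        + 3 * (\<integral>\<^sup>+r\<in>{0..s}. ennreal ((H r \<omega> - e' k r \<omega>)\<^sup>2) \<partial>lborel)
        + 3 * (\<integral>\<^sup>+r\<in>{s..t}. ennreal ((H r \<omega> - \<xi> \<omega>)\<^sup>2) \<partial>lborel) \<partial>M)"
    proof (intro nn_integral_cong)
      fix \<omega> assume \<omega>: "\<omega> \<in> space M"
      have [measurable]: "(\<lambda>r. H r \<omega>) \<in> borel_measurable lborel"
        "(\<lambda>r. e k r \<omega>) \<in> borel_measurable lborel" "(\<lambda>r. e' k r \<omega>) \<in> borel_measurable lborel"
        using measurable_compose[OF measurable_Pair1'[OF \<omega>] H]
          measurable_compose[OF measurable_Pair1'[OF \<omega>] em(1)]
          measurable_compose[OF measurable_Pair1'[OF \<omega>] em(2)] by simp_all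
      show "(\<integral>\<^sup>+r. 3 * (ennreal ((H r \<omega> - e k r \<omega>)\<^sup>2) * indicator {0..t} r)
          + 3 * (ennreal ((H r \<omega> - e' k r \<omega>)\<^sup>2) * indicator {0..s} r)
          + 3 * (ennreal ((H r \<omega> - \<xi> \<omega>)\<^sup>2) * indicator {s..t} r) \<partial>lborel) =
        3 * (\<integral>\<^sup>+r\<in>{0..t}. ennreal ((H r \<omega> - e k r \<omega>)\<^sup>2) \<partial>lborel)
        + 3 * (\<integral>\<^sup>+r\<in>{0..s}. ennreal ((H r \<omega> - e' k r \<omega>)\<^sup>2) \<partial>lborel)
        + 3 * (\<integral>\<^sup>+r\<in>{s..t}. ennreal ((H r \<omega> - \<xi> \<omega>)\<^sup>2) \<partial>lborel)"
        by (simp add: nn_integral_add nn_integral_cmult)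
    qed
    also have "\<dots> = 3 * ?a k + 3 * ?a' k + 3 * ?Q"
      by (simp add: nn_integral_add nn_integral_cmult)
    finally show ?thesis .
  qed
  have "?L \<le> 3 * ?d k + 3 * ?d' k + 3 * (3 * ?a k + 3 * ?a' k + 3 * ?Q)" for k
  proof -
    have "?L \<le> (\<integral>\<^sup>+\<omega>. 3 * ennreal ((I \<omega> - E k \<omega>)\<^sup>2) + 3 * ennreal ((J \<omega> - E' k \<omega>)\<^sup>2)
       + 3 * ennreal ((E k \<omega> - E' k \<omega> - \<xi> \<omega> * (W t \<omega> - W s \<omega>))\<^sup>2) \<partial>M)"
    proof (intro nn_integral_mono)
      fix \<omega>
      have *: "I \<omega> - J \<omega> - \<xi> \<omega> * (W t \<omega> - W s \<omega>) =
        (I \<omega> - E k \<omega>) + - (J \<omega> - E' k \<omega>) + (E k \<omega> - E' k \<omega> - \<xi> \<omega> * (W t \<omega> - W s \<omega>))" by simp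
      show "ennreal ((I \<omega> - J \<omega> - \<xi> \<omega> * (W t \<omega> - W s \<omega>))\<^sup>2)
        \<le> 3 * ennreal ((I \<omega> - E k \<omega>)\<^sup>2) + 3 * ennreal ((J \<omega> - E' k \<omega>)\<^sup>2)
         + 3 * ennreal ((E k \<omega> - E' k \<omega> - \<xi> \<omega> * (W t \<omega> - W s \<omega>))\<^sup>2)"
        unfolding * by (rule order_trans[OF ennreal_square_add3_le]) (simp add: power2_commute)
    qed
    also have "\<dots> = 3 * ?d k + 3 * ?d' k + 3 * ?S k"
      by (simp add: nn_integral_add nn_integral_cmult)
    also have "\<dots> \<le> 3 * ?d k + 3 * ?d' k + 3 * (3 * ?a k + 3 * ?a' k + 3 * ?Q)"
      by (intro add_left_mono mult_left_mono S) auto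
    finally show ?thesis .
  qed
  moreover have "(\<lambda>k. 3 * ?d k + 3 * ?d' k + 3 * (3 * ?a k + 3 * ?a' k + 3 * ?Q))
      \<longlonglongrightarrow> 3 * 0 + 3 * 0 + 3 * (3 * 0 + 3 * 0 + 3 * ?Q)"
    using a0 a'0 d0 d'0 unfolding e_def e'_def E_def E'_def
    by (intro tendsto_add ennreal_tendsto_cmult tendsto_const) auto
  ultimately have "?L \<le> 3 * 0 + 3 * 0 + 3 * (3 * 0 + 3 * 0 + 3 * ?Q)"
    by (intro LIMSEQ_le_const) auto
  then show ?thesis by (simp add: mult.assoc[symmetric])
qed

text \<open>
  Truncate \<open>\<xi>\<close> at level \<open>N\<close> and let \<open>N \<rightarrow> \<infinity>\<close>: Fatou's lemma on the left, dominated convergence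
  on the right.
\<close>

lemma ito_increment_bound_unbounded:
  assumes H [measurable]: "(\<lambda>z. H (snd z) (fst z)) \<in> borel_measurable (M \<Otimes>\<^sub>M lborel)"
    and st: "0 \<le> s" "s \<le> t"
    and I: "has_ito_integral M F W H t I" and J: "has_ito_integral M F W H s J"
    and \<xi>: "\<xi> \<in> borel_measurable (F s)" "integrable M (\<lambda>\<omega>. (\<xi> \<omega>)\<^sup>2)"
  shows "(\<integral>\<^sup>+\<omega>. ennreal ((I \<omega> - J \<omega> - \<xi> \<omega> * (W t \<omega> - W s \<omega>))\<^sup>2) \<partial>M) \<le>
    18 * (\<integral>\<^sup>+\<omega>. (\<integral>\<^sup>+r\<in>{s..t}. ennreal ((H r \<omega> - \<xi> \<omega>)\<^sup>2) \<partial>lborel) \<partial>M)" (is "?L \<le> 18 * ?Q")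
proof -
  have [measurable]: "\<xi> \<in> borel_measurable M" "I \<in> borel_measurable M" "J \<in> borel_measurable M"
    using \<xi> measurable_from_F I J unfolding has_ito_integral_def by auto
  have [measurable]: "W t \<in> borel_measurable M" "W s \<in> borel_measurable M"
    using W_measurable st by auto
  define \<zeta> where "\<zeta> N \<omega> = max (- real N) (min (real N) (\<xi> \<omega>))" for N \<omega>
  have \<zeta>F: "\<zeta> N \<in> borel_measurable (F s)" for N unfolding \<zeta>_def using \<xi>(1) by measurable
  have [measurable]: "\<zeta> N \<in> borel_measurable M" for N unfolding \<zeta>_def by measurable
  have \<zeta>b: "bounded (\<zeta> N ` space M)" for N
    unfolding bounded_real \<zeta>_def by (intro exI[of _ "real N"]) auto
  have ev: "\<forall>\<^sub>F N in sequentially. \<zeta> N \<omega> = \<xi> \<omega>" for \<omega>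
    using eventually_ge_at_top[of "nat \<lceil>\<bar>\<xi> \<omega>\<bar>\<rceil>"]
    by eventually_elim (auto simp: \<zeta>_def nat_le_iff ceiling_le_iff)
  have lim: "(\<lambda>N. \<integral>\<^sup>+\<omega>. ennreal ((\<xi> \<omega> - \<zeta> N \<omega>)\<^sup>2) \<partial>M) \<longlonglongrightarrow> (\<integral>\<^sup>+\<omega>. 0 \<partial>M)"
  proof (rule nn_integral_dominated_convergence[where w="\<lambda>\<omega>. ennreal ((\<xi> \<omega>)\<^sup>2)"])
    show "(\<integral>\<^sup>+\<omega>. ennreal ((\<xi> \<omega>)\<^sup>2) \<partial>M) < \<infinity>"
      using \<xi>(2) by (simp add: nn_integral_eq_integral)
    show "AE \<omega> in M. ennreal ((\<xi> \<omega> - \<zeta> N \<omega>)\<^sup>2) \<le> ennreal ((\<xi> \<omega>)\<^sup>2)" for N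
      by (intro AE_I2 ennreal_leI) (auto simp: \<zeta>_def abs_le_square_iff[symmetric])
    show "AE \<omega> in M. (\<lambda>N. ennreal ((\<xi> \<omega> - \<zeta> N \<omega>)\<^sup>2)) \<longlonglongrightarrow> 0"
    proof (intro AE_I2 tendsto_eventually)
      show "\<forall>\<^sub>F N in sequentially. ennreal ((\<xi> \<omega> - \<zeta> N \<omega>)\<^sup>2) = 0" for \<omega>
        using ev[of \<omega>] by eventually_elim simp
    qed
  qed auto
  have step: "(\<integral>\<^sup>+\<omega>. ennreal ((I \<omega> - J \<omega> - \<zeta> N \<omega> * (W t \<omega> - W s \<omega>))\<^sup>2) \<partial>M) \<le>
    9 * (2 * ?Q + 2 * (ennreal (t - s) * (\<integral>\<^sup>+\<omega>. ennreal ((\<xi> \<omega> - \<zeta> N \<omega>)\<^sup>2) \<partial>M)))" for N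
  proof -
    have pt: "ennreal ((H r \<omega> - \<zeta> N \<omega>)\<^sup>2) \<le> 2 * ennreal ((H r \<omega> - \<xi> \<omega>)\<^sup>2) + 2 * ennreal ((\<xi> \<omega> - \<zeta> N \<omega>)\<^sup>2)" for r \<omega>
    proof -
      have "ennreal ((H r \<omega> - \<zeta> N \<omega>)\<^sup>2) \<le> ennreal (2 * (H r \<omega> - \<xi> \<omega>)\<^sup>2 + 2 * (\<xi> \<omega> - \<zeta> N \<omega>)\<^sup>2)"
        using square_add_le[of "H r \<omega> - \<xi> \<omega>" "\<xi> \<omega> - \<zeta> N \<omega>"] by (intro ennreal_leI) simp
      also have "\<dots> = 2 * ennreal ((H r \<omega> - \<xi> \<omega>)\<^sup>2) + 2 * ennreal ((\<xi> \<omega> - \<zeta> N \<omega>)\<^sup>2)"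
        by (simp add: ennreal_plus ennreal_mult)
      finally show ?thesis .
    qed
    have "(\<integral>\<^sup>+\<omega>. (\<integral>\<^sup>+r\<in>{s..t}. ennreal ((H r \<omega> - \<zeta> N \<omega>)\<^sup>2) \<partial>lborel) \<partial>M)
      \<le> (\<integral>\<^sup>+\<omega>. (\<integral>\<^sup>+r. 2 * (ennreal ((H r \<omega> - \<xi> \<omega>)\<^sup>2) * indicator {s..t} r)
          + 2 * (ennreal ((\<xi> \<omega> - \<zeta> N \<omega>)\<^sup>2) * indicator {s..t} r) \<partial>lborel) \<partial>M)"
    proof (intro nn_integral_mono)
      fix \<omega> and r :: real
      show "ennreal ((H r \<omega> - \<zeta> N \<omega>)\<^sup>2) * indicator {s..t} r \<le> 2 * (ennreal ((H r \<omega> - \<xi> \<omega>)\<^sup>2) * indicator {s..t} r)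
          + 2 * (ennreal ((\<xi> \<omega> - \<zeta> N \<omega>)\<^sup>2) * indicator {s..t} r)"
        using pt[of r \<omega>] by (cases "r \<in> {s..t}") auto
    qed
    also have "\<dots> = (\<integral>\<^sup>+\<omega>. 2 * (\<integral>\<^sup>+r\<in>{s..t}. ennreal ((H r \<omega> - \<xi> \<omega>)\<^sup>2) \<partial>lborel)
        + 2 * (ennreal ((\<xi> \<omega> - \<zeta> N \<omega>)\<^sup>2) * ennreal (t - s)) \<partial>M)"
    proof (intro nn_integral_cong)
      fix \<omega> assume "\<omega> \<in> space M"
      then have [measurable]: "(\<lambda>r. H r \<omega>) \<in> borel_measurable lborel"
        using measurable_compose[OF measurable_Pair1' H] by simp
      show "(\<integral>\<^sup>+r. 2 * (ennreal ((H r \<omega> - \<xi> \<omega>)\<^sup>2) * indicator {s..t} r)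
          + 2 * (ennreal ((\<xi> \<omega> - \<zeta> N \<omega>)\<^sup>2) * indicator {s..t} r) \<partial>lborel) =
        2 * (\<integral>\<^sup>+r\<in>{s..t}. ennreal ((H r \<omega> - \<xi> \<omega>)\<^sup>2) \<partial>lborel)
        + 2 * (ennreal ((\<xi> \<omega> - \<zeta> N \<omega>)\<^sup>2) * ennreal (t - s))"
        using st by (simp add: nn_integral_add nn_integral_cmult nn_integral_cmult_indicator)
    qed
    also have "\<dots> = 2 * ?Q + 2 * (ennreal (t - s) * (\<integral>\<^sup>+\<omega>. ennreal ((\<xi> \<omega> - \<zeta> N \<omega>)\<^sup>2) \<partial>M))"
      by (simp add: nn_integral_add nn_integral_cmult nn_integral_multc mult.commute[of "ennreal (t - s)"])
    finally show ?thesis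
      by (intro order_trans[OF ito_increment_bound[OF H st I J \<zeta>F \<zeta>b]] mult_left_mono) auto
  qed
  have "?L = (\<integral>\<^sup>+\<omega>. liminf (\<lambda>N. ennreal ((I \<omega> - J \<omega> - \<zeta> N \<omega> * (W t \<omega> - W s \<omega>))\<^sup>2)) \<partial>M)"
  proof (intro nn_integral_cong lim_imp_Liminf[symmetric] tendsto_eventually)
    show "\<forall>\<^sub>F N in sequentially. ennreal ((I \<omega> - J \<omega> - \<zeta> N \<omega> * (W t \<omega> - W s \<omega>))\<^sup>2)
      = ennreal ((I \<omega> - J \<omega> - \<xi> \<omega> * (W t \<omega> - W s \<omega>))\<^sup>2)" for \<omega>
      using ev[of \<omega>] by eventually_elim simp
  qed simp
  also have "\<dots> \<le> liminf (\<lambda>N. \<integral>\<^sup>+\<omega>. ennreal ((I \<omega> - J \<omega> - \<zeta> N \<omega> * (W t \<omega> - W s \<omega>))\<^sup>2) \<partial>M)"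
    by (intro nn_integral_liminf) auto
  also have "\<dots> \<le> liminf (\<lambda>N. 9 * (2 * ?Q + 2 * (ennreal (t - s) * (\<integral>\<^sup>+\<omega>. ennreal ((\<xi> \<omega> - \<zeta> N \<omega>)\<^sup>2) \<partial>M))))"
    by (intro Liminf_mono always_eventually allI step)
  also have "\<dots> = 9 * (2 * ?Q + 2 * (ennreal (t - s) * (\<integral>\<^sup>+\<omega>. 0 \<partial>M)))"
    by (intro lim_imp_Liminf tendsto_add ennreal_tendsto_cmult tendsto_const lim) auto
  finally show ?thesis by (simp add: mult.assoc[symmetric])
qed

text \<open>
  An elementary integral is a sum of terms \<open>\<xi> \<Delta>W\<close> with \<open>\<Delta>W\<close> centred and independent of
  \<open>\<zeta> \<xi>\<close>; the orthogonality survives the mean-square limit.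
\<close>

lemma ito_mean_zero:
  assumes t: "0 \<le> t" and I: "has_ito_integral M F W H t I"
    and \<zeta>: "\<zeta> \<in> borel_measurable (F 0)" "bounded (\<zeta> ` space M)"
  shows "integrable M I" "expectation (\<lambda>\<omega>. \<zeta> \<omega> * I \<omega>) = 0"
proof -
  have [measurable]: "I \<in> borel_measurable M"
    using I unfolding has_ito_integral_def by auto
  have \<zeta>M: "\<zeta> \<in> borel_measurable M" using \<zeta>(1) by (rule measurable_from_F)
  obtain B where B: "\<And>\<omega>. \<omega> \<in> space M \<Longrightarrow> \<bar>\<zeta> \<omega>\<bar> \<le> B"
    using \<zeta>(2) unfolding bounded_real by auto
  obtain m p x where el: "\<And>k. elementary M F t (m k) (p k) (x k)"
    and d0: "(\<lambda>k. \<integral>\<^sup>+\<omega>. ennreal ((I \<omega> - elementary_integral W (m k) (p k) (x k) \<omega>)\<^sup>2) \<partial>M) \<longlonglongrightarrow> 0"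
    using I unfolding has_ito_integral_def by blast
  define E where "E k = elementary_integral W (m k) (p k) (x k)" for k
  have "integrable M (\<lambda>\<omega>. x k j \<omega> * (W (p k (Suc j)) \<omega> - W (p k j) \<omega>))" if "j < m k" for k j
    using increment_moment(1)[of "p k j" "p k (Suc j)" 1] elementary_nodes[OF el that]
      elementary_value[OF el that] by (intro integrable_bounded_mult) auto
  then have Ei: "integrable M (E k)" for k
    unfolding E_def elementary_integral_def by (auto intro!: Bochner_Integration.integrable_sum)
  have E0: "expectation (\<lambda>\<omega>. \<zeta> \<omega> * E k \<omega>) = 0" for k
  proof -
    have summand: "integrable M (\<lambda>\<omega>. (\<zeta> \<omega> * x k j \<omega>) * (W (p k (Suc j)) \<omega> - W (p k j) \<omega>))"
      "expectation (\<lambda>\<omega>. (\<zeta> \<omega> * x k j \<omega>) * (W (p k (Suc j)) \<omega> - W (p k j) \<omega>)) = 0" if j: "j < m k" for j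
    proof -
      note n = elementary_nodes[OF el j] and v = elementary_value[OF el j]
      have Y: "(\<lambda>\<omega>. \<zeta> \<omega> * x k j \<omega>) \<in> borel_measurable (F (p k j))"
        using measurable_F_mono[OF n(1) \<zeta>(1)] v(1) by simp
      have Yi: "integrable M (\<lambda>\<omega>. \<zeta> \<omega> * x k j \<omega>)"
        using integrable_bounded_mult[OF \<zeta>M \<zeta>(2) integrable_bounded_mult[OF v(3,2), of "\<lambda>_. 1"]] by simp
      show "integrable M (\<lambda>\<omega>. (\<zeta> \<omega> * x k j \<omega>) * (W (p k (Suc j)) \<omega> - W (p k j) \<omega>))"
        "expectation (\<lambda>\<omega>. (\<zeta> \<omega> * x k j \<omega>) * (W (p k (Suc j)) \<omega> - W (p k j) \<omega>)) = 0"
        using expectation_times_increment[OF n(1,2) Y Yi, of "\<lambda>x. x"]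
          increment_moment(1)[of "p k j" "p k (Suc j)" 1] increment_moment(2)[of "p k j" "p k (Suc j)"] n by auto
    qed
    have "expectation (\<lambda>\<omega>. \<zeta> \<omega> * E k \<omega>) =
      expectation (\<lambda>\<omega>. \<Sum>j<m k. (\<zeta> \<omega> * x k j \<omega>) * (W (p k (Suc j)) \<omega> - W (p k j) \<omega>))"
      unfolding E_def elementary_integral_def by (simp add: sum_distrib_left mult.assoc)
    also have "\<dots> = 0"
      using summand by (subst Bochner_Integration.integral_sum) auto
    finally show ?thesis .
  qed
  have small: "\<exists>k. integrable M (\<lambda>\<omega>. I \<omega> - E k \<omega>) \<and> expectation (\<lambda>\<omega>. \<bar>I \<omega> - E k \<omega>\<bar>) \<le> 2 * \<eta>"
    if "\<eta> > 0" for \<eta>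
  proof -
    have "0 < ennreal (\<eta>\<^sup>2)" using that by simp
    from order_tendstoD(2)[OF d0 this] obtain k
      where k: "(\<integral>\<^sup>+\<omega>. ennreal ((I \<omega> - E k \<omega>)\<^sup>2) \<partial>M) \<le> ennreal (\<eta>\<^sup>2)"
      unfolding E_def eventually_sequentially using less_imp_le by blast
    have [measurable]: "E k \<in> borel_measurable M" using Ei by auto
    note sq = integrable_of_nn_integral_le[OF _ _ k]
    have i2: "integrable M (\<lambda>\<omega>. (I \<omega> - E k \<omega>)\<^sup>2)" "expectation (\<lambda>\<omega>. (I \<omega> - E k \<omega>)\<^sup>2) \<le> \<eta>\<^sup>2"
      using sq by auto
    have m: "(\<lambda>\<omega>. I \<omega> - E k \<omega>) \<in> borel_measurable M" by measurable
    note i1 = first_moment_le(1)[OF m i2(1) that]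
    have "expectation (\<lambda>\<omega>. \<bar>I \<omega> - E k \<omega>\<bar>) \<le> \<eta> + expectation (\<lambda>\<omega>. (I \<omega> - E k \<omega>)\<^sup>2) / \<eta>"
      by (rule first_moment_le(2)[OF m i2(1) that])
    also have "\<dots> \<le> \<eta> + \<eta>\<^sup>2 / \<eta>"
      using i2(2) that by (intro add_left_mono divide_right_mono) auto
    finally show ?thesis using i1 that by (auto simp: power2_eq_square)
  qed
  have Ii: "integrable M I"
  proof -
    obtain k where "integrable M (\<lambda>\<omega>. I \<omega> - E k \<omega>)" using small[of 1] by auto
    from Bochner_Integration.integrable_add[OF this Ei[of k]] show ?thesis by simp
  qed
  then show "integrable M I" .
  have B0: "0 \<le> B" using B not_empty by (meson abs_ge_zero all_not_in_conv order_trans)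
  have "\<bar>expectation (\<lambda>\<omega>. \<zeta> \<omega> * I \<omega>)\<bar> \<le> (2 * B) * \<eta>" if \<eta>: "\<eta> > 0" for \<eta>
  proof -
    obtain k where k: "integrable M (\<lambda>\<omega>. I \<omega> - E k \<omega>)" "expectation (\<lambda>\<omega>. \<bar>I \<omega> - E k \<omega>\<bar>) \<le> 2 * \<eta>"
      using small[OF \<eta>] by auto
    have i: "integrable M (\<lambda>\<omega>. \<zeta> \<omega> * (I \<omega> - E k \<omega>))" "integrable M (\<lambda>\<omega>. \<zeta> \<omega> * E k \<omega>)"
      using k(1) Ei by (auto intro!: integrable_bounded_mult \<zeta>M \<zeta>)
    have "expectation (\<lambda>\<omega>. \<zeta> \<omega> * I \<omega>) = expectation (\<lambda>\<omega>. \<zeta> \<omega> * (I \<omega> - E k \<omega>) + \<zeta> \<omega> * E k \<omega>)"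
      by (simp add: algebra_simps)
    also have "\<dots> = expectation (\<lambda>\<omega>. \<zeta> \<omega> * (I \<omega> - E k \<omega>))"
      using i E0 by simp
    finally have "\<bar>expectation (\<lambda>\<omega>. \<zeta> \<omega> * I \<omega>)\<bar> \<le> expectation (\<lambda>\<omega>. \<bar>\<zeta> \<omega> * (I \<omega> - E k \<omega>)\<bar>)"
      by (metis integral_abs_bound)
    also have "\<dots> \<le> expectation (\<lambda>\<omega>. B * \<bar>I \<omega> - E k \<omega>\<bar>)"
      using k B by (intro integral_mono integrable_abs i) (auto simp: abs_mult intro!: mult_right_mono)
    also have "\<dots> \<le> (2 * B) * \<eta>"
      using k(2) B0 mult_left_mono[OF k(2) B0] by simp
    finally show ?thesis .
  qed
  note small_bound = this
  have "\<bar>expectation (\<lambda>\<omega>. \<zeta> \<omega> * I \<omega>)\<bar> \<le> 0"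
  proof -
    have "\<bar>expectation (\<lambda>\<omega>. \<zeta> \<omega> * I \<omega>)\<bar> \<le> 0 + e" if "e > 0" for e
    proof -
      have "(2 * B) * (e / (2 * B + 1)) \<le> e" using that B0 by (simp add: field_simps)
      moreover have "e / (2 * B + 1) > 0" using that B0 by simp
      ultimately show ?thesis
        using small_bound[of "e / (2 * B + 1)"] by linarith
    qed
    then show ?thesis by (rule field_le_epsilon)
  qed
  then show "expectation (\<lambda>\<omega>. \<zeta> \<omega> * I \<omega>) = 0" by simp
qed

end

section \<open>Increments of a stationary diffusion\<close>

text \<open>
  Freeze the process at the last point of the grid of mesh \<open>1 / (k + 1)\<close>; it then depends on time
  through a countable-valued map, and path continuity gives the limit.
\<close>

lemma jointly_measurable_of_continuous_paths:
  fixes Y :: "real \<Rightarrow> 'a \<Rightarrow> real"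
  assumes Y: "\<And>t. Y t \<in> borel_measurable M"
    and cont: "\<And>\<omega>. \<omega> \<in> space M \<Longrightarrow> continuous_on UNIV (\<lambda>t. Y t \<omega>)"
  shows "(\<lambda>z. Y (snd z) (fst z)) \<in> borel_measurable (M \<Otimes>\<^sub>M lborel)"
proof (rule borel_measurable_LIMSEQ_real)
  let ?r = "\<lambda>k r. real_of_int \<lfloor>real (Suc k) * r\<rfloor> / real (Suc k)"
  show "(\<lambda>z. Y (?r k (snd z)) (fst z)) \<in> borel_measurable (M \<Otimes>\<^sub>M lborel)" for k
  proof -
    have g: "(\<lambda>z. \<lfloor>real (Suc k) * snd z\<rfloor>) \<in> measurable (M \<Otimes>\<^sub>M lborel) (count_space UNIV)"
      by measurable
    have "(\<lambda>z. Y (real_of_int i / real (Suc k)) (fst z)) \<in> borel_measurable (M \<Otimes>\<^sub>M lborel)" for i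
      using Y by measurable
    from measurable_compose_countable[OF this g] show ?thesis by simp
  qed
  show "(\<lambda>k. Y (?r k (snd z)) (fst z)) \<longlonglongrightarrow> Y (snd z) (fst z)" if z: "z \<in> space (M \<Otimes>\<^sub>M lborel)" for z
  proof -
    have "(\<lambda>k. ?r k (snd z)) \<longlonglongrightarrow> snd z"
    proof (rule real_tendsto_sandwich)
      show "\<forall>\<^sub>F k in sequentially. snd z - 1 / real (Suc k) \<le> ?r k (snd z)"
      proof (intro always_eventually allI)
        fix k
        have "real (Suc k) * snd z - 1 \<le> real_of_int \<lfloor>real (Suc k) * snd z\<rfloor>" by linarith
        then have "(real (Suc k) * snd z - 1) / real (Suc k) \<le> ?r k (snd z)"
          by (intro divide_right_mono) auto
        then show "snd z - 1 / real (Suc k) \<le> ?r k (snd z)" by (simp add: diff_divide_distrib)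
      qed
      show "\<forall>\<^sub>F k in sequentially. ?r k (snd z) \<le> snd z"
      proof (intro always_eventually allI)
        fix k
        have "?r k (snd z) \<le> (real (Suc k) * snd z) / real (Suc k)"
          by (intro divide_right_mono) auto
        then show "?r k (snd z) \<le> snd z" by simp
      qed
      have "(\<lambda>k. 1 / real (Suc k)) \<longlonglongrightarrow> 0" using LIMSEQ_inverse_real_of_nat by (simp add: inverse_eq_divide)
      from tendsto_diff[OF tendsto_const this] show "(\<lambda>k. snd z - 1 / real (Suc k)) \<longlonglongrightarrow> snd z" by simp
    qed simp
    moreover have "isCont (\<lambda>t. Y t (fst z)) (snd z)"
      using cont[of "fst z"] z by (auto simp: space_pair_measure continuous_on_eq_continuous_at)
    ultimately show ?thesis by (rule isCont_tendsto_compose[rotated])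
  qed
qed

lemma LBINT_split:
  fixes f :: "real \<Rightarrow> real"
  assumes f: "continuous_on UNIV f" and "a \<le> c" "c \<le> d"
  shows "(LBINT x:{a..d}. f x) = (LBINT x:{a..c}. f x) + (LBINT x:{c..d}. f x)"
proof -
  have "set_integrable lborel {u..v} f" for u v
    using f by (intro borel_integrable_atLeastAtMost' continuous_on_subset[OF f]) auto
  note eq = set_borel_integral_eq_integral[OF this]
  show ?thesis
    unfolding eq using Henstock_Kurzweil_Integration.integral_combine[OF assms(2,3) eq(1)] by simp
qed

lemma square_LBINT_le:
  fixes f :: "real \<Rightarrow> real"
  assumes f: "continuous_on UNIV f" and st: "s \<le> t"
  shows "ennreal ((LBINT r:{s..t}. f r)\<^sup>2) \<le> ennreal (t - s) * (\<integral>\<^sup>+r\<in>{s..t}. ennreal ((f r)\<^sup>2) \<partial>lborel)"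
proof -
  have [measurable]: "f \<in> borel_measurable borel" using f by (rule borel_measurable_continuous_onI)
  have "set_integrable lborel {s..t} f"
    using f by (intro borel_integrable_atLeastAtMost' continuous_on_subset[OF f]) auto
  then have "ennreal \<bar>LBINT r:{s..t}. f r\<bar> \<le> (\<integral>\<^sup>+r. ennreal (norm (indicat_real {s..t} r *\<^sub>R f r)) \<partial>lborel)"
    unfolding set_integrable_def set_lebesgue_integral_def real_norm_def[symmetric]
    by (rule integral_norm_bound_ennreal)
  also have "\<dots> = (\<integral>\<^sup>+r. ennreal \<bar>f r\<bar> * indicator {s..t} r \<partial>lborel)"
    by (intro nn_integral_cong) (simp add: indicator_def)
  also have "\<dots> = (\<integral>\<^sup>+r. (ennreal \<bar>f r\<bar> * indicator {s..t} r) * indicator {s..t} r \<partial>lborel)"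
    by (intro nn_integral_cong) (simp add: indicator_def)
  finally have 1: "(ennreal \<bar>LBINT r:{s..t}. f r\<bar>)\<^sup>2 \<le>
      (\<integral>\<^sup>+r. (ennreal \<bar>f r\<bar> * indicator {s..t} r) * indicator {s..t} r \<partial>lborel)\<^sup>2"
    by (intro power_mono) auto
  also have "\<dots> \<le> (\<integral>\<^sup>+r. (ennreal \<bar>f r\<bar> * indicator {s..t} r)\<^sup>2 \<partial>lborel) * (\<integral>\<^sup>+r. (indicator {s..t} r)\<^sup>2 \<partial>lborel)"
    by (intro Cauchy_Schwarz_nn_integral) auto
  also have "(\<integral>\<^sup>+r. (ennreal \<bar>f r\<bar> * indicator {s..t} r)\<^sup>2 \<partial>lborel) = (\<integral>\<^sup>+r\<in>{s..t}. ennreal ((f r)\<^sup>2) \<partial>lborel)"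
    by (intro nn_integral_cong) (simp add: indicator_def ennreal_power)
  also have "(\<integral>\<^sup>+r. (indicator {s..t} r)\<^sup>2 \<partial>lborel) = (\<integral>\<^sup>+r. indicator {s..t} r \<partial>lborel)"
    by (intro nn_integral_cong) (simp add: indicator_def)
  also have "\<dots> = ennreal (t - s)" using st by simp
  finally show ?thesis by (simp add: ennreal_power mult.commute)
qed

text \<open>
  Paths are continuous on the whole line: a process on \<open>{0..}\<close> is to be extended by its initial
  value to negative times. The moments of the invariant law \<open>\<nu>\<close> are moments of the process at
  every time, which makes all increment estimates below uniform in time.
\<close>

locale stationary_diffusion = brownian_filtration M F W
  for M :: "'a measure" and F W +
  fixes X :: "real \<Rightarrow> 'a \<Rightarrow> real" and b \<sigma> :: "real \<Rightarrow> real" and \<nu> :: "real measure" and K :: real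
  assumes X_continuous: "\<And>\<omega>. \<omega> \<in> space M \<Longrightarrow> continuous_on UNIV (\<lambda>t. X t \<omega>)"
    and X_adapted: "\<And>t. 0 \<le> t \<Longrightarrow> X t \<in> borel_measurable (F t)"
    and X_measurable [measurable]: "\<And>t. X t \<in> borel_measurable M"
    and ito: "\<And>t. 0 \<le> t \<Longrightarrow> has_ito_integral M F W (\<lambda>s \<omega>. \<sigma> (X s \<omega>)) t
        (\<lambda>\<omega>. X t \<omega> - X 0 \<omega> - (LBINT s:{0..t}. b (X s \<omega>)))"
    and law: "\<And>t. 0 \<le> t \<Longrightarrow> distr M borel (X t) = \<nu>"
    and moments: "\<And>k::nat. integrable \<nu> (\<lambda>x. (1 + \<bar>x\<bar>) ^ k)"
    and K_nonneg: "0 \<le> K"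
    and lipschitz_b: "\<And>x y. \<bar>b x - b y\<bar> \<le> K * \<bar>x - y\<bar>"
    and lipschitz_\<sigma>: "\<And>x y. \<bar>\<sigma> x - \<sigma> y\<bar> \<le> K * \<bar>x - y\<bar>"
begin

lemma continuous_of_lipschitz:
  fixes f :: "real \<Rightarrow> real"
  assumes "\<And>x y. \<bar>f x - f y\<bar> \<le> K * \<bar>x - y\<bar>"
  shows "continuous_on UNIV f"
proof (rule lipschitz_on_continuous_on)
  show "K-lipschitz_on UNIV f"
    using assms K_nonneg by (intro lipschitz_onI) (auto simp: dist_real_def)
qed

lemma continuous_b: "continuous_on UNIV b" and continuous_\<sigma>: "continuous_on UNIV \<sigma>"
  using continuous_of_lipschitz lipschitz_b lipschitz_\<sigma> by auto

lemma borel_b [measurable]: "b \<in> borel_measurable borel"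
  and borel_\<sigma> [measurable]: "\<sigma> \<in> borel_measurable borel"
  using continuous_b continuous_\<sigma> borel_measurable_continuous_onI by auto

lemma joint_X [measurable]: "(\<lambda>z. X (snd z) (fst z)) \<in> borel_measurable (M \<Otimes>\<^sub>M lborel)"
  by (rule jointly_measurable_of_continuous_paths[OF X_measurable X_continuous])

lemma sets_\<nu> [measurable_cong, simp]: "sets \<nu> = sets borel"
  using law[of 0] by (metis order_refl sets_distr)

lemma prob_space_\<nu>: "prob_space \<nu>"
  using prob_space_distr[OF X_measurable[of 0]] law[of 0] by simp

lemma expectation_X:
  assumes "0 \<le> t" "f \<in> borel_measurable borel"
  shows "expectation (\<lambda>\<omega>. f (X t \<omega>)) = (\<integral>x. f x \<partial>\<nu> :: real)"
  using integral_distr[of "X t" M borel f] assms law by simp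

lemma integrable_X:
  fixes f :: "real \<Rightarrow> real"
  assumes "0 \<le> t" "f \<in> borel_measurable borel" "integrable \<nu> f"
  shows "integrable M (\<lambda>\<omega>. f (X t \<omega>))"
  using integrable_distr_eq[of "X t" M borel f] assms law by simp

lemma integrable_growth:
  fixes f :: "real \<Rightarrow> real"
  assumes "f \<in> borel_measurable borel" "\<And>x. \<bar>f x\<bar> \<le> C * (1 + \<bar>x\<bar>) ^ k"
  shows "integrable \<nu> f"
  by (rule Bochner_Integration.integrable_bound[OF integrable_mult_right[OF moments, of C k]])
     (use assms in \<open>auto intro!: AE_I2 order_trans[OF assms(2) abs_ge_self]\<close>)

lemma linear_growth:
  obtains A where "0 \<le> A" "\<And>x. \<bar>b x\<bar> \<le> A * (1 + \<bar>x\<bar>)" "\<And>x. \<bar>\<sigma> x\<bar> \<le> A * (1 + \<bar>x\<bar>)"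
proof
  let ?A = "K + \<bar>b 0\<bar> + \<bar>\<sigma> 0\<bar>"
  show "0 \<le> ?A" using K_nonneg by simp
  have *: "c + K * \<bar>x\<bar> \<le> ?A * (1 + \<bar>x\<bar>)" if "c \<le> \<bar>b 0\<bar> + \<bar>\<sigma> 0\<bar>" for c x
  proof -
    have "?A * (1 + \<bar>x\<bar>) = K + \<bar>b 0\<bar> + \<bar>\<sigma> 0\<bar> + K * \<bar>x\<bar> + (\<bar>b 0\<bar> + \<bar>\<sigma> 0\<bar>) * \<bar>x\<bar>"
      by (simp add: algebra_simps)
    moreover have "0 \<le> (\<bar>b 0\<bar> + \<bar>\<sigma> 0\<bar>) * \<bar>x\<bar>" by simp
    ultimately show ?thesis using that K_nonneg by linarith
  qed
  show "\<bar>b x\<bar> \<le> ?A * (1 + \<bar>x\<bar>)" for x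
  proof -
    have "\<bar>b x\<bar> \<le> \<bar>b 0\<bar> + \<bar>b x - b 0\<bar>" by linarith
    also have "\<dots> \<le> \<bar>b 0\<bar> + K * \<bar>x\<bar>" using lipschitz_b[of x 0] by simp
    also have "\<dots> \<le> ?A * (1 + \<bar>x\<bar>)" by (rule *) simp
    finally show ?thesis .
  qed
  show "\<bar>\<sigma> x\<bar> \<le> ?A * (1 + \<bar>x\<bar>)" for x
  proof -
    have "\<bar>\<sigma> x\<bar> \<le> \<bar>\<sigma> 0\<bar> + \<bar>\<sigma> x - \<sigma> 0\<bar>" by linarith
    also have "\<dots> \<le> \<bar>\<sigma> 0\<bar> + K * \<bar>x\<bar>" using lipschitz_\<sigma>[of x 0] by simp
    also have "\<dots> \<le> ?A * (1 + \<bar>x\<bar>)" by (rule *) simp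
    finally show ?thesis .
  qed
qed

lemma integrable_\<nu>_powers:
  "integrable \<nu> (\<lambda>x. (b x) ^ k)" "integrable \<nu> (\<lambda>x. (\<sigma> x) ^ k)"
proof -
  obtain A where A: "0 \<le> A" "\<And>x. \<bar>b x\<bar> \<le> A * (1 + \<bar>x\<bar>)" "\<And>x. \<bar>\<sigma> x\<bar> \<le> A * (1 + \<bar>x\<bar>)"
    using linear_growth by blast
  show "integrable \<nu> (\<lambda>x. (b x) ^ k)"
    using A by (intro integrable_growth[of _ "A ^ k" k]) (auto simp: power_abs power_mult_distrib[symmetric] intro!: power_mono)
  show "integrable \<nu> (\<lambda>x. (\<sigma> x) ^ k)"
    using A by (intro integrable_growth[of _ "A ^ k" k]) (auto simp: power_abs power_mult_distrib[symmetric] intro!: power_mono)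
qed

lemma nn_integral_time_le:
  assumes Y [measurable]: "(\<lambda>z. Y (snd z) (fst z)) \<in> borel_measurable (M \<Otimes>\<^sub>M lborel)"
    and "s \<le> t" and c: "\<And>r. s \<le> r \<Longrightarrow> r \<le> t \<Longrightarrow> (\<integral>\<^sup>+\<omega>. Y r \<omega> \<partial>M) \<le> ennreal c"
  shows "(\<integral>\<^sup>+\<omega>. (\<integral>\<^sup>+r\<in>{s..t}. Y r \<omega> \<partial>lborel) \<partial>M) \<le> ennreal ((t - s) * c)"
proof -
  interpret P: pair_sigma_finite M lborel ..
  have "(\<integral>\<^sup>+\<omega>. (\<integral>\<^sup>+r\<in>{s..t}. Y r \<omega> \<partial>lborel) \<partial>M) = (\<integral>\<^sup>+r. (\<integral>\<^sup>+\<omega>. Y r \<omega> * indicator {s..t} r \<partial>M) \<partial>lborel)"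
    by (rule P.Fubini'[symmetric]) (simp add: case_prod_beta)
  also have "\<dots> \<le> (\<integral>\<^sup>+r. ennreal c * indicator {s..t} r \<partial>lborel)"
    using c by (intro nn_integral_mono) (auto simp: indicator_def)
  also have "\<dots> = ennreal ((t - s) * c)"
    using assms(2) by (simp add: nn_integral_cmult_indicator ennreal_mult'' mult.commute)
  finally show ?thesis .
qed

lemma time_integral_square:
  fixes Y :: "real \<Rightarrow> 'a \<Rightarrow> real"
  assumes Y [measurable]: "(\<lambda>z. Y (snd z) (fst z)) \<in> borel_measurable (M \<Otimes>\<^sub>M lborel)"
    and cont: "\<And>\<omega>. \<omega> \<in> space M \<Longrightarrow> continuous_on UNIV (\<lambda>t. Y t \<omega>)"
    and st: "s \<le> t" and c0: "0 \<le> c"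
    and c: "\<And>r. s \<le> r \<Longrightarrow> r \<le> t \<Longrightarrow> (\<integral>\<^sup>+\<omega>. ennreal ((Y r \<omega>)\<^sup>2) \<partial>M) \<le> ennreal c"
  shows "(\<lambda>\<omega>. LBINT r:{s..t}. Y r \<omega>) \<in> borel_measurable M"
    and "(\<integral>\<^sup>+\<omega>. ennreal ((LBINT r:{s..t}. Y r \<omega>)\<^sup>2) \<partial>M) \<le> ennreal ((t - s)\<^sup>2 * c)"
proof -
  show "(\<lambda>\<omega>. LBINT r:{s..t}. Y r \<omega>) \<in> borel_measurable M"
    unfolding set_lebesgue_integral_def by measurable
  have "(\<integral>\<^sup>+\<omega>. ennreal ((LBINT r:{s..t}. Y r \<omega>)\<^sup>2) \<partial>M) \<le>
    (\<integral>\<^sup>+\<omega>. ennreal (t - s) * (\<integral>\<^sup>+r\<in>{s..t}. ennreal ((Y r \<omega>)\<^sup>2) \<partial>lborel) \<partial>M)"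
    by (intro nn_integral_mono square_LBINT_le cont st)
  also have "\<dots> = ennreal (t - s) * (\<integral>\<^sup>+\<omega>. (\<integral>\<^sup>+r\<in>{s..t}. ennreal ((Y r \<omega>)\<^sup>2) \<partial>lborel) \<partial>M)"
    by (intro nn_integral_cmult) measurable
  also have "\<dots> \<le> ennreal (t - s) * ennreal ((t - s) * c)"
    using st c by (intro mult_left_mono nn_integral_time_le) auto
  also have "\<dots> = ennreal ((t - s)\<^sup>2 * c)"
    using st c0 by (simp add: ennreal_mult[symmetric] power2_eq_square mult.assoc)
  finally show "(\<integral>\<^sup>+\<omega>. ennreal ((LBINT r:{s..t}. Y r \<omega>)\<^sup>2) \<partial>M) \<le> ennreal ((t - s)\<^sup>2 * c)" .
qed

lemma continuous_path_comp:
  assumes "continuous_on UNIV f" "\<omega> \<in> space M"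
  shows "continuous_on UNIV (\<lambda>r. f (X r \<omega>))"
  using continuous_on_compose2[OF assms(1) X_continuous[OF assms(2)]] by simp

lemma nn_expectation_X:
  assumes "0 \<le> t" "f \<in> borel_measurable borel" "integrable \<nu> f" "\<And>x. 0 \<le> f x"
  shows "(\<integral>\<^sup>+\<omega>. ennreal (f (X t \<omega>)) \<partial>M) = ennreal (\<integral>x. f x \<partial>\<nu>)"
  using nn_integral_eq_integral[OF integrable_X[OF assms(1-3)]] assms(4) expectation_X[OF assms(1,2)] by simp

abbreviation drift :: "real \<Rightarrow> real \<Rightarrow> 'a \<Rightarrow> real" where
  "drift s t \<omega> \<equiv> (LBINT r:{s..t}. b (X r \<omega>))"

lemma drift_square:
  assumes "0 \<le> s" "s \<le> t"
  shows "drift s t \<in> borel_measurable M"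
    and "(\<integral>\<^sup>+\<omega>. ennreal ((drift s t \<omega>)\<^sup>2) \<partial>M) \<le> ennreal ((t - s)\<^sup>2 * (\<integral>x. (b x)\<^sup>2 \<partial>\<nu>))"
proof -
  note T = time_integral_square[of "\<lambda>r \<omega>. b (X r \<omega>)" s t "\<integral>x. (b x)\<^sup>2 \<partial>\<nu>"]
  have c: "(\<integral>\<^sup>+\<omega>. ennreal ((b (X r \<omega>))\<^sup>2) \<partial>M) \<le> ennreal (\<integral>x. (b x)\<^sup>2 \<partial>\<nu>)" if "s \<le> r" for r
    using nn_expectation_X[of r "\<lambda>x. (b x)\<^sup>2"] integrable_\<nu>_powers(1)[of 2] that assms by simp
  show "drift s t \<in> borel_measurable M"
    using c assms by (intro T continuous_path_comp continuous_b) auto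
  show "(\<integral>\<^sup>+\<omega>. ennreal ((drift s t \<omega>)\<^sup>2) \<partial>M) \<le> ennreal ((t - s)\<^sup>2 * (\<integral>x. (b x)\<^sup>2 \<partial>\<nu>))"
    using c assms by (intro T continuous_path_comp continuous_b) auto
qed

lemma martingale_increment_bound:
  assumes "0 \<le> s" "s \<le> t" and "\<xi> \<in> borel_measurable (F s)" "integrable M (\<lambda>\<omega>. (\<xi> \<omega>)\<^sup>2)"
    and c: "\<And>r. s \<le> r \<Longrightarrow> r \<le> t \<Longrightarrow> (\<integral>\<^sup>+\<omega>. ennreal ((\<sigma> (X r \<omega>) - \<xi> \<omega>)\<^sup>2) \<partial>M) \<le> ennreal c"
    and "0 \<le> c"
  shows "(\<integral>\<^sup>+\<omega>. ennreal ((X t \<omega> - X s \<omega> - drift s t \<omega> - \<xi> \<omega> * (W t \<omega> - W s \<omega>))\<^sup>2) \<partial>M) \<le> ennreal (18 * (t - s) * c)"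
proof -
  have [measurable]: "\<xi> \<in> borel_measurable M" using assms(3) by (rule measurable_from_F)
  have "(\<integral>\<^sup>+\<omega>. ennreal ((X t \<omega> - X s \<omega> - drift s t \<omega> - \<xi> \<omega> * (W t \<omega> - W s \<omega>))\<^sup>2) \<partial>M) =
    (\<integral>\<^sup>+\<omega>. ennreal (((X t \<omega> - X 0 \<omega> - drift 0 t \<omega>) - (X s \<omega> - X 0 \<omega> - drift 0 s \<omega>) - \<xi> \<omega> * (W t \<omega> - W s \<omega>))\<^sup>2) \<partial>M)"
  proof (intro nn_integral_cong)
    fix \<omega> assume "\<omega> \<in> space M"
    then have "drift 0 t \<omega> = drift 0 s \<omega> + drift s t \<omega>"
      using assms by (intro LBINT_split continuous_path_comp continuous_b) auto
    then show "ennreal ((X t \<omega> - X s \<omega> - drift s t \<omega> - \<xi> \<omega> * (W t \<omega> - W s \<omega>))\<^sup>2) =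
      ennreal (((X t \<omega> - X 0 \<omega> - drift 0 t \<omega>) - (X s \<omega> - X 0 \<omega> - drift 0 s \<omega>) - \<xi> \<omega> * (W t \<omega> - W s \<omega>))\<^sup>2)"
      by (intro arg_cong[where f="\<lambda>x. ennreal (x\<^sup>2)"]) simp
  qed
  also have "\<dots> \<le> 18 * (\<integral>\<^sup>+\<omega>. (\<integral>\<^sup>+r\<in>{s..t}. ennreal ((\<sigma> (X r \<omega>) - \<xi> \<omega>)\<^sup>2) \<partial>lborel) \<partial>M)"
    using assms by (intro ito_increment_bound_unbounded ito) auto
  also have "\<dots> \<le> 18 * ennreal ((t - s) * c)"
    using assms by (intro mult_left_mono nn_integral_time_le) auto
  also have "\<dots> = ennreal (18 * (t - s) * c)"
    using assms by (simp add: ennreal_mult[symmetric] mult.assoc flip: ennreal_numeral)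
  finally show ?thesis .
qed

text \<open>
  The drift contributes \<open>O((t - s)\<^sup>2)\<close> and the stochastic integral, by the isometry, \<open>O(t - s)\<close>.
\<close>

lemma increment_square:
  obtains C where "0 \<le> C"
    "\<And>s t. 0 \<le> s \<Longrightarrow> s \<le> t \<Longrightarrow> t \<le> s + 1 \<Longrightarrow> integrable M (\<lambda>\<omega>. (X t \<omega> - X s \<omega>)\<^sup>2)"
    "\<And>s t. 0 \<le> s \<Longrightarrow> s \<le> t \<Longrightarrow> t \<le> s + 1 \<Longrightarrow> expectation (\<lambda>\<omega>. (X t \<omega> - X s \<omega>)\<^sup>2) \<le> C * (t - s)"
proof -
  define C where "C = 36 * (\<integral>x. (\<sigma> x)\<^sup>2 \<partial>\<nu>) + 2 * (\<integral>x. (b x)\<^sup>2 \<partial>\<nu>)"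
  have C0: "0 \<le> C" unfolding C_def by simp
  have main: "(\<integral>\<^sup>+\<omega>. ennreal ((X t \<omega> - X s \<omega>)\<^sup>2) \<partial>M) \<le> ennreal (C * (t - s))"
    if st: "0 \<le> s" "s \<le> t" "t \<le> s + 1" for s t
  proof -
    note [measurable] = drift_square(1)[OF st(1,2)]
    have m: "(\<integral>\<^sup>+\<omega>. ennreal ((X t \<omega> - X s \<omega> - drift s t \<omega>)\<^sup>2) \<partial>M) \<le> ennreal (18 * (t - s) * (\<integral>x. (\<sigma> x)\<^sup>2 \<partial>\<nu>))"
      using martingale_increment_bound[OF st(1,2), of "\<lambda>_. 0" "\<integral>x. (\<sigma> x)\<^sup>2 \<partial>\<nu>"]
        nn_expectation_X[of _ "\<lambda>x. (\<sigma> x)\<^sup>2"] integrable_\<nu>_powers(2)[of 2] st by simp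
    have "(\<integral>\<^sup>+\<omega>. ennreal ((X t \<omega> - X s \<omega>)\<^sup>2) \<partial>M) \<le>
      (\<integral>\<^sup>+\<omega>. 2 * ennreal ((X t \<omega> - X s \<omega> - drift s t \<omega>)\<^sup>2) + 2 * ennreal ((drift s t \<omega>)\<^sup>2) \<partial>M)"
    proof (intro nn_integral_mono)
      fix \<omega>
      have "ennreal ((X t \<omega> - X s \<omega>)\<^sup>2) \<le> ennreal (2 * (X t \<omega> - X s \<omega> - drift s t \<omega>)\<^sup>2 + 2 * (drift s t \<omega>)\<^sup>2)"
        using square_add_le[of "X t \<omega> - X s \<omega> - drift s t \<omega>" "drift s t \<omega>"] by (intro ennreal_leI) simp
      then show "ennreal ((X t \<omega> - X s \<omega>)\<^sup>2) \<le> 2 * ennreal ((X t \<omega> - X s \<omega> - drift s t \<omega>)\<^sup>2) + 2 * ennreal ((drift s t \<omega>)\<^sup>2)"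
        by (simp add: ennreal_plus ennreal_mult)
    qed
    also have "\<dots> = 2 * (\<integral>\<^sup>+\<omega>. ennreal ((X t \<omega> - X s \<omega> - drift s t \<omega>)\<^sup>2) \<partial>M) + 2 * (\<integral>\<^sup>+\<omega>. ennreal ((drift s t \<omega>)\<^sup>2) \<partial>M)"
      by (simp add: nn_integral_add nn_integral_cmult)
    also have "\<dots> \<le> 2 * ennreal (18 * (t - s) * (\<integral>x. (\<sigma> x)\<^sup>2 \<partial>\<nu>)) + 2 * ennreal ((t - s)\<^sup>2 * (\<integral>x. (b x)\<^sup>2 \<partial>\<nu>))"
      using drift_square(2)[OF st(1,2)] m by (intro add_mono mult_left_mono) auto
    also have "\<dots> = ennreal (2 * (18 * (t - s) * (\<integral>x. (\<sigma> x)\<^sup>2 \<partial>\<nu>)) + 2 * ((t - s)\<^sup>2 * (\<integral>x. (b x)\<^sup>2 \<partial>\<nu>)))"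
      using st by (simp add: ennreal_mult ennreal_plus)
    also have "\<dots> \<le> ennreal (C * (t - s))"
    proof (intro ennreal_leI)
      have "(t - s)\<^sup>2 \<le> t - s" using st by (simp add: power2_eq_square mult_left_le)
      then have "(t - s)\<^sup>2 * (\<integral>x. (b x)\<^sup>2 \<partial>\<nu>) \<le> (t - s) * (\<integral>x. (b x)\<^sup>2 \<partial>\<nu>)"
        by (intro mult_right_mono) auto
      then show "2 * (18 * (t - s) * (\<integral>x. (\<sigma> x)\<^sup>2 \<partial>\<nu>)) + 2 * ((t - s)\<^sup>2 * (\<integral>x. (b x)\<^sup>2 \<partial>\<nu>)) \<le> C * (t - s)"
        unfolding C_def by (simp add: algebra_simps)
    qed
    finally show ?thesis .
  qed
  show thesis
  proof (rule that[OF C0])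
    fix s t :: real assume st: "0 \<le> s" "s \<le> t" "t \<le> s + 1"
    show "integrable M (\<lambda>\<omega>. (X t \<omega> - X s \<omega>)\<^sup>2)" "expectation (\<lambda>\<omega>. (X t \<omega> - X s \<omega>)\<^sup>2) \<le> C * (t - s)"
      using integrable_of_nn_integral_le[OF _ _ main[OF st]] C0 st by auto
  qed
qed

text \<open>
  Freezing the diffusion coefficient at the left end point costs, by the isometry and the Lipschitz
  condition, the time integral of \<open>E (X r - X s)\<^sup>2\<close>, which is of second order in \<open>t - s\<close>.
\<close>

lemma linearized_increment:
  obtains C where "0 \<le> C"
    "\<And>s t. 0 \<le> s \<Longrightarrow> s \<le> t \<Longrightarrow> t \<le> s + 1 \<Longrightarrow>
       integrable M (\<lambda>\<omega>. (X t \<omega> - X s \<omega> - \<sigma> (X s \<omega>) * (W t \<omega> - W s \<omega>))\<^sup>2)"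
    "\<And>s t. 0 \<le> s \<Longrightarrow> s \<le> t \<Longrightarrow> t \<le> s + 1 \<Longrightarrow>
       expectation (\<lambda>\<omega>. (X t \<omega> - X s \<omega> - \<sigma> (X s \<omega>) * (W t \<omega> - W s \<omega>))\<^sup>2) \<le> C * (t - s)\<^sup>2"
proof -
  obtain C1 where C1: "0 \<le> C1"
    "\<And>s t. 0 \<le> s \<Longrightarrow> s \<le> t \<Longrightarrow> t \<le> s + 1 \<Longrightarrow> integrable M (\<lambda>\<omega>. (X t \<omega> - X s \<omega>)\<^sup>2)"
    "\<And>s t. 0 \<le> s \<Longrightarrow> s \<le> t \<Longrightarrow> t \<le> s + 1 \<Longrightarrow> expectation (\<lambda>\<omega>. (X t \<omega> - X s \<omega>)\<^sup>2) \<le> C1 * (t - s)"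
    using increment_square by blast
  define C where "C = 36 * (K\<^sup>2 * C1) + 2 * (\<integral>x. (b x)\<^sup>2 \<partial>\<nu>)"
  have C0: "0 \<le> C" unfolding C_def using C1(1) by simp
  have main: "(\<integral>\<^sup>+\<omega>. ennreal ((X t \<omega> - X s \<omega> - \<sigma> (X s \<omega>) * (W t \<omega> - W s \<omega>))\<^sup>2) \<partial>M) \<le> ennreal (C * (t - s)\<^sup>2)"
    if st: "0 \<le> s" "s \<le> t" "t \<le> s + 1" for s t
  proof -
    note [measurable] = drift_square(1)[OF st(1,2)]
    have [measurable]: "W t \<in> borel_measurable M" "W s \<in> borel_measurable M"
      using W_measurable st by auto
    let ?E = "\<lambda>\<omega>. X t \<omega> - X s \<omega> - drift s t \<omega> - \<sigma> (X s \<omega>) * (W t \<omega> - W s \<omega>)"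
    have c: "(\<integral>\<^sup>+\<omega>. ennreal ((\<sigma> (X r \<omega>) - \<sigma> (X s \<omega>))\<^sup>2) \<partial>M) \<le> ennreal (K\<^sup>2 * C1 * (t - s))"
      if r: "s \<le> r" "r \<le> t" for r
    proof -
      have i: "integrable M (\<lambda>\<omega>. (X r \<omega> - X s \<omega>)\<^sup>2)" using C1(2)[of s r] st r by simp
      have "(\<integral>\<^sup>+\<omega>. ennreal ((\<sigma> (X r \<omega>) - \<sigma> (X s \<omega>))\<^sup>2) \<partial>M) \<le> (\<integral>\<^sup>+\<omega>. ennreal (K\<^sup>2 * (X r \<omega> - X s \<omega>)\<^sup>2) \<partial>M)"
      proof (intro nn_integral_mono ennreal_leI)
        fix \<omega>
        have "\<bar>\<sigma> (X r \<omega>) - \<sigma> (X s \<omega>)\<bar>\<^sup>2 \<le> (K * \<bar>X r \<omega> - X s \<omega>\<bar>)\<^sup>2"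
          by (intro power_mono lipschitz_\<sigma>) auto
        then show "(\<sigma> (X r \<omega>) - \<sigma> (X s \<omega>))\<^sup>2 \<le> K\<^sup>2 * (X r \<omega> - X s \<omega>)\<^sup>2" by (simp add: power_mult_distrib)
      qed
      also have "\<dots> = ennreal (K\<^sup>2 * expectation (\<lambda>\<omega>. (X r \<omega> - X s \<omega>)\<^sup>2))"
        using i by (subst nn_integral_eq_integral) auto
      also have "\<dots> \<le> ennreal (K\<^sup>2 * (C1 * (t - s)))"
        using C1(3)[of s r] st r C1(1) mult_left_mono[of "r - s" "t - s" C1]
        by (intro ennreal_leI mult_left_mono) auto
      finally show ?thesis by (simp add: mult.assoc)
    qed
    have m: "(\<integral>\<^sup>+\<omega>. ennreal ((?E \<omega>)\<^sup>2) \<partial>M) \<le> ennreal (18 * (t - s) * (K\<^sup>2 * C1 * (t - s)))"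
    proof (rule martingale_increment_bound[OF st(1,2)])
      show "(\<lambda>\<omega>. \<sigma> (X s \<omega>)) \<in> borel_measurable (F s)"
        using measurable_compose[OF X_adapted[OF st(1)] borel_\<sigma>] .
      show "integrable M (\<lambda>\<omega>. (\<sigma> (X s \<omega>))\<^sup>2)"
        using integrable_X[OF st(1), of "\<lambda>x. (\<sigma> x)\<^sup>2"] integrable_\<nu>_powers(2)[of 2] by simp
    qed (use c C1 st in auto)
    have "(\<integral>\<^sup>+\<omega>. ennreal ((X t \<omega> - X s \<omega> - \<sigma> (X s \<omega>) * (W t \<omega> - W s \<omega>))\<^sup>2) \<partial>M) \<le>
      (\<integral>\<^sup>+\<omega>. 2 * ennreal ((?E \<omega>)\<^sup>2) + 2 * ennreal ((drift s t \<omega>)\<^sup>2) \<partial>M)"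
    proof (intro nn_integral_mono)
      fix \<omega>
      have "ennreal ((X t \<omega> - X s \<omega> - \<sigma> (X s \<omega>) * (W t \<omega> - W s \<omega>))\<^sup>2) \<le> ennreal (2 * (?E \<omega>)\<^sup>2 + 2 * (drift s t \<omega>)\<^sup>2)"
        using square_add_le[of "?E \<omega>" "drift s t \<omega>"] by (intro ennreal_leI) (simp add: algebra_simps)
      then show "ennreal ((X t \<omega> - X s \<omega> - \<sigma> (X s \<omega>) * (W t \<omega> - W s \<omega>))\<^sup>2) \<le> 2 * ennreal ((?E \<omega>)\<^sup>2) + 2 * ennreal ((drift s t \<omega>)\<^sup>2)"
        by (simp add: ennreal_plus ennreal_mult)
    qed
    also have "\<dots> = 2 * (\<integral>\<^sup>+\<omega>. ennreal ((?E \<omega>)\<^sup>2) \<partial>M) + 2 * (\<integral>\<^sup>+\<omega>. ennreal ((drift s t \<omega>)\<^sup>2) \<partial>M)"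
      by (simp add: nn_integral_add nn_integral_cmult)
    also have "\<dots> \<le> 2 * ennreal (18 * (t - s) * (K\<^sup>2 * C1 * (t - s))) + 2 * ennreal ((t - s)\<^sup>2 * (\<integral>x. (b x)\<^sup>2 \<partial>\<nu>))"
      using drift_square(2)[OF st(1,2)] m by (intro add_mono mult_left_mono) auto
    also have "\<dots> = ennreal (2 * (18 * (t - s) * (K\<^sup>2 * C1 * (t - s))) + 2 * ((t - s)\<^sup>2 * (\<integral>x. (b x)\<^sup>2 \<partial>\<nu>)))"
      using st C1(1) by (simp add: ennreal_mult ennreal_plus)
    also have "2 * (18 * (t - s) * (K\<^sup>2 * C1 * (t - s))) + 2 * ((t - s)\<^sup>2 * (\<integral>x. (b x)\<^sup>2 \<partial>\<nu>)) = C * (t - s)\<^sup>2"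
      unfolding C_def by (simp add: algebra_simps power2_eq_square)
    finally show ?thesis .
  qed
  show thesis
  proof (rule that[OF C0])
    fix s t :: real assume st: "0 \<le> s" "s \<le> t" "t \<le> s + 1"
    have [measurable]: "W t \<in> borel_measurable M" "W s \<in> borel_measurable M"
      using W_measurable st by auto
    show "integrable M (\<lambda>\<omega>. (X t \<omega> - X s \<omega> - \<sigma> (X s \<omega>) * (W t \<omega> - W s \<omega>))\<^sup>2)"
      "expectation (\<lambda>\<omega>. (X t \<omega> - X s \<omega> - \<sigma> (X s \<omega>) * (W t \<omega> - W s \<omega>))\<^sup>2) \<le> C * (t - s)\<^sup>2"
      using integrable_of_nn_integral_le[OF _ _ main[OF st]] C0 st by auto
  qed
qed

lemma expectation_X_times_increment:
  fixes f g :: "real \<Rightarrow> real"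
  assumes "0 \<le> s" "s \<le> t" "f \<in> borel_measurable borel" "integrable \<nu> f"
    and "g \<in> borel_measurable borel" "integrable M (\<lambda>\<omega>. g (W t \<omega> - W s \<omega>))"
  shows "integrable M (\<lambda>\<omega>. f (X s \<omega>) * g (W t \<omega> - W s \<omega>))"
    and "expectation (\<lambda>\<omega>. f (X s \<omega>) * g (W t \<omega> - W s \<omega>)) = (\<integral>x. f x \<partial>\<nu>) * expectation (\<lambda>\<omega>. g (W t \<omega> - W s \<omega>))"
  using expectation_times_increment[OF assms(1,2) measurable_compose[OF X_adapted assms(3)] integrable_X[OF assms(1,3,4)] assms(5,6)]
    expectation_X[OF assms(1,3)] assms(1) by auto

text \<open>
  With \<open>D\<close> the linearization error, \<open>(\<Delta>X)\<^sup>2 - \<sigma>\<^sup>2 (\<Delta>W)\<^sup>2 = D\<^sup>2 + 2 (\<sigma> \<Delta>W) D\<close>. The cross term decides the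
  order: the weight \<open>sqrt h\<close> balances \<open>E (\<sigma> \<Delta>W)\<^sup>2 = O(h)\<close> against \<open>E D\<^sup>2 = O(h\<^sup>2)\<close>.
\<close>

lemma squared_increment:
  obtains C where "0 \<le> C"
    "\<And>s t. 0 \<le> s \<Longrightarrow> s < t \<Longrightarrow> t \<le> s + 1 \<Longrightarrow>
       integrable M (\<lambda>\<omega>. (X t \<omega> - X s \<omega>)\<^sup>2 - (\<sigma> (X s \<omega>))\<^sup>2 * (W t \<omega> - W s \<omega>)\<^sup>2)"
    "\<And>s t. 0 \<le> s \<Longrightarrow> s < t \<Longrightarrow> t \<le> s + 1 \<Longrightarrow>
       expectation (\<lambda>\<omega>. \<bar>(X t \<omega> - X s \<omega>)\<^sup>2 - (\<sigma> (X s \<omega>))\<^sup>2 * (W t \<omega> - W s \<omega>)\<^sup>2\<bar>) \<le> C * ((t - s) * sqrt (t - s))"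
proof -
  obtain C2 where C2: "0 \<le> C2"
    "\<And>s t. 0 \<le> s \<Longrightarrow> s \<le> t \<Longrightarrow> t \<le> s + 1 \<Longrightarrow>
       integrable M (\<lambda>\<omega>. (X t \<omega> - X s \<omega> - \<sigma> (X s \<omega>) * (W t \<omega> - W s \<omega>))\<^sup>2)"
    "\<And>s t. 0 \<le> s \<Longrightarrow> s \<le> t \<Longrightarrow> t \<le> s + 1 \<Longrightarrow>
       expectation (\<lambda>\<omega>. (X t \<omega> - X s \<omega> - \<sigma> (X s \<omega>) * (W t \<omega> - W s \<omega>))\<^sup>2) \<le> C2 * (t - s)\<^sup>2"
    using linearized_increment by blast
  define m where "m = (\<integral>x. (\<sigma> x)\<^sup>2 \<partial>\<nu>)"
  have m0: "0 \<le> m" unfolding m_def by simp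
  define C where "C = 3 * C2 + 2 * m"
  have "integrable M (\<lambda>\<omega>. (X t \<omega> - X s \<omega>)\<^sup>2 - (\<sigma> (X s \<omega>))\<^sup>2 * (W t \<omega> - W s \<omega>)\<^sup>2) \<and>
      expectation (\<lambda>\<omega>. \<bar>(X t \<omega> - X s \<omega>)\<^sup>2 - (\<sigma> (X s \<omega>))\<^sup>2 * (W t \<omega> - W s \<omega>)\<^sup>2\<bar>) \<le> C * ((t - s) * sqrt (t - s))"
    if st: "0 \<le> s" "s < t" "t \<le> s + 1" for s t
  proof -
    define h where "h = t - s"
    have h: "0 < h" "h \<le> 1" using st unfolding h_def by auto
    have [measurable]: "W t \<in> borel_measurable M" "W s \<in> borel_measurable M"
      using W_measurable st by auto
    let ?V = "\<lambda>\<omega>. (\<sigma> (X s \<omega>))\<^sup>2 * (W t \<omega> - W s \<omega>)\<^sup>2"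
    let ?D = "\<lambda>\<omega>. X t \<omega> - X s \<omega> - \<sigma> (X s \<omega>) * (W t \<omega> - W s \<omega>)"
    have V: "integrable M ?V" "expectation ?V = m * h"
      using expectation_X_times_increment[of s t "\<lambda>x. (\<sigma> x)\<^sup>2" "\<lambda>y. y\<^sup>2"] increment_moment(1)[of s t 2]
        increment_moment(3)[of s t] integrable_\<nu>_powers(2)[of 2] st unfolding m_def h_def by auto
    have D: "integrable M (\<lambda>\<omega>. (?D \<omega>)\<^sup>2)" "expectation (\<lambda>\<omega>. (?D \<omega>)\<^sup>2) \<le> C2 * h\<^sup>2"
      using C2(2,3)[of s t] st unfolding h_def by auto
    let ?B = "\<lambda>\<omega>. (?D \<omega>)\<^sup>2 + 2 * (sqrt h * ?V \<omega> + (?D \<omega>)\<^sup>2 / sqrt h)"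
    have B: "integrable M ?B" using V D by simp
    have pt: "\<bar>(X t \<omega> - X s \<omega>)\<^sup>2 - ?V \<omega>\<bar> \<le> ?B \<omega>" for \<omega>
    proof -
      let ?y = "\<sigma> (X s \<omega>) * (W t \<omega> - W s \<omega>)"
      have "(X t \<omega> - X s \<omega>)\<^sup>2 - ?V \<omega> = (?D \<omega>)\<^sup>2 + 2 * (?y * ?D \<omega>)"
        by (simp add: power2_eq_square algebra_simps)
      moreover have "\<bar>?y * ?D \<omega>\<bar> \<le> sqrt h * ?y\<^sup>2 + (?D \<omega>)\<^sup>2 / sqrt h"
        using h by (intro abs_mult_le_weighted) simp
      ultimately show ?thesis unfolding power_mult_distrib by (smt (verit) zero_le_power2)
    qed
    have i: "integrable M (\<lambda>\<omega>. (X t \<omega> - X s \<omega>)\<^sup>2 - ?V \<omega>)"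
      by (rule Bochner_Integration.integrable_bound[OF B], measurable)
         (use order_trans[OF pt abs_ge_self] in \<open>simp only: real_norm_def AE_I2\<close>)
    have "expectation (\<lambda>\<omega>. \<bar>(X t \<omega> - X s \<omega>)\<^sup>2 - ?V \<omega>\<bar>) \<le> expectation ?B"
      by (rule integral_mono[OF integrable_abs[OF i] B pt])
    also have "\<dots> = expectation (\<lambda>\<omega>. (?D \<omega>)\<^sup>2) + 2 * (sqrt h * (m * h) + expectation (\<lambda>\<omega>. (?D \<omega>)\<^sup>2) / sqrt h)"
      using V D by simp
    also have "\<dots> \<le> C2 * h\<^sup>2 + 2 * (sqrt h * (m * h) + C2 * h\<^sup>2 / sqrt h)"
      using D(2) h m0 by (intro add_mono mult_left_mono divide_right_mono) auto
    also have "\<dots> \<le> C2 * (h * sqrt h) + 2 * (sqrt h * (m * h) + C2 * (h * sqrt h))"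
    proof -
      have q: "h\<^sup>2 / sqrt h = h * sqrt h"
        using h by (simp add: field_simps power2_eq_square)
      have "h \<le> sqrt h" using h by (simp add: real_le_rsqrt power2_eq_square mult_left_le)
      then have "h\<^sup>2 \<le> h * sqrt h" using h by (simp add: power2_eq_square)
      then have "C2 * h\<^sup>2 \<le> C2 * (h * sqrt h)" using C2(1) by (rule mult_left_mono)
      then show ?thesis using q by (simp flip: times_divide_eq_right)
    qed
    also have "\<dots> = C * (h * sqrt h)" unfolding C_def by (simp add: algebra_simps)
    finally show ?thesis using i unfolding h_def by simp
  qed
  moreover have "0 \<le> C" unfolding C_def using C2(1) m0 by simp
  ultimately show thesis using that[of C] by blast
qed

end

section \<open>The invariant law charges every interval\<close>

context stationary_diffusion
begin

text \<open>
  Stationarity in infinitesimal form: the generator integrates to zero against the invariant law.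
  The test function only has to be twice differentiable off a null set of that law, in the sense
  of a second-order Taylor estimate, because at any given time the process is almost surely
  outside of that set. Expand \<open>E \<phi>(X h) - E \<phi>(X 0) = 0\<close>: all error terms are \<open>O(h sqrt h)\<close>.
\<close>

lemma generator_identity:
  fixes \<phi> \<phi>1 \<phi>2 :: "real \<Rightarrow> real"
  assumes [measurable]: "\<phi> \<in> borel_measurable borel" "\<phi>1 \<in> borel_measurable borel" "\<phi>2 \<in> borel_measurable borel"
    and bound: "\<And>x. \<bar>\<phi> x\<bar> \<le> B" "\<And>x. \<bar>\<phi>1 x\<bar> \<le> B" "\<And>x. \<bar>\<phi>2 x\<bar> \<le> B"
    and N: "N \<in> null_sets \<nu>"
    and taylor: "\<And>x y. x \<notin> N \<Longrightarrow> y \<notin> N \<Longrightarrow>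
      \<bar>\<phi> y - \<phi> x - \<phi>1 x * (y - x) - \<phi>2 x / 2 * (y - x)\<^sup>2\<bar> \<le> B * (min 1 \<bar>y - x\<bar> * (y - x)\<^sup>2)"
  shows "(\<integral>x. \<phi>1 x * b x + \<phi>2 x / 2 * (\<sigma> x)\<^sup>2 \<partial>\<nu>) = 0"
proof -
  obtain C1 where C1: "0 \<le> C1"
    "\<And>s t. 0 \<le> s \<Longrightarrow> s \<le> t \<Longrightarrow> t \<le> s + 1 \<Longrightarrow> integrable M (\<lambda>\<omega>. (X t \<omega> - X s \<omega>)\<^sup>2)"
    "\<And>s t. 0 \<le> s \<Longrightarrow> s \<le> t \<Longrightarrow> t \<le> s + 1 \<Longrightarrow> expectation (\<lambda>\<omega>. (X t \<omega> - X s \<omega>)\<^sup>2) \<le> C1 * (t - s)"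
    using increment_square by blast
  obtain C3 where C3: "0 \<le> C3"
    "\<And>s t. 0 \<le> s \<Longrightarrow> s < t \<Longrightarrow> t \<le> s + 1 \<Longrightarrow>
       integrable M (\<lambda>\<omega>. (X t \<omega> - X s \<omega>)\<^sup>2 - (\<sigma> (X s \<omega>))\<^sup>2 * (W t \<omega> - W s \<omega>)\<^sup>2)"
    "\<And>s t. 0 \<le> s \<Longrightarrow> s < t \<Longrightarrow> t \<le> s + 1 \<Longrightarrow>
       expectation (\<lambda>\<omega>. \<bar>(X t \<omega> - X s \<omega>)\<^sup>2 - (\<sigma> (X s \<omega>))\<^sup>2 * (W t \<omega> - W s \<omega>)\<^sup>2\<bar>) \<le> C3 * ((t - s) * sqrt (t - s))"
    using squared_increment by blast
  define m4 where "m4 = (\<integral>x. (\<sigma> x) ^ 4 \<partial>\<nu>)"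
  have B0: "0 \<le> B" using bound(1)[of 0] by linarith
  have m40: "0 \<le> m4" unfolding m4_def by simp
  define C where "C = B * (1 + K\<^sup>2 * C1) + B * C3 + B * (C3 + C1 + 3 * m4)"
  have C0: "0 \<le> C" unfolding C_def using B0 C1(1) C3(1) m40 by simp
  define L where "L = (\<integral>x. \<phi>1 x * b x + \<phi>2 x / 2 * (\<sigma> x)\<^sup>2 \<partial>\<nu>)"
  have bd: "integrable \<nu> (\<lambda>x. f x * g x)" if "f \<in> borel_measurable borel" "\<And>x. \<bar>f x\<bar> \<le> B" "integrable \<nu> g" for f g :: "real \<Rightarrow> real"
    by (rule Bochner_Integration.integrable_bound[OF integrable_mult_right[OF that(3), of B]])
       (use that B0 in \<open>auto intro!: AE_I2 mult_right_mono simp: abs_mult\<close>)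
  have i1: "integrable \<nu> (\<lambda>x. \<phi>1 x * b x)"
    using integrable_\<nu>_powers(1)[of 1] by (intro bd bound) auto
  have i2: "integrable \<nu> (\<lambda>x. \<phi>2 x * (\<sigma> x)\<^sup>2)"
    using integrable_\<nu>_powers(2)[of 2] by (intro bd bound) auto
  have Leq: "L = (\<integral>x. \<phi>1 x * b x \<partial>\<nu>) + (\<integral>x. \<phi>2 x * (\<sigma> x)\<^sup>2 \<partial>\<nu>) / 2"
    unfolding L_def using i1 i2 by simp
  have main: "\<bar>L\<bar> \<le> C * sqrt h" if h: "0 < h" "h \<le> 1" for h
  proof -
    have [measurable]: "W h \<in> borel_measurable M" "W 0 \<in> borel_measurable M" "drift 0 h \<in> borel_measurable M"
      using W_measurable drift_square(1)[of 0 h] h by auto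
    let ?D = "\<lambda>\<omega>. X h \<omega> - X 0 \<omega>" and ?V = "\<lambda>\<omega>. W h \<omega> - W 0 \<omega>"
    let ?Q = "\<lambda>\<omega>. (?D \<omega>)\<^sup>2 - (\<sigma> (X 0 \<omega>))\<^sup>2 * (?V \<omega>)\<^sup>2"
    let ?Y = "\<lambda>\<omega>. drift 0 h \<omega> - h * b (X 0 \<omega>)"
    let ?R = "\<lambda>\<omega>. \<phi> (X h \<omega>) - \<phi> (X 0 \<omega>) - \<phi>1 (X 0 \<omega>) * ?D \<omega> - \<phi>2 (X 0 \<omega>) / 2 * (?D \<omega>)\<^sup>2"
    have bdM: "integrable M (\<lambda>\<omega>. f (X 0 \<omega>) * g \<omega>)"
      and bdE: "\<bar>expectation (\<lambda>\<omega>. f (X 0 \<omega>) * g \<omega>)\<bar> \<le> B * expectation (\<lambda>\<omega>. \<bar>g \<omega>\<bar>)"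
      if f: "f \<in> borel_measurable borel" "\<And>x. \<bar>f x\<bar> \<le> B" and g: "integrable M g" for f g :: "_ \<Rightarrow> real"
    proof -
      have "bounded ((\<lambda>\<omega>. f (X 0 \<omega>)) ` space M)" unfolding bounded_real using f by auto
      then show i: "integrable M (\<lambda>\<omega>. f (X 0 \<omega>) * g \<omega>)"
        using f g measurable_compose[OF X_measurable[of 0] f(1)] by (intro integrable_bounded_mult) auto
      have "\<bar>expectation (\<lambda>\<omega>. f (X 0 \<omega>) * g \<omega>)\<bar> \<le> expectation (\<lambda>\<omega>. \<bar>f (X 0 \<omega>) * g \<omega>\<bar>)"
        by (rule integral_abs_bound)
      also have "\<dots> \<le> expectation (\<lambda>\<omega>. B * \<bar>g \<omega>\<bar>)"
        using f g by (intro integral_mono integrable_abs i) (auto simp: abs_mult intro!: mult_right_mono)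
      finally show "\<bar>expectation (\<lambda>\<omega>. f (X 0 \<omega>) * g \<omega>)\<bar> \<le> B * expectation (\<lambda>\<omega>. \<bar>g \<omega>\<bar>)" by simp
    qed
    have a1: "integrable M (\<lambda>\<omega>. \<phi>1 (X 0 \<omega>) * (?D \<omega> - drift 0 h \<omega>))"
      "expectation (\<lambda>\<omega>. \<phi>1 (X 0 \<omega>) * (?D \<omega> - drift 0 h \<omega>)) = 0"
    proof -
      have z: "(\<lambda>\<omega>. \<phi>1 (X 0 \<omega>)) \<in> borel_measurable (F 0)"
        using measurable_compose[OF X_adapted[of 0], of \<phi>1 borel] by simp
      have zb: "bounded ((\<lambda>\<omega>. \<phi>1 (X 0 \<omega>)) ` space M)" unfolding bounded_real using bound(2) by auto
      note mz = ito_mean_zero[OF less_imp_le[OF h(1)] ito[OF less_imp_le[OF h(1)]] z zb]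
      show "expectation (\<lambda>\<omega>. \<phi>1 (X 0 \<omega>) * (?D \<omega> - drift 0 h \<omega>)) = 0" by (rule mz(2))
      show "integrable M (\<lambda>\<omega>. \<phi>1 (X 0 \<omega>) * (?D \<omega> - drift 0 h \<omega>))" by (intro bdM bound mz(1)) auto
    qed
    have Y: "integrable M ?Y" "expectation (\<lambda>\<omega>. \<bar>?Y \<omega>\<bar>) \<le> (1 + K\<^sup>2 * C1) * (h * sqrt h)"
    proof -
      have Yeq: "?Y \<omega> = (LBINT r:{0..h}. b (X r \<omega>) - b (X 0 \<omega>))" if "\<omega> \<in> space M" for \<omega>
      proof -
        have "set_integrable lborel {0..h} (\<lambda>r. b (X r \<omega>))"
          by (intro borel_integrable_atLeastAtMost' continuous_on_subset[OF continuous_path_comp[OF continuous_b that]]) auto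
        moreover have "set_integrable lborel {0..h} (\<lambda>r. b (X 0 \<omega>))"
          by (intro borel_integrable_atLeastAtMost') auto
        moreover have "(LBINT r:{0..h}. b (X 0 \<omega>)) = h * b (X 0 \<omega>)"
          using h by (simp add: set_lebesgue_integral_def)
        ultimately show ?thesis by (simp add: set_integral_diff)
      qed
      have "(\<integral>\<^sup>+\<omega>. ennreal ((LBINT r:{0..h}. b (X r \<omega>) - b (X 0 \<omega>))\<^sup>2) \<partial>M) \<le> ennreal ((h - 0)\<^sup>2 * (K\<^sup>2 * C1 * h))"
      proof (rule time_integral_square(2))
        show "continuous_on UNIV (\<lambda>t. b (X t \<omega>) - b (X 0 \<omega>))" if "\<omega> \<in> space M" for \<omega>
          by (intro continuous_on_diff continuous_path_comp[OF continuous_b that] continuous_on_const)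
        show "(\<integral>\<^sup>+\<omega>. ennreal ((b (X r \<omega>) - b (X 0 \<omega>))\<^sup>2) \<partial>M) \<le> ennreal (K\<^sup>2 * C1 * h)" if r: "0 \<le> r" "r \<le> h" for r
        proof -
          have i: "integrable M (\<lambda>\<omega>. (X r \<omega> - X 0 \<omega>)\<^sup>2)" using C1(2)[of 0 r] h r by simp
          have "(\<integral>\<^sup>+\<omega>. ennreal ((b (X r \<omega>) - b (X 0 \<omega>))\<^sup>2) \<partial>M) \<le> (\<integral>\<^sup>+\<omega>. ennreal (K\<^sup>2 * (X r \<omega> - X 0 \<omega>)\<^sup>2) \<partial>M)"
          proof (intro nn_integral_mono ennreal_leI)
            fix \<omega>
            have "\<bar>b (X r \<omega>) - b (X 0 \<omega>)\<bar>\<^sup>2 \<le> (K * \<bar>X r \<omega> - X 0 \<omega>\<bar>)\<^sup>2"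
              by (intro power_mono lipschitz_b) auto
            then show "(b (X r \<omega>) - b (X 0 \<omega>))\<^sup>2 \<le> K\<^sup>2 * (X r \<omega> - X 0 \<omega>)\<^sup>2" by (simp add: power_mult_distrib)
          qed
          also have "\<dots> = ennreal (K\<^sup>2 * expectation (\<lambda>\<omega>. (X r \<omega> - X 0 \<omega>)\<^sup>2))"
            using i by (subst nn_integral_eq_integral) auto
          also have "\<dots> \<le> ennreal (K\<^sup>2 * (C1 * h))"
            using C1(3)[of 0 r] h r C1(1) mult_left_mono[of r h C1]
            by (intro ennreal_leI mult_left_mono) auto
          finally show ?thesis by (simp add: mult.assoc)
        qed
      qed (use h C1(1) in auto)
      also have "(h - 0)\<^sup>2 * (K\<^sup>2 * C1 * h) = K\<^sup>2 * C1 * h ^ 3" by (simp add: power3_eq_cube power2_eq_square)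
      also have "(\<integral>\<^sup>+\<omega>. ennreal ((LBINT r:{0..h}. b (X r \<omega>) - b (X 0 \<omega>))\<^sup>2) \<partial>M) = (\<integral>\<^sup>+\<omega>. ennreal ((?Y \<omega>)\<^sup>2) \<partial>M)"
        by (intro nn_integral_cong) (simp only: Yeq)
      finally have "(\<integral>\<^sup>+\<omega>. ennreal ((?Y \<omega>)\<^sup>2) \<partial>M) \<le> ennreal (K\<^sup>2 * C1 * h ^ 3)" .
      note Y2 = integrable_of_nn_integral_le[OF _ _ this]
      have Y2: "integrable M (\<lambda>\<omega>. (?Y \<omega>)\<^sup>2)" "expectation (\<lambda>\<omega>. (?Y \<omega>)\<^sup>2) \<le> K\<^sup>2 * C1 * h ^ 3"
        using Y2 C1(1) h by auto
      have c: "0 < h * sqrt h" using h by simp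
      have m: "?Y \<in> borel_measurable M" by measurable
      show "integrable M ?Y" by (rule first_moment_le(1)[OF m Y2(1) c])
      have "expectation (\<lambda>\<omega>. \<bar>?Y \<omega>\<bar>) \<le> h * sqrt h + expectation (\<lambda>\<omega>. (?Y \<omega>)\<^sup>2) / (h * sqrt h)"
        by (rule first_moment_le(2)[OF m Y2(1) c])
      also have "\<dots> \<le> h * sqrt h + (K\<^sup>2 * C1 * h ^ 3) / (h * sqrt h)"
        using Y2(2) h by (intro add_left_mono divide_right_mono) auto
      also have "(K\<^sup>2 * C1 * h ^ 3) / (h * sqrt h) = K\<^sup>2 * C1 * (h * sqrt h)"
      proof -
        have "h ^ 3 / (h * sqrt h) = h * sqrt h"
          using h by (simp add: field_simps power3_eq_cube)
        then show ?thesis by (simp only: times_divide_eq_right[symmetric])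
      qed
      finally show "expectation (\<lambda>\<omega>. \<bar>?Y \<omega>\<bar>) \<le> (1 + K\<^sup>2 * C1) * (h * sqrt h)"
        by (simp add: algebra_simps)
    qed
    have Q: "integrable M ?Q" "expectation (\<lambda>\<omega>. \<bar>?Q \<omega>\<bar>) \<le> C3 * (h * sqrt h)"
      using C3(2,3)[of 0 h] h by auto
    have a5: "integrable M (\<lambda>\<omega>. (\<phi>2 (X 0 \<omega>) * (\<sigma> (X 0 \<omega>))\<^sup>2) * (?V \<omega>)\<^sup>2)"
      "expectation (\<lambda>\<omega>. (\<phi>2 (X 0 \<omega>) * (\<sigma> (X 0 \<omega>))\<^sup>2) * (?V \<omega>)\<^sup>2) = (\<integral>x. \<phi>2 x * (\<sigma> x)\<^sup>2 \<partial>\<nu>) * h"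
      using expectation_X_times_increment[of 0 h "\<lambda>x. \<phi>2 x * (\<sigma> x)\<^sup>2" "\<lambda>y. y\<^sup>2"] i2 h
        increment_moment(1)[of 0 h 2] increment_moment(3)[of 0 h] by auto
    have a3: "integrable M (\<lambda>\<omega>. \<phi>1 (X 0 \<omega>) * b (X 0 \<omega>))"
      "expectation (\<lambda>\<omega>. \<phi>1 (X 0 \<omega>) * b (X 0 \<omega>)) = (\<integral>x. \<phi>1 x * b x \<partial>\<nu>)"
      using integrable_X[of 0 "\<lambda>x. \<phi>1 x * b x"] expectation_X[of 0 "\<lambda>x. \<phi>1 x * b x"] i1 by auto
    have V4: "integrable M (\<lambda>\<omega>. (\<sigma> (X 0 \<omega>)) ^ 4 * (?V \<omega>) ^ 4)"
      "expectation (\<lambda>\<omega>. (\<sigma> (X 0 \<omega>)) ^ 4 * (?V \<omega>) ^ 4) = m4 * (3 * h\<^sup>2)"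
      using expectation_X_times_increment[of 0 h "\<lambda>x. (\<sigma> x) ^ 4" "\<lambda>y. y ^ 4"] integrable_\<nu>_powers(2)[of 4] h
        increment_moment(1)[of 0 h 4] increment_moment(4)[of 0 h] unfolding m4_def by auto
    let ?G = "\<lambda>\<omega>. \<bar>?Q \<omega>\<bar> + (sqrt h * (?D \<omega>)\<^sup>2 + ((\<sigma> (X 0 \<omega>)) ^ 4 * (?V \<omega>) ^ 4) / sqrt h)"
    have D2: "integrable M (\<lambda>\<omega>. (?D \<omega>)\<^sup>2)" "expectation (\<lambda>\<omega>. (?D \<omega>)\<^sup>2) \<le> C1 * h"
      using C1(2,3)[of 0 h] h by auto
    have G: "integrable M ?G" using Q D2 V4 by simp
    have AEN: "AE \<omega> in M. X t \<omega> \<notin> N" if "0 \<le> t" for t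
    proof -
      have "AE x in distr M borel (X t). x \<notin> N"
        unfolding law[OF that] using N by (rule AE_not_in)
      then show ?thesis by (rule AE_distrD[OF X_measurable])
    qed
    (* The factor min 1 |dX| in the Taylor remainder is what makes its mean o(h): second moments do not control |dX|^3. *)
    have Rb: "AE \<omega> in M. \<bar>?R \<omega>\<bar> \<le> B * ?G \<omega>"
      using AEN[of 0, OF order_refl] AEN[of h, OF less_imp_le[OF h(1)]]
    proof eventually_elim
      case (elim \<omega>)
      let ?m = "min 1 \<bar>?D \<omega>\<bar>" and ?S = "(\<sigma> (X 0 \<omega>))\<^sup>2 * (?V \<omega>)\<^sup>2"
      have "?m * (?D \<omega>)\<^sup>2 = ?m * ?Q \<omega> + ?m * ?S" by (simp add: algebra_simps)
      also have "\<dots> \<le> \<bar>?m * ?Q \<omega>\<bar> + \<bar>?m * ?S\<bar>" by linarith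
      also have "\<dots> \<le> \<bar>?Q \<omega>\<bar> + (sqrt h * ?m\<^sup>2 + ?S\<^sup>2 / sqrt h)"
      proof (rule add_mono)
        show "\<bar>?m * ?Q \<omega>\<bar> \<le> \<bar>?Q \<omega>\<bar>" unfolding abs_mult by (intro mult_left_le_one_le) auto
        show "\<bar>?m * ?S\<bar> \<le> sqrt h * ?m\<^sup>2 + ?S\<^sup>2 / sqrt h" using h by (intro abs_mult_le_weighted) simp
      qed
      also have "\<dots> \<le> ?G \<omega>"
      proof -
        have "?m\<^sup>2 \<le> \<bar>?D \<omega>\<bar>\<^sup>2" by (intro power_mono) auto
        then have "sqrt h * ?m\<^sup>2 \<le> sqrt h * (?D \<omega>)\<^sup>2" using h by (intro mult_left_mono) auto
        moreover have "?S\<^sup>2 = (\<sigma> (X 0 \<omega>)) ^ 4 * (?V \<omega>) ^ 4"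
          by (simp add: power_mult_distrib)
        ultimately show ?thesis by simp
      qed
      finally have "B * (?m * (?D \<omega>)\<^sup>2) \<le> B * ?G \<omega>" using B0 by (rule mult_left_mono)
      then show ?case using taylor[OF elim] by linarith
    qed
    have E\<phi>: "integrable M (\<lambda>\<omega>. \<phi> (X t \<omega>))" "expectation (\<lambda>\<omega>. \<phi> (X t \<omega>)) = (\<integral>x. \<phi> x \<partial>\<nu>)" if "0 \<le> t" for t
    proof -
      have "integrable \<nu> \<phi>" using integrable_growth[of \<phi> B 0] bound(1) by simp
      then show "integrable M (\<lambda>\<omega>. \<phi> (X t \<omega>))" "expectation (\<lambda>\<omega>. \<phi> (X t \<omega>)) = (\<integral>x. \<phi> x \<partial>\<nu>)"
        using integrable_X[of t \<phi>] expectation_X[of t \<phi>] that by auto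
    qed
    have R: "integrable M ?R"
    proof (rule Bochner_Integration.integrable_bound)
      show "integrable M (\<lambda>\<omega>. B * ?G \<omega>)" using G by (rule integrable_mult_right)
      show "AE \<omega> in M. norm (?R \<omega>) \<le> norm (B * ?G \<omega>)"
        using Rb
      proof eventually_elim
        case (elim \<omega>)
        then show ?case unfolding real_norm_def using abs_ge_self by (rule order_trans)
      qed
    qed measurable
    have ER: "\<bar>expectation ?R\<bar> \<le> B * (C3 + C1 + 3 * m4) * (h * sqrt h)"
    proof -
      have "\<bar>expectation ?R\<bar> \<le> expectation (\<lambda>\<omega>. \<bar>?R \<omega>\<bar>)" by (rule integral_abs_bound)
      also have "\<dots> \<le> expectation (\<lambda>\<omega>. B * ?G \<omega>)"
        by (rule integral_mono_AE[OF integrable_abs[OF R] integrable_mult_right[OF G] Rb])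
      also have "\<dots> = B * (expectation (\<lambda>\<omega>. \<bar>?Q \<omega>\<bar>) + (sqrt h * expectation (\<lambda>\<omega>. (?D \<omega>)\<^sup>2) + m4 * (3 * h\<^sup>2) / sqrt h))"
        using Q D2 V4 by simp
      also have "\<dots> \<le> B * (C3 * (h * sqrt h) + (sqrt h * (C1 * h) + m4 * (3 * h\<^sup>2) / sqrt h))"
        using Q(2) D2(2) B0 h by (intro mult_left_mono add_mono order_refl) auto
      also have "m4 * (3 * h\<^sup>2) / sqrt h = 3 * m4 * (h * sqrt h)"
      proof -
        have "h\<^sup>2 / sqrt h = h * sqrt h"
          using h by (simp add: field_simps power2_eq_square)
        moreover have "m4 * (3 * h\<^sup>2) / sqrt h = 3 * m4 * (h\<^sup>2 / sqrt h)" by simp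
        ultimately show ?thesis by (simp only:)
      qed
      finally show ?thesis by (simp add: algebra_simps)
    qed
    have a2: "integrable M (\<lambda>\<omega>. \<phi>1 (X 0 \<omega>) * ?Y \<omega>)"
      and e2: "\<bar>expectation (\<lambda>\<omega>. \<phi>1 (X 0 \<omega>) * ?Y \<omega>)\<bar> \<le> B * ((1 + K\<^sup>2 * C1) * (h * sqrt h))"
      using bdM[of \<phi>1 ?Y] order_trans[OF bdE[of \<phi>1 ?Y] mult_left_mono[OF Y(2) B0]] bound(2) Y(1) by auto
    have a4: "integrable M (\<lambda>\<omega>. \<phi>2 (X 0 \<omega>) * ?Q \<omega>)"
      and e4: "\<bar>expectation (\<lambda>\<omega>. \<phi>2 (X 0 \<omega>) * ?Q \<omega>)\<bar> \<le> B * (C3 * (h * sqrt h))"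
      using bdM[of \<phi>2 ?Q] order_trans[OF bdE[of \<phi>2 ?Q] mult_left_mono[OF Q(2) B0]] bound(3) Q(1) by auto
    have sum6: "expectation (\<lambda>\<omega>. f1 \<omega> + (f2 \<omega> + (h * f3 \<omega> + (f4 \<omega> / 2 + (f5 \<omega> / 2 + f6 \<omega>))))) =
        expectation f1 + (expectation f2 + (h * expectation f3 + (expectation f4 / 2 + (expectation f5 / 2 + expectation f6))))"
      if "integrable M f1" "integrable M f2" "integrable M f3" "integrable M f4" "integrable M f5" "integrable M f6"
      for f1 f2 f3 f4 f5 f6 :: "'a \<Rightarrow> real"
      using that by simp
    have "0 = expectation (\<lambda>\<omega>. \<phi> (X h \<omega>) - \<phi> (X 0 \<omega>))"
      using E\<phi>[of h] E\<phi>[of 0] h by simp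
    also have "\<dots> = expectation (\<lambda>\<omega>. \<phi>1 (X 0 \<omega>) * (?D \<omega> - drift 0 h \<omega>) + (\<phi>1 (X 0 \<omega>) * ?Y \<omega>
      + (h * (\<phi>1 (X 0 \<omega>) * b (X 0 \<omega>)) + ((\<phi>2 (X 0 \<omega>) * ?Q \<omega>) / 2
      + (((\<phi>2 (X 0 \<omega>) * (\<sigma> (X 0 \<omega>))\<^sup>2) * (?V \<omega>)\<^sup>2) / 2 + ?R \<omega>)))))"
      by (intro Bochner_Integration.integral_cong refl) (simp add: algebra_simps add_divide_distrib diff_divide_distrib)
    also have "\<dots> = 0 + (expectation (\<lambda>\<omega>. \<phi>1 (X 0 \<omega>) * ?Y \<omega>) + (h * (\<integral>x. \<phi>1 x * b x \<partial>\<nu>)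
      + (expectation (\<lambda>\<omega>. \<phi>2 (X 0 \<omega>) * ?Q \<omega>) / 2 + ((\<integral>x. \<phi>2 x * (\<sigma> x)\<^sup>2 \<partial>\<nu>) * h / 2 + expectation ?R))))"
      unfolding sum6[OF a1(1) a2 a3(1) a4 a5(1) R] a1(2) a3(2) a5(2) ..
    finally have "h * L = - (expectation (\<lambda>\<omega>. \<phi>1 (X 0 \<omega>) * ?Y \<omega>) + expectation (\<lambda>\<omega>. \<phi>2 (X 0 \<omega>) * ?Q \<omega>) / 2 + expectation ?R)"
      unfolding Leq by (simp add: algebra_simps)
    then have "\<bar>h * L\<bar> \<le> \<bar>expectation (\<lambda>\<omega>. \<phi>1 (X 0 \<omega>) * ?Y \<omega>)\<bar> + \<bar>expectation (\<lambda>\<omega>. \<phi>2 (X 0 \<omega>) * ?Q \<omega>)\<bar> + \<bar>expectation ?R\<bar>"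
      by linarith
    also have "\<dots> \<le> B * ((1 + K\<^sup>2 * C1) * (h * sqrt h)) + B * (C3 * (h * sqrt h)) + B * (C3 + C1 + 3 * m4) * (h * sqrt h)"
      by (intro add_mono e2 e4 ER)
    also have "\<dots> = h * (C * sqrt h)" unfolding C_def by (simp add: algebra_simps)
    finally show ?thesis using h by (simp add: abs_mult)
  qed
  have "\<bar>L\<bar> \<le> 0 + e" if e: "e > 0" for e
  proof -
    define h where "h = min 1 ((e / (C + 1))\<^sup>2)"
    have pos: "0 < e / (C + 1)" using e C0 by simp
    have h: "0 < h" "h \<le> 1" unfolding h_def using zero_less_power[OF pos, of 2] by (simp_all del: zero_less_power2)
    have "sqrt h \<le> sqrt ((e / (C + 1))\<^sup>2)" unfolding h_def by (rule real_sqrt_le_mono) simp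
    then have h3: "sqrt h \<le> e / (C + 1)" unfolding real_sqrt_abs abs_of_pos[OF pos] .
    have "\<bar>L\<bar> \<le> C * sqrt h" using main h by simp
    also have "\<dots> \<le> C * (e / (C + 1))" using C0 h3 by (intro mult_left_mono)
    also have "\<dots> \<le> e" using C0 e by (simp add: field_simps)
    finally show ?thesis by simp
  qed
  then have "\<bar>L\<bar> \<le> 0" by (rule field_le_epsilon)
  then show ?thesis unfolding L_def by simp
qed

end

text \<open>
  The truncated cube has a Lipschitz continuous second derivative, which bounds the remainder by
  \<open>e\<^sup>3\<close> for the increment \<open>e\<close>. For large \<open>e\<close> the bound is of order \<open>e\<^sup>2\<close>, because
  the positive parts are at most \<open>1\<close>.
\<close>

lemma cube_taylor:
  fixes p q :: real
  assumes "p \<le> 1" "q \<le> 1"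
  shows "\<bar>(max 0 q) ^ 3 - (max 0 p) ^ 3 - 3 * (max 0 p)\<^sup>2 * (q - p) - 3 * max 0 p * (q - p)\<^sup>2\<bar>
    \<le> 7 * (min 1 \<bar>q - p\<bar> * (q - p)\<^sup>2)"
proof -
  define e where "e = q - p"
  define m where "m = min 1 \<bar>e\<bar>"
  have m0: "0 \<le> m" unfolding m_def by simp
  have q: "q = p + e" unfolding e_def by simp
  have me: "0 \<le> m * e\<^sup>2" using m0 by simp
  have goal: "\<bar>(max 0 q) ^ 3 - (max 0 p) ^ 3 - 3 * (max 0 p)\<^sup>2 * e - 3 * max 0 p * e\<^sup>2\<bar> \<le> 7 * (m * e\<^sup>2)"
  proof (cases "0 \<le> p")
    case p: True
    show ?thesis
    proof (cases "0 \<le> q")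
      case True
      then have "\<bar>e\<bar> \<le> 1" using p assms unfolding e_def by auto
      then have m: "m = \<bar>e\<bar>" unfolding m_def by simp
      have "(max 0 q) ^ 3 - (max 0 p) ^ 3 - 3 * (max 0 p)\<^sup>2 * e - 3 * max 0 p * e\<^sup>2 = e * e\<^sup>2"
        using True p unfolding q by (simp add: power3_eq_cube power2_eq_square algebra_simps)
      then have "\<bar>(max 0 q) ^ 3 - (max 0 p) ^ 3 - 3 * (max 0 p)\<^sup>2 * e - 3 * max 0 p * e\<^sup>2\<bar> = m * e\<^sup>2"
        by (simp add: m abs_mult)
      then show ?thesis using me by linarith
    next
      case False
      then have pe: "p \<le> \<bar>e\<bar>" using p unfolding e_def by auto
      then have pm: "p \<le> m" using assms unfolding m_def by simp
      have 1: "p ^ 3 \<le> m * e\<^sup>2"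
      proof -
        have "p\<^sup>2 \<le> \<bar>e\<bar>\<^sup>2" using p pe by (intro power_mono) auto
        then have "p * p\<^sup>2 \<le> m * e\<^sup>2" using p pm m0 by (intro mult_mono) auto
        then show ?thesis by (simp add: power3_eq_cube power2_eq_square)
      qed
      have 2: "\<bar>p\<^sup>2 * e\<bar> \<le> m * e\<^sup>2"
      proof -
        have "p * (p * \<bar>e\<bar>) \<le> m * (\<bar>e\<bar> * \<bar>e\<bar>)" using p pm pe m0 by (intro mult_mono) auto
        then show ?thesis using p by (simp add: abs_mult power2_eq_square)
      qed
      have 3: "p * e\<^sup>2 \<le> m * e\<^sup>2" using pm by (intro mult_right_mono) auto
      have "0 \<le> p ^ 3" "0 \<le> p * e\<^sup>2" using p by auto
      then have "\<bar>- (p ^ 3) - 3 * (p\<^sup>2 * e) - 3 * (p * e\<^sup>2)\<bar> \<le> 7 * (m * e\<^sup>2)"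
        using 1 2 3 by linarith
      moreover have "(max 0 q) ^ 3 - (max 0 p) ^ 3 - 3 * (max 0 p)\<^sup>2 * e - 3 * max 0 p * e\<^sup>2
        = - (p ^ 3) - 3 * (p\<^sup>2 * e) - 3 * (p * e\<^sup>2)"
        using False p by (simp add: mult.assoc)
      ultimately show ?thesis by (simp only:)
    qed
  next
    case p: False
    show ?thesis
    proof (cases "0 \<le> q")
      case True
      then have qe: "q \<le> \<bar>e\<bar>" using p unfolding e_def by auto
      then have qm: "q \<le> m" using assms unfolding m_def by simp
      have "q\<^sup>2 \<le> \<bar>e\<bar>\<^sup>2" using True qe by (intro power_mono) auto
      then have "q * q\<^sup>2 \<le> m * e\<^sup>2" using True qm m0 by (intro mult_mono) auto
      moreover have "0 \<le> q * q\<^sup>2" using True by simp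
      ultimately have "\<bar>q * q\<^sup>2\<bar> \<le> 7 * (m * e\<^sup>2)" using me by linarith
      moreover have "(max 0 q) ^ 3 - (max 0 p) ^ 3 - 3 * (max 0 p)\<^sup>2 * e - 3 * max 0 p * e\<^sup>2 = q * q\<^sup>2"
        using True p by (simp add: power3_eq_cube power2_eq_square)
      ultimately show ?thesis by (simp only:)
    next
      case False
      then show ?thesis using p me by simp
    qed
  qed
  then show ?thesis unfolding m_def e_def .
qed

context stationary_diffusion
begin

text \<open>
  Suppose that the law misses a ball, and let \<open>rs\<close> be the largest radius of a null ball with the
  same centre, so that slightly larger balls have positive mass. The test function
  \<open>u\<^sup>3\<close> with \<open>u = (rs + d - |x - x0|)\<^sub>+\<close> decreases away from the ball and is twice continuously
  differentiable except at \<open>x0\<close>. Off the ball the generator maps it to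
  \<open>3 u (\<sigma>\<^sup>2 - sgn (x - x0) b u)\<close>. As \<open>u \<le> d\<close> there, this is at least \<open>3 u (\<kappa> - b0 d)\<close>, which is positive
  for small \<open>d\<close> wherever \<open>u > 0\<close>. A stationary law cannot put mass there: near the edge of a gap, noise would push the process across.
\<close>

lemma full_support:
  assumes nondeg: "0 < \<kappa>" "\<And>x. \<kappa> \<le> (\<sigma> x)\<^sup>2" and r: "0 < r"
  shows "measure \<nu> (ball x0 r) > 0"
proof (rule ccontr)
  assume "\<not> measure \<nu> (ball x0 r) > 0"
  then have r0: "measure \<nu> (ball x0 r) = 0" using zero_less_measure_iff by blast
  interpret \<nu>: prob_space \<nu> by (rule prob_space_\<nu>)
  have space\<nu>: "space \<nu> = UNIV" using sets_eq_imp_space_eq[OF sets_\<nu>] by simp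
  have mono: "measure \<nu> (ball x0 s) \<le> measure \<nu> (ball x0 t)" if "s \<le> t" for s t
    using that by (intro \<nu>.finite_measure_mono subset_ball) auto
  define S where "S = {s. 0 < s \<and> measure \<nu> (ball x0 s) = 0}"
  have "r \<in> S" using r r0 unfolding S_def by simp
  have bdd: "bdd_above S"
  proof -
    have "(\<lambda>n. measure \<nu> (ball x0 (real n))) \<longlonglongrightarrow> measure \<nu> (\<Union>n. ball x0 (real n))"
      by (intro \<nu>.finite_Lim_measure_incseq) (auto simp: incseq_def)
    also have "(\<Union>n. ball x0 (real n)) = space \<nu>"
      using space\<nu> reals_Archimedean2 by auto
    finally have "(\<lambda>n. measure \<nu> (ball x0 (real n))) \<longlonglongrightarrow> 1" by (simp add: \<nu>.prob_space)
    from order_tendstoD(1)[OF this, of 0] obtain n where n: "0 < measure \<nu> (ball x0 (real n))"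
      by (auto simp: eventually_sequentially)
    have "s \<le> real n" if "s \<in> S" for s
      using mono[of "real n" s] n that unfolding S_def by (cases "s \<le> real n") auto
    then show ?thesis by (rule bdd_aboveI)
  qed
  define rs where "rs = Sup S"
  have rs: "0 < rs" using cSup_upper[OF \<open>r \<in> S\<close> bdd] r unfolding rs_def by simp
  have below: "measure \<nu> (ball x0 s) = 0" if s: "s < rs" for s
  proof -
    have "\<exists>s'\<in>S. s < s'"
      using less_cSupD[of S s] s \<open>r \<in> S\<close> unfolding rs_def by blast
    then obtain s' where "s' \<in> S" "s < s'" by blast
    then show ?thesis using mono[of s s'] measure_nonneg[of \<nu> "ball x0 s"] unfolding S_def by auto
  qed
  let ?N = "ball x0 rs"
  have N: "?N \<in> null_sets \<nu>"
  proof -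
    have "(\<Union>n. ball x0 (rs - inverse (real (Suc n)))) \<in> null_sets \<nu>"
      using below by (intro null_sets_UN null_setsI) (auto simp: \<nu>.emeasure_eq_measure)
    also have "(\<Union>n. ball x0 (rs - inverse (real (Suc n)))) = ?N"
    proof (intro equalityI subsetI)
      fix x assume "x \<in> ?N"
      then have "0 < rs - dist x0 x" by simp
      from reals_Archimedean[OF this] show "x \<in> (\<Union>n. ball x0 (rs - inverse (real (Suc n))))"
        by (auto simp: algebra_simps)
    next
      fix x assume "x \<in> (\<Union>n. ball x0 (rs - inverse (real (Suc n))))"
      then obtain n where "dist x0 x < rs - inverse (real (Suc n))" by auto
      moreover have "0 < inverse (real (Suc n))" by simp
      ultimately show "x \<in> ?N" unfolding mem_ball by linarith
    qed
    finally show ?thesis .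
  qed
  have above: "0 < measure \<nu> (ball x0 (rs + d))" if "0 < d" for d
  proof (rule ccontr)
    assume "\<not> ?thesis"
    then have "rs + d \<in> S" using rs that unfolding S_def by (simp add: zero_less_measure_iff)
    from cSup_upper[OF this bdd] show False using that unfolding rs_def by simp
  qed
  obtain A where A: "0 \<le> A" "\<And>x. \<bar>b x\<bar> \<le> A * (1 + \<bar>x\<bar>)"
    by (rule linear_growth) (rule that)
  define b0 where "b0 = A * (2 + \<bar>x0\<bar> + rs)"
  have b0: "0 \<le> b0" "\<bar>b x\<bar> \<le> b0" if "\<bar>x - x0\<bar> \<le> rs + 1" for x
  proof -
    show "0 \<le> b0" unfolding b0_def using A(1) rs by simp
    have "A * (1 + \<bar>x\<bar>) \<le> b0" unfolding b0_def using that A(1) by (intro mult_left_mono) auto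
    then show "\<bar>b x\<bar> \<le> b0" using A(2)[of x] by simp
  qed
  have b00: "0 \<le> b0" using b0(1)[of x0] rs by simp
  define d where "d = min 1 (\<kappa> / (b0 + 1))"
  have d: "0 < d" "d \<le> 1" "b0 * d < \<kappa>"
  proof -
    show "0 < d" "d \<le> 1" unfolding d_def using nondeg b00 by auto
    have "b0 * d \<le> b0 * (\<kappa> / (b0 + 1))" unfolding d_def using b00 by (intro mult_left_mono) auto
    also have "\<dots> < \<kappa>" using b00 nondeg by (simp add: field_simps)
    finally show "b0 * d < \<kappa>" .
  qed
  define c where "c = rs + d"
  define u where "u x = max 0 (c - \<bar>x - x0\<bar>)" for x
  have um [measurable]: "u \<in> borel_measurable borel" unfolding u_def by measurable
  have c0: "0 < c" unfolding c_def using rs d by simp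
  have u0: "0 \<le> u x" "u x \<le> c" for x unfolding u_def using c0 by auto
  have uN: "u x \<le> d" "u x \<le> 1" "c - \<bar>x - x0\<bar> \<le> 1" if "x \<notin> ?N" for x
    using that d unfolding u_def c_def by (auto simp: dist_real_def)
  define \<rho> where "\<rho> = 2 * rs"
  define k where "k = min 1 \<rho>"
  have \<rho>: "0 < \<rho>" "0 < k" "k \<le> \<rho>" "k \<le> 1" unfolding \<rho>_def k_def using rs by auto
  define C where "C = (1 / \<rho>\<^sup>2 + 3 / \<rho> + 3) / k"
  have C0: "0 \<le> C" unfolding C_def using \<rho> by simp
  define B where "B = 7 + C + (c ^ 3 + 3 * c\<^sup>2 + 6 * c)"
  have c3: "0 \<le> c ^ 3" "0 \<le> c\<^sup>2" using c0 by auto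
  have B0: "7 \<le> B" "C \<le> B" "c ^ 3 \<le> B" "3 * c\<^sup>2 \<le> B" "6 * c \<le> B" unfolding B_def using C0 c0 c3 by linarith+
  have u2: "(u x)\<^sup>2 \<le> c\<^sup>2" "(u x) ^ 3 \<le> c ^ 3" for x using u0 by (auto intro!: power_mono)
  have gen: "(\<integral>x. (- 3 * sgn (x - x0) * (u x)\<^sup>2) * b x + (6 * u x) / 2 * (\<sigma> x)\<^sup>2 \<partial>\<nu>) = 0"
  proof (rule generator_identity[where \<phi>="\<lambda>x. (u x) ^ 3" and B=B, OF _ _ _ _ _ _ N])
    show "\<bar>(u x) ^ 3\<bar> \<le> B" for x using u2(2)[of x] B0 u0(1)[of x] by simp
    show "\<bar>- 3 * sgn (x - x0) * (u x)\<^sup>2\<bar> \<le> B" for x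
    proof -
      have "\<bar>- 3 * sgn (x - x0) * (u x)\<^sup>2\<bar> \<le> 3 * (u x)\<^sup>2" by (simp add: abs_mult sgn_real_def)
      then show ?thesis using u2(1)[of x] B0 by linarith
    qed
    show "\<bar>6 * u x\<bar> \<le> B" for x using u0[of x] B0 by simp
  next
    fix x y assume xy: "x \<notin> ?N" "y \<notin> ?N"
    let ?T = "(u y) ^ 3 - (u x) ^ 3 - (- 3 * sgn (x - x0) * (u x)\<^sup>2) * (y - x) - 6 * u x / 2 * (y - x)\<^sup>2"
    let ?p = "c - \<bar>x - x0\<bar>" and ?q = "c - \<bar>y - x0\<bar>" and ?m = "min 1 \<bar>y - x\<bar> * (y - x)\<^sup>2"
    have far: "rs \<le> \<bar>x - x0\<bar>" "rs \<le> \<bar>y - x0\<bar>" using xy by (auto simp: dist_real_def)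
    have m0: "0 \<le> ?m" by simp
    (* Points on the same side of the gap see one truncated cube; points on opposite sides are at least 2 rs apart. *)
    consider "0 < x - x0" "0 < y - x0" | "x - x0 < 0" "y - x0 < 0" | "\<rho> \<le> \<bar>y - x\<bar>"
      using far rs unfolding \<rho>_def by linarith
    then show "\<bar>?T\<bar> \<le> B * ?m"
    proof cases
      case 1
      have "?T = (max 0 ?q) ^ 3 - (max 0 ?p) ^ 3 - 3 * (max 0 ?p)\<^sup>2 * (?q - ?p) - 3 * max 0 ?p * (?q - ?p)\<^sup>2"
        using 1 unfolding u_def by (simp add: power2_commute algebra_simps)
      also have "\<bar>\<dots>\<bar> \<le> 7 * (min 1 \<bar>?q - ?p\<bar> * (?q - ?p)\<^sup>2)" by (intro cube_taylor uN xy)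
      also have "?q - ?p = - (y - x)" using 1 by simp
      also have "7 * (min 1 \<bar>- (y - x)\<bar> * (- (y - x))\<^sup>2) = 7 * ?m" by (simp add: power2_commute abs_minus_commute)
      also have "\<dots> \<le> B * ?m" using B0 m0 by (intro mult_right_mono)
      finally show ?thesis .
    next
      case 2
      have "?T = (max 0 ?q) ^ 3 - (max 0 ?p) ^ 3 - 3 * (max 0 ?p)\<^sup>2 * (?q - ?p) - 3 * max 0 ?p * (?q - ?p)\<^sup>2"
        using 2 unfolding u_def by (simp add: algebra_simps)
      also have "\<bar>\<dots>\<bar> \<le> 7 * (min 1 \<bar>?q - ?p\<bar> * (?q - ?p)\<^sup>2)" by (intro cube_taylor uN xy)
      also have "?q - ?p = y - x" using 2 by simp
      also have "7 * ?m \<le> B * ?m" using B0 m0 by (intro mult_right_mono)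
      finally show ?thesis .
    next
      case 3
      define e where "e = \<bar>y - x\<bar>"
      have e: "\<rho> \<le> e" "0 < e" using 3 \<rho> unfolding e_def by auto
      have ux: "0 \<le> u x" "u x \<le> 1" "0 \<le> u y" "u y \<le> 1" using u0 uN xy by auto
      have p: "(u y) ^ 3 \<le> 1" "(u x) ^ 3 \<le> 1" "(u x)\<^sup>2 \<le> 1" "0 \<le> (u y) ^ 3" "0 \<le> (u x) ^ 3"
        using ux by (auto simp: power_le_one)
      have t1: "\<bar>(u y) ^ 3 - (u x) ^ 3\<bar> \<le> 1" using p by linarith
      have t2: "\<bar>(- 3 * sgn (x - x0) * (u x)\<^sup>2) * (y - x)\<bar> \<le> 3 * e"
      proof -
        have "\<bar>- 3 * sgn (x - x0) * (u x)\<^sup>2\<bar> \<le> 3" using p by (simp add: abs_mult sgn_real_def)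
        then show ?thesis unfolding e_def abs_mult[of _ "y - x"] by (intro mult_right_mono) auto
      qed
      have t3: "\<bar>6 * u x / 2 * (y - x)\<^sup>2\<bar> \<le> 3 * e\<^sup>2"
      proof -
        have "\<bar>6 * u x / 2\<bar> * (y - x)\<^sup>2 \<le> 3 * (y - x)\<^sup>2" using ux by (intro mult_right_mono) auto
        then show ?thesis unfolding e_def by (simp add: abs_mult)
      qed
      have "\<bar>?T\<bar> \<le> 1 + 3 * e + 3 * e\<^sup>2" using t1 t2 t3 by linarith
      also have "\<dots> \<le> (1 / \<rho>\<^sup>2 + 3 / \<rho> + 3) * e\<^sup>2"
      proof -
        have "\<rho>\<^sup>2 \<le> e\<^sup>2" using e \<rho> by (intro power_mono) auto
        then have "1 \<le> 1 / \<rho>\<^sup>2 * e\<^sup>2" using \<rho> by simp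
        moreover have "3 * e \<le> 3 / \<rho> * e\<^sup>2" using e \<rho> by (simp add: field_simps power2_eq_square)
        ultimately show ?thesis by (simp add: algebra_simps)
      qed
      also have "\<dots> = C * (k * e\<^sup>2)" unfolding C_def using \<rho> by simp
      also have "\<dots> \<le> C * ?m"
      proof -
        have "k \<le> min 1 \<bar>y - x\<bar>" using e \<rho> unfolding e_def k_def by simp
        then have "k * e\<^sup>2 \<le> ?m" unfolding e_def by (simp add: mult_right_mono)
        then show ?thesis using C0 by (rule mult_left_mono)
      qed
      also have "\<dots> \<le> B * ?m" using B0 m0 by (intro mult_right_mono)
      finally show ?thesis .
    qed
  qed measurable
  let ?g = "\<lambda>x. (- 3 * sgn (x - x0) * (u x)\<^sup>2) * b x + (6 * u x) / 2 * (\<sigma> x)\<^sup>2"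
  have lower: "3 * u x * (\<kappa> - b0 * d) \<le> ?g x" if x: "x \<notin> ?N" for x
  proof (cases "u x = 0")
    case False
    then have "\<bar>x - x0\<bar> \<le> rs + 1" using u0(1)[of x] d unfolding u_def c_def by auto
    then have bx: "\<bar>b x\<bar> \<le> b0" using b0 by simp
    have "sgn (x - x0) * u x * b x \<le> \<bar>sgn (x - x0) * u x * b x\<bar>" by simp
    also have "\<dots> \<le> u x * \<bar>b x\<bar>" using u0(1)[of x] by (auto simp: abs_mult sgn_real_def)
    also have "\<dots> \<le> d * b0" using bx uN[OF x] u0(1)[of x] d by (intro mult_mono) auto
    finally have "\<kappa> - b0 * d \<le> (\<sigma> x)\<^sup>2 - sgn (x - x0) * u x * b x"
      using nondeg(2)[of x] by (simp add: mult.commute)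
    then have "3 * u x * (\<kappa> - b0 * d) \<le> 3 * u x * ((\<sigma> x)\<^sup>2 - sgn (x - x0) * u x * b x)"
      using u0(1)[of x] by (intro mult_left_mono) auto
    also have "\<dots> = ?g x" by (simp add: algebra_simps power2_eq_square)
    finally show ?thesis .
  qed simp
  have gi: "integrable \<nu> ?g"
  proof -
    have fm: "integrable \<nu> (\<lambda>x. f x * g x)" if "f \<in> borel_measurable borel" "\<And>x. \<bar>f x\<bar> \<le> B" "integrable \<nu> g" for f g :: "real \<Rightarrow> real"
      by (rule Bochner_Integration.integrable_bound[OF integrable_mult_right[OF that(3), of B]])
         (use that B0 in \<open>auto intro!: AE_I2 mult_right_mono simp: abs_mult\<close>)
    have l: "\<bar>- 3 * sgn (x - x0) * (u x)\<^sup>2\<bar> \<le> B" for x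
    proof -
      have "\<bar>- 3 * sgn (x - x0) * (u x)\<^sup>2\<bar> \<le> 3 * (u x)\<^sup>2" by (simp add: abs_mult sgn_real_def)
      then show ?thesis using u2(1)[of x] B0 by linarith
    qed
    have l2: "\<bar>6 * u x / 2\<bar> \<le> B" for x using u0[of x] B0 by simp
    show ?thesis
      using integrable_\<nu>_powers(1)[of 1] integrable_\<nu>_powers(2)[of 2]
      by (intro Bochner_Integration.integrable_add fm l l2) auto
  qed
  have NAE: "AE x in \<nu>. x \<notin> ?N" using N by (rule AE_not_in)
  have "AE x in \<nu>. 0 \<le> ?g x"
    using NAE
  proof eventually_elim
    case (elim x)
    have "0 \<le> 3 * u x * (\<kappa> - b0 * d)" using u0(1)[of x] d by simp
    then show ?case using lower[OF elim] by linarith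
  qed
  from integral_nonneg_eq_0_iff_AE[OF gi this] gen have "AE x in \<nu>. ?g x = 0" by simp
  with NAE have "AE x in \<nu>. x \<notin> ball x0 c"
  proof eventually_elim
    case (elim x)
    have "3 * u x * (\<kappa> - b0 * d) \<le> 0" using lower[OF elim(1)] elim(2) by linarith
    then have "u x \<le> 0" using d by (simp add: mult_le_0_iff)
    then show ?case unfolding u_def by (auto simp: dist_real_def)
  qed
  then have "measure \<nu> (ball x0 c) = 0"
    using \<nu>.prob_eq_0[of "ball x0 c"] by simp
  then show False using above[OF d(1)] unfolding c_def by simp
qed

end

section \<open>A one-sided ergodic theorem\<close>

lemma LBINT_abs_le:
  fixes f :: "real \<Rightarrow> real"
  assumes "continuous_on UNIV f" "s \<le> t" "\<And>r. s \<le> r \<Longrightarrow> r \<le> t \<Longrightarrow> \<bar>f r\<bar> \<le> B"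
  shows "\<bar>LBINT r:{s..t}. f r\<bar> \<le> B * (t - s)"
proof -
  have i: "set_integrable lborel {s..t} f"
    by (intro borel_integrable_atLeastAtMost' continuous_on_subset[OF assms(1)]) auto
  have "\<bar>LBINT r:{s..t}. f r\<bar> = norm (integral {s..t} f)"
    using set_borel_integral_eq_integral(2)[OF i] by simp
  also have "\<dots> \<le> B * (t - s)"
    using assms by (intro integral_bound continuous_on_subset[OF assms(1)]) auto
  finally show ?thesis .
qed

lemma LBINT_shift:
  fixes f :: "real \<Rightarrow> real"
  shows "(LBINT s:{0..n}. f (t + s)) = (LBINT s:{t..t + n}. f s)"
proof -
  have "(LBINT s:{t..t + n}. f s) = (\<integral>s. indicator {t..t + n} (t + 1 * s) *\<^sub>R f (t + 1 * s) \<partial>lborel)"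
    unfolding set_lebesgue_integral_def by (subst lborel_integral_real_affine[of 1 _ t]) auto
  also have "\<dots> = (LBINT s:{0..n}. f (t + s))"
    unfolding set_lebesgue_integral_def
    by (intro Bochner_Integration.integral_cong refl) (simp add: indicator_def)
  finally show ?thesis ..
qed

text \<open>
  An exact formula, to be used both for fixed paths and, in mean, along vanishing meshes.
\<close>

lemma riemann_sum_error:
  fixes f :: "real \<Rightarrow> real"
  assumes f: "continuous_on UNIV f" and h: "0 \<le> h"
  shows "h * (\<Sum>j<N. f (real j * h)) - (LBINT s:{0..real N * h}. f s)
    = (\<Sum>j<N. LBINT s:{real j * h..real j * h + h}. f (real j * h) - f s)"
proof (induction N)
  case 0
  have "\<bar>LBINT s:{0..0}. f s\<bar> \<le> \<bar>f 0\<bar> * (0 - 0)"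
    by (rule LBINT_abs_le[OF f]) auto
  then show ?case by simp
next
  case (Suc N)
  have "(LBINT s:{0..real (Suc N) * h}. f s) = (LBINT s:{0..real N * h}. f s) + (LBINT s:{real N * h..real N * h + h}. f s)"
    using LBINT_split[OF f, of 0 "real N * h" "real N * h + h"] h by (simp add: algebra_simps)
  moreover have "(LBINT s:{real N * h..real N * h + h}. f (real N * h) - f s) =
    h * f (real N * h) - (LBINT s:{real N * h..real N * h + h}. f s)"
  proof -
    have "set_integrable lborel {real N * h..real N * h + h} f"
      by (intro borel_integrable_atLeastAtMost' continuous_on_subset[OF f]) auto
    moreover have "set_integrable lborel {real N * h..real N * h + h} (\<lambda>_. f (real N * h))"
      by (intro borel_integrable_atLeastAtMost') auto
    moreover have "(LBINT s:{real N * h..real N * h + h}. f (real N * h)) = h * f (real N * h)"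
      using h by (simp add: set_lebesgue_integral_def)
    ultimately show ?thesis by (simp add: set_integral_diff)
  qed
  ultimately show ?case using Suc by (simp add: algebra_simps)
qed

definition dyadic_riemann_sum :: "(real \<Rightarrow> real) \<Rightarrow> nat \<Rightarrow> nat \<Rightarrow> real" where
  "dyadic_riemann_sum f n k = (1 / 2 ^ k) * (\<Sum>j<n * 2 ^ k. f (real j * (1 / 2 ^ k)))"

lemma dyadic_riemann_sum_tendsto:
  fixes f :: "real \<Rightarrow> real"
  assumes f: "continuous_on UNIV f"
  shows "dyadic_riemann_sum f n \<longlonglongrightarrow> (LBINT s:{0..real n}. f s)"
proof (rule LIMSEQ_I)
  fix e :: real assume e: "0 < e"
  define e' where "e' = e / (real n + 1)"
  have e': "0 < e'" "real n * e' < e" unfolding e'_def using e by (auto simp: field_simps)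
  have "uniformly_continuous_on {0..real n} f"
    by (intro compact_uniformly_continuous continuous_on_subset[OF f]) auto
  then obtain d where d: "0 < d"
    "\<And>x y. x \<in> {0..real n} \<Longrightarrow> y \<in> {0..real n} \<Longrightarrow> dist y x < d \<Longrightarrow> dist (f y) (f x) < e'"
    unfolding uniformly_continuous_on_def using e' by metis
  obtain k0 where k0: "(1 / 2 :: real) ^ k0 < d"
    using real_arch_pow_inv[of d "1/2"] d(1) by auto
  show "\<exists>k0. \<forall>k\<ge>k0. norm (dyadic_riemann_sum f n k - (LBINT s:{0..real n}. f s)) < e"
  proof (intro exI allI impI)
    fix k assume "k0 \<le> k"
    define h :: real where "h = 1 / 2 ^ k"
    have h0: "0 < h" unfolding h_def by simp
    have "h = (1/2) ^ k" unfolding h_def by (simp add: power_divide)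
    also have "\<dots> \<le> (1/2) ^ k0" using \<open>k0 \<le> k\<close> by (intro power_decreasing) auto
    finally have hd: "h < d" using k0 by simp
    have nh: "real (n * 2 ^ k) * h = real n" unfolding h_def by simp
    have "dyadic_riemann_sum f n k - (LBINT s:{0..real n}. f s) =
      (\<Sum>j<n * 2 ^ k. LBINT s:{real j * h..real j * h + h}. f (real j * h) - f s)"
      using riemann_sum_error[OF f, of h "n * 2 ^ k"] h0 unfolding nh
      by (simp add: dyadic_riemann_sum_def h_def[symmetric])
    also have "norm \<dots> \<le> (\<Sum>j<n * 2 ^ k. e' * h)"
    proof (rule order_trans[OF norm_sum sum_mono])
      fix j assume j: "j \<in> {..<n * 2 ^ k}"
      have "Suc j \<le> n * 2 ^ k" using j by simp
      then have "real (Suc j) * h \<le> real (n * 2 ^ k) * h"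
        using h0 by (intro mult_right_mono) (simp_all only: of_nat_le_iff less_imp_le)
      then have jn: "real j * h + h \<le> real n" unfolding nh by (simp add: algebra_simps)
      have "\<bar>f (real j * h) - f r\<bar> \<le> e'" if "real j * h \<le> r" "r \<le> real j * h + h" for r
      proof -
        have j0: "0 \<le> real j * h" using h0 by simp
        have "0 \<le> r" using j0 that(1) by linarith
        then have "dist (f (real j * h)) (f r) < e'"
          using that jn h0 hd by (intro d(2)) (auto simp: dist_real_def)
        then show ?thesis by (simp add: dist_real_def)
      qed
      then have "\<bar>LBINT s:{real j * h..real j * h + h}. f (real j * h) - f s\<bar> \<le> e' * (real j * h + h - real j * h)"
        using h0 by (intro LBINT_abs_le continuous_on_diff continuous_on_const f) auto
      then show "norm (LBINT s:{real j * h..real j * h + h}. f (real j * h) - f s) \<le> e' * h" by simp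
    qed
    also have "\<dots> = e' * (real (n * 2 ^ k) * h)" by simp
    also have "\<dots> = real n * e'" unfolding nh by simp
    also have "\<dots> < e" by (rule e')
    finally show "norm (dyadic_riemann_sum f n k - (LBINT s:{0..real n}. f s)) < e" .
  qed
qed

locale stationary_ergodic_process = prob_space M for M :: "'a measure" +
  fixes X :: "real \<Rightarrow> 'a \<Rightarrow> real"
  assumes path_continuous: "\<And>\<omega>. \<omega> \<in> space M \<Longrightarrow> continuous_on UNIV (\<lambda>t. X t \<omega>)"
    and path_measurable [measurable]: "\<And>t. X t \<in> borel_measurable M"
    and is_stationary: "stationary M X"
    and is_ergodic: "ergodic M X"
begin

lemma shifted_path_measurable [measurable]: "shifted_path X t \<in> measurable M path_space"
  unfolding shifted_path_def path_space_def by measurable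

lemma expectation_shifted_path:
  fixes \<Phi> :: "(real \<Rightarrow> real) \<Rightarrow> real"
  assumes "0 \<le> t" "\<Phi> \<in> borel_measurable path_space"
  shows "expectation (\<lambda>\<omega>. \<Phi> (shifted_path X t \<omega>)) = expectation (\<lambda>\<omega>. \<Phi> (shifted_path X 0 \<omega>))"
proof -
  have eq: "distr M path_space (shifted_path X t) = distr M path_space (shifted_path X 0)"
    using is_stationary[unfolded stationary_def, rule_format, OF assms(1)] .
  show ?thesis
    unfolding integral_distr[OF shifted_path_measurable assms(2), symmetric] eq ..
qed

text \<open>
  The time integral as a functional of the path that is measurable for the product sigma-algebra,
  which sees countably many coordinates only. On continuous paths it is the integral.
\<close>

definition path_integral :: "(real \<Rightarrow> real) \<Rightarrow> nat \<Rightarrow> (real \<Rightarrow> real) \<Rightarrow> real" where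
  "path_integral g n w = lim (dyadic_riemann_sum (\<lambda>s. g (w s)) n)"

lemma path_integral_measurable [measurable]:
  assumes [measurable]: "g \<in> borel_measurable borel"
  shows "path_integral g n \<in> borel_measurable path_space"
proof -
  have [measurable]: "(\<lambda>w. w (real j * (1 / 2 ^ k))) \<in> borel_measurable path_space" for j k
    unfolding path_space_def by (intro measurable_component_singleton) simp
  show ?thesis
    unfolding path_integral_def dyadic_riemann_sum_def by measurable
qed

lemma path_integral_shifted:
  assumes g: "continuous_on UNIV g" and \<omega>: "\<omega> \<in> space M"
  shows "dyadic_riemann_sum (\<lambda>s. g (shifted_path X t \<omega> s)) n \<longlonglongrightarrow> (LBINT s:{t..t + real n}. g (X s \<omega>))"
    and "path_integral g n (shifted_path X t \<omega>) = (LBINT s:{t..t + real n}. g (X s \<omega>))"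
proof -
  have c: "continuous_on UNIV (\<lambda>s. g (X (t + s) \<omega>))"
    by (intro continuous_on_compose2[OF g] continuous_on_compose2[OF path_continuous[OF \<omega>]] continuous_intros) auto
  have "dyadic_riemann_sum (\<lambda>s. g (shifted_path X t \<omega> s)) n = dyadic_riemann_sum (\<lambda>s. g (X (t + s) \<omega>)) n"
    unfolding dyadic_riemann_sum_def shifted_path_def by (intro ext) simp
  with dyadic_riemann_sum_tendsto[OF c, of n]
  show *: "dyadic_riemann_sum (\<lambda>s. g (shifted_path X t \<omega> s)) n \<longlonglongrightarrow> (LBINT s:{t..t + real n}. g (X s \<omega>))"
    by (simp add: LBINT_shift[of "real n" "\<lambda>s. g (X s \<omega>)" t])
  show "path_integral g n (shifted_path X t \<omega>) = (LBINT s:{t..t + real n}. g (X s \<omega>))"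
    unfolding path_integral_def using * by (rule limI)
qed

text \<open>
  Garsia's proof of the ergodic theorem, one-sided. Boundedness of the integrand makes the event
  that the running integrals are unbounded above invariant under every real shift. If it had
  positive probability, it would have probability one by ergodicity, and the maximal inequality
  would make the mean of the integrand non-negative.
\<close>

lemma negative_mean_bounded_integrals:
  fixes g :: "real \<Rightarrow> real"
  assumes g: "continuous_on UNIV g" and bound: "\<And>x. \<bar>g x\<bar> \<le> B"
    and mean: "\<And>t. 0 \<le> t \<Longrightarrow> expectation (\<lambda>\<omega>. g (X t \<omega>)) = \<mu>" "\<mu> < 0"
  shows "AE \<omega> in M. \<exists>C. \<forall>n::nat. (LBINT s:{0..real n}. g (X s \<omega>)) \<le> C"
proof -
  have gm [measurable]: "g \<in> borel_measurable borel" using g by (rule borel_measurable_continuous_onI)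
  have B0: "0 \<le> B" using bound[of 0] by linarith
  define L where "L n t \<omega> = (LBINT s:{t..t + real n}. g (X s \<omega>))" for n t \<omega>
  have pc: "continuous_on UNIV (\<lambda>s. g (X s \<omega>))" if "\<omega> \<in> space M" for \<omega>
    by (intro continuous_on_compose2[OF g] path_continuous[OF that]) auto
  have Lp: "path_integral g n (shifted_path X t \<omega>) = L n t \<omega>" if "\<omega> \<in> space M" for n t \<omega>
    unfolding L_def by (rule path_integral_shifted(2)[OF g that])
  have Lm [measurable]: "L n t \<in> borel_measurable M" for n t
  proof -
    have "(\<lambda>\<omega>. path_integral g n (shifted_path X t \<omega>)) \<in> borel_measurable M" by measurable
    then show ?thesis using Lp by (subst measurable_cong[where g="\<lambda>\<omega>. path_integral g n (shifted_path X t \<omega>)"]) auto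
  qed
  have Lb: "\<bar>L n t \<omega>\<bar> \<le> B * real n" if "\<omega> \<in> space M" for n t \<omega>
    using LBINT_abs_le[OF pc[OF that], of t "t + real n" B] bound unfolding L_def by simp
  have L0: "L 0 t \<omega> = 0" if "\<omega> \<in> space M" for t \<omega>
    using Lb[OF that, of 0 t] by simp
  have LSuc: "L (Suc n) 0 \<omega> = L 1 0 \<omega> + L n 1 \<omega>" if "\<omega> \<in> space M" for n \<omega>
    using LBINT_split[OF pc[OF that], of 0 1 "1 + real n"] unfolding L_def by simp
  define A where "A = {w \<in> space path_space. \<forall>C::nat. \<exists>n. path_integral g n w > real C}"
  have A [measurable]: "A \<in> sets path_space" unfolding A_def by measurable
  have inA: "shifted_path X t \<omega> \<in> A \<longleftrightarrow> (\<forall>C::nat. \<exists>n. L n t \<omega> > real C)" if "\<omega> \<in> space M" for t \<omega>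
    unfolding A_def using Lp[OF that] measurable_space[OF shifted_path_measurable that] by simp
  have invariant: "shifted_path X t \<omega> \<in> A \<longleftrightarrow> shifted_path X 0 \<omega> \<in> A" if \<omega>: "\<omega> \<in> space M" and t: "0 \<le> t" for t \<omega>
  proof -
    have close: "\<bar>L n t \<omega> - L n 0 \<omega>\<bar> \<le> 2 * B * t" for n
    proof -
      have "L n 0 \<omega> + (LBINT s:{real n..real n + t}. g (X s \<omega>)) = (LBINT s:{0..t}. g (X s \<omega>)) + L n t \<omega>"
        using LBINT_split[OF pc[OF \<omega>], of 0 t "t + real n"] LBINT_split[OF pc[OF \<omega>], of 0 "real n" "t + real n"] t
        unfolding L_def by (simp add: add.commute)
      moreover have "\<bar>LBINT s:{real n..real n + t}. g (X s \<omega>)\<bar> \<le> B * t" "\<bar>LBINT s:{0..t}. g (X s \<omega>)\<bar> \<le> B * t"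
        using LBINT_abs_le[OF pc[OF \<omega>], of "real n" "real n + t" B] LBINT_abs_le[OF pc[OF \<omega>], of 0 t B] bound t by auto
      ultimately show ?thesis by linarith
    qed
    have transfer: "\<forall>C::nat. \<exists>n. L n v \<omega> > real C"
      if unb: "\<forall>C::nat. \<exists>n. L n u \<omega> > real C" and c: "\<And>n. \<bar>L n u \<omega> - L n v \<omega>\<bar> \<le> 2 * B * t" for u v
    proof
      fix C :: nat
      obtain D :: nat where D: "real C + 2 * B * t \<le> real D" using real_arch_simple by blast
      obtain n where "L n u \<omega> > real D" using spec[OF unb, of D] by blast
      then have "L n v \<omega> > real C" using c[of n] D by linarith
      then show "\<exists>n. L n v \<omega> > real C" by blast
    qed
    have c1: "\<bar>L n t \<omega> - L n 0 \<omega>\<bar> \<le> 2 * B * t" and c2: "\<bar>L n 0 \<omega> - L n t \<omega>\<bar> \<le> 2 * B * t" for n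
      using close[of n] by (auto simp: abs_minus_commute)
    show ?thesis unfolding inA[OF \<omega>] using transfer[OF _ c1] transfer[OF _ c2] by blast
  qed
  define D where "D = {\<omega> \<in> space M. shifted_path X 0 \<omega> \<in> A}"
  have D [measurable]: "D \<in> sets M" unfolding D_def by measurable
  have "measure M D \<in> {0, 1}"
    using is_ergodic A invariant unfolding ergodic_def D_def by (blast intro: AE_I2)
  moreover have "measure M D \<noteq> 1"
  proof
    assume D1: "measure M D = 1"
    define U where "U N t \<omega> = Max ((\<lambda>n. L n t \<omega>) ` {..N})" for N t \<omega>
    define \<Phi> where "\<Phi> N w = Max ((\<lambda>n. path_integral g n w) ` {..N})" for N w
    have \<Phi>m: "\<Phi> N \<in> borel_measurable path_space" for N
      unfolding \<Phi>_def by measurable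
    have U\<Phi>: "\<Phi> N (shifted_path X t \<omega>) = U N t \<omega>" if "\<omega> \<in> space M" for N t \<omega>
      unfolding \<Phi>_def U_def by (simp add: Lp[OF that])
    have Um [measurable]: "U N t \<in> borel_measurable M" for N t
      unfolding U_def by measurable
    have U0: "0 \<le> U N t \<omega>" if "\<omega> \<in> space M" for N t \<omega>
      unfolding U_def using L0[OF that, of t] by (intro Max_ge) (auto intro!: image_eqI[of _ _ 0])
    have Ub: "U N t \<omega> \<le> B * real N" if "\<omega> \<in> space M" for N t \<omega>
      unfolding U_def
    proof (intro Max.boundedI)
      fix y assume "y \<in> (\<lambda>n. L n t \<omega>) ` {..N}"
      then obtain n where "n \<le> N" "y = L n t \<omega>" by auto
      moreover have "L n t \<omega> \<le> B * real n" using Lb[OF that, of n t] by linarith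
      moreover have "B * real n \<le> B * real N" using \<open>n \<le> N\<close> B0 by (intro mult_left_mono) auto
      ultimately show "y \<le> B * real N" by linarith
    qed auto
    have Ui: "integrable M (U N t)" for N t
      using U0 Ub by (intro integrable_const_bound[of _ "B * real N"]) (auto intro!: AE_I2)
    have Ueq: "expectation (U N 1) = expectation (U N 0)" for N
    proof -
      have "expectation (U N 1) = expectation (\<lambda>\<omega>. \<Phi> N (shifted_path X 1 \<omega>))"
        by (intro Bochner_Integration.integral_cong) (simp_all add: U\<Phi>)
      also have "\<dots> = expectation (\<lambda>\<omega>. \<Phi> N (shifted_path X 0 \<omega>))"
        by (intro expectation_shifted_path \<Phi>m) simp
      also have "\<dots> = expectation (U N 0)"
        by (intro Bochner_Integration.integral_cong) (simp_all add: U\<Phi>)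
      finally show ?thesis .
    qed
    have L1b: "\<bar>L 1 0 \<omega>\<bar> \<le> B" if "\<omega> \<in> space M" for \<omega> using Lb[OF that, of 1 0] by simp
    let ?f = "\<lambda>N \<omega>. L 1 0 \<omega> * of_bool (0 < U N 0 \<omega>)"
    have fi: "integrable M (?f N)" for N
      using L1b B0 by (intro integrable_const_bound[of _ B]) (auto intro!: AE_I2)
    (* A positive maximum over [0,n] is attained after time 1: it is at most the first unit integral plus the shifted maximum. *)
    have pt: "U N 0 \<omega> - U N 1 \<omega> \<le> ?f N \<omega>" if \<omega>: "\<omega> \<in> space M" for N \<omega>
    proof (cases "0 < U N 0 \<omega>")
      case True
      have "U N 0 \<omega> \<in> (\<lambda>n. L n 0 \<omega>) ` {..N}" unfolding U_def by (intro Max_in) auto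
      then obtain n where n: "n \<le> N" "U N 0 \<omega> = L n 0 \<omega>" by auto
      then have "n \<noteq> 0" using True L0[OF \<omega>] by (metis less_irrefl)
      then obtain k where k: "n = Suc k" using not0_implies_Suc by blast
      have "L k 1 \<omega> \<le> U N 1 \<omega>" unfolding U_def using n k by (intro Max_ge) auto
      then show ?thesis using True n(2) LSuc[OF \<omega>, of k] unfolding k by simp
    next
      case False
      then show ?thesis using U0[OF \<omega>, of N 1] by simp
    qed
    have nonneg: "0 \<le> expectation (?f N)" for N
    proof -
      have "0 = expectation (\<lambda>\<omega>. U N 0 \<omega> - U N 1 \<omega>)" using Ui Ueq[of N] by simp
      also have "\<dots> \<le> expectation (?f N)" using Ui fi pt by (intro integral_mono) auto
      finally show ?thesis .
    qed
    have AED: "AE \<omega> in M. \<omega> \<in> D" using D1 prob_eq_1[OF D] by simp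
    have "(\<lambda>N. expectation (?f N)) \<longlonglongrightarrow> expectation (L 1 0)"
    proof (rule integral_dominated_convergence[where w="\<lambda>_. B"])
      show "AE \<omega> in M. (\<lambda>N. ?f N \<omega>) \<longlonglongrightarrow> L 1 0 \<omega>"
        using AED
      proof eventually_elim
        case (elim \<omega>)
        then have \<omega>: "\<omega> \<in> space M" and "shifted_path X 0 \<omega> \<in> A" unfolding D_def by auto
        then obtain n where n: "0 < L n 0 \<omega>" using inA[OF \<omega>, of 0] by (metis of_nat_0)
        show ?case
        proof (rule tendsto_eventually)
          show "\<forall>\<^sub>F N in sequentially. ?f N \<omega> = L 1 0 \<omega>"
            using eventually_ge_at_top[of n]
          proof eventually_elim
            case (elim N)
            have "L n 0 \<omega> \<le> U N 0 \<omega>" unfolding U_def using elim by (intro Max_ge) auto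
            then show ?case using n by simp
          qed
        qed
      qed
      show "AE \<omega> in M. norm (?f N \<omega>) \<le> B" for N using L1b B0 by (auto intro!: AE_I2)
    qed auto
    then have L1nonneg: "0 \<le> expectation (L 1 0)"
      by (rule LIMSEQ_le_const) (use nonneg in auto)
    let ?J = "\<lambda>k \<omega>. dyadic_riemann_sum (\<lambda>s. g (shifted_path X 0 \<omega> s)) 1 k"
    have Jeq: "?J k \<omega> = (1 / 2 ^ k) * (\<Sum>j<2 ^ k. g (X (real j * (1 / 2 ^ k)) \<omega>))" for k \<omega>
      unfolding dyadic_riemann_sum_def shifted_path_def by simp
    have gi: "integrable M (\<lambda>\<omega>. g (X t \<omega>))" for t
      using bound by (intro integrable_const_bound[of _ B]) (auto intro!: AE_I2)
    have EJ: "expectation (?J k) = \<mu>" for k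
      unfolding Jeq using gi mean(1) by (simp add: Bochner_Integration.integral_sum)
    have "(\<lambda>k. expectation (?J k)) \<longlonglongrightarrow> expectation (L 1 0)"
    proof (rule integral_dominated_convergence[where w="\<lambda>_. B"])
      show "AE \<omega> in M. (\<lambda>k. ?J k \<omega>) \<longlonglongrightarrow> L 1 0 \<omega>"
        using path_integral_shifted(1)[OF g, of _ 0 1] unfolding L_def by (intro AE_I2)
      show "AE \<omega> in M. norm (?J k \<omega>) \<le> B" for k
      proof (intro AE_I2)
        fix \<omega>
        have "\<bar>\<Sum>j<2 ^ k. g (X (real j * (1 / 2 ^ k)) \<omega>)\<bar> \<le> (\<Sum>j<(2::nat) ^ k. B)"
          by (rule order_trans[OF sum_abs sum_mono]) (rule bound)
        then show "norm (?J k \<omega>) \<le> B" unfolding Jeq by (simp add: abs_mult field_simps)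
      qed
      show "?J k \<in> borel_measurable M" for k unfolding Jeq by measurable
    qed auto
    then have "expectation (L 1 0) = \<mu>" unfolding EJ by (simp add: LIMSEQ_const_iff)
    with L1nonneg mean(2) show False by simp
  qed
  ultimately have "measure M D = 0" by simp
  then have "AE \<omega> in M. \<omega> \<notin> D" using prob_eq_0[OF D] by simp
  then show ?thesis
  proof (rule AE_mp, intro AE_I2 impI)
    fix \<omega> assume \<omega>: "\<omega> \<in> space M" and "\<omega> \<notin> D"
    then have "\<not> (\<forall>C::nat. \<exists>n. L n 0 \<omega> > real C)" using inA[OF \<omega>, of 0] unfolding D_def by simp
    then obtain C :: nat where "\<forall>n. L n 0 \<omega> \<le> real C" by (auto simp: not_less)
    then show "\<exists>C. \<forall>n::nat. (LBINT s:{0..real n}. g (X s \<omega>)) \<le> C" unfolding L_def by auto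
  qed
qed

end

lemma (in prob_space) prob_tendsto_0_of_AE_eventually:
  assumes [measurable]: "\<And>n. Measurable.pred M (P n)"
    and ev: "AE \<omega> in M. \<forall>\<^sub>F n in sequentially. \<not> P n \<omega>"
  shows "(\<lambda>n. measure M {\<omega> \<in> space M. P n \<omega>}) \<longlonglongrightarrow> 0"
proof -
  have "(\<lambda>n. expectation (\<lambda>\<omega>. of_bool (P n \<omega>) :: real)) \<longlonglongrightarrow> expectation (\<lambda>\<omega>. 0)"
  proof (rule integral_dominated_convergence[where w="\<lambda>_. 1"])
    show "AE \<omega> in M. (\<lambda>n. of_bool (P n \<omega>)) \<longlonglongrightarrow> (0 :: real)"
      using ev
    proof eventually_elim
      case (elim \<omega>)
      show ?case
      proof (rule tendsto_eventually)
        show "\<forall>\<^sub>F n in sequentially. of_bool (P n \<omega>) = (0 :: real)"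
          using elim by eventually_elim simp
      qed
    qed
  qed auto
  moreover have "expectation (\<lambda>\<omega>. of_bool (P n \<omega>) :: real) = measure M {\<omega> \<in> space M. P n \<omega>}" for n
  proof -
    have "expectation (\<lambda>\<omega>. of_bool (P n \<omega>) :: real) = expectation (indicator {\<omega> \<in> space M. P n \<omega>})"
      by (intro Bochner_Integration.integral_cong) (auto simp: indicator_def)
    also have "\<dots> = measure M {\<omega> \<in> space M. P n \<omega>}" by simp
    finally show ?thesis .
  qed
  ultimately show ?thesis by simp
qed

lemma (in prob_space) prob_abs_ge_le:
  fixes f :: "'a \<Rightarrow> real"
  assumes [measurable]: "f \<in> borel_measurable M"
    and "(\<integral>\<^sup>+\<omega>. ennreal \<bar>f \<omega>\<bar> \<partial>M) \<le> ennreal c" "0 \<le> c" "0 < a"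
  shows "measure M {\<omega> \<in> space M. a \<le> \<bar>f \<omega>\<bar>} \<le> c / a"
proof -
  note i = integrable_of_nn_integral_le[OF _ _ assms(2,3)]
  have "measure M {\<omega> \<in> space M. a \<le> \<bar>f \<omega>\<bar>} \<le> expectation (\<lambda>\<omega>. \<bar>f \<omega>\<bar>) / a"
    using i assms(4) by (intro integral_Markov_inequality_measure[where A="space M"]) auto
  also have "\<dots> \<le> c / a" using i assms(4) by (intro divide_right_mono) auto
  finally show ?thesis .
qed

context stationary_diffusion
begin

text \<open>
  The integrand \<open>3 m / 4 - G\<close> has negative mean, so that the time integral of \<open>G\<close> eventually
  exceeds \<open>5 m / 8\<close> times the length of the interval. Sampling at a vanishing mesh loses
  nothing: the Riemann sum of a Lipschitz function along the path differs from the time integral,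
  in mean and relative to the length, by \<open>O(sqrt h)\<close>.
\<close>

lemma occupation_lower_bound:
  fixes G :: "real \<Rightarrow> real" and h :: "nat \<Rightarrow> real"
  assumes stat: "stationary M X" and erg: "ergodic M X"
    and G: "\<And>x. 0 \<le> G x" "\<And>x. G x \<le> 1" "\<And>x y. \<bar>G x - G y\<bar> \<le> \<Lambda> * \<bar>x - y\<bar>" "0 \<le> \<Lambda>"
    and m: "m = (\<integral>x. G x \<partial>\<nu>)" "0 < m"
    and h: "\<And>n. 0 < h n" "h \<longlonglongrightarrow> 0" "filterlim (\<lambda>n. real n * h n) at_top sequentially"
  shows "(\<lambda>n. measure M {\<omega> \<in> space M. (\<Sum>i<n. G (X (real i * h n) \<omega>)) < m / 2 * real n}) \<longlonglongrightarrow> 0"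
proof -
  interpret E: stationary_ergodic_process M X
    by unfold_locales (use X_continuous stat erg in auto)
  have Gc: "continuous_on UNIV G"
  proof (rule lipschitz_on_continuous_on)
    show "\<Lambda>-lipschitz_on UNIV G" using G by (intro lipschitz_onI) (auto simp: dist_real_def)
  qed
  have [measurable]: "G \<in> borel_measurable borel" using Gc by (rule borel_measurable_continuous_onI)
  have Gi: "integrable \<nu> G" using G(1,2) by (intro integrable_growth[of _ 1 0]) auto
  have pc: "continuous_on UNIV (\<lambda>s. G (X s \<omega>))" if "\<omega> \<in> space M" for \<omega>
    by (rule continuous_path_comp[OF Gc that])
  obtain C1 where C1: "0 \<le> C1"
    "\<And>s t. 0 \<le> s \<Longrightarrow> s \<le> t \<Longrightarrow> t \<le> s + 1 \<Longrightarrow> integrable M (\<lambda>\<omega>. (X t \<omega> - X s \<omega>)\<^sup>2)"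
    "\<And>s t. 0 \<le> s \<Longrightarrow> s \<le> t \<Longrightarrow> t \<le> s + 1 \<Longrightarrow> expectation (\<lambda>\<omega>. (X t \<omega> - X s \<omega>)\<^sup>2) \<le> C1 * (t - s)"
    by (rule increment_square) (rule that)
  define I where "I T \<omega> = (LBINT s:{0..T}. G (X s \<omega>))" for T \<omega>
  have Im [measurable]: "I T \<in> borel_measurable M" for T
    unfolding I_def set_lebesgue_integral_def by measurable
  define T where "T n = real n * h n" for n
  have T0: "0 \<le> T n" for n unfolding T_def using h(1)[of n] by simp
  have m1: "m \<le> 1"
  proof -
    interpret \<nu>: prob_space \<nu> by (rule prob_space_\<nu>)
    have "m \<le> (\<integral>x. 1 \<partial>\<nu>)" unfolding m(1) using Gi G by (intro integral_mono) auto
    then show ?thesis by (simp add: \<nu>.prob_space)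
  qed
  have time: "(\<lambda>n. measure M {\<omega> \<in> space M. I (T n) \<omega> < 5 * m / 8 * T n}) \<longlonglongrightarrow> 0"
  proof (rule prob_tendsto_0_of_AE_eventually)
    have "AE \<omega> in M. \<exists>C. \<forall>n::nat. (LBINT s:{0..real n}. 3 * m / 4 - G (X s \<omega>)) \<le> C"
    proof (rule E.negative_mean_bounded_integrals[where B=1 and \<mu>="- m / 4"])
      show "continuous_on UNIV (\<lambda>x. 3 * m / 4 - G x)" by (intro continuous_intros Gc)
      show "\<bar>3 * m / 4 - G x\<bar> \<le> 1" for x using G(1,2)[of x] m(2) m1 by linarith
      show "expectation (\<lambda>\<omega>. 3 * m / 4 - G (X t \<omega>)) = - m / 4" if "0 \<le> t" for t
        using expectation_X[OF that, of G] integrable_X[OF that _ Gi] m by (simp add: prob_space)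
    qed (use m in auto)
    then show "AE \<omega> in M. \<forall>\<^sub>F n in sequentially. \<not> I (T n) \<omega> < 5 * m / 8 * T n"
    proof (rule AE_mp, intro AE_I2 impI)
      fix \<omega> assume \<omega>: "\<omega> \<in> space M"
        and "\<exists>C. \<forall>n::nat. (LBINT s:{0..real n}. 3 * m / 4 - G (X s \<omega>)) \<le> C"
      then obtain C where C: "\<And>n::nat. (LBINT s:{0..real n}. 3 * m / 4 - G (X s \<omega>)) \<le> C" by auto
      have low: "3 * m / 4 * real n - C \<le> I (real n) \<omega>" for n :: nat
      proof -
        have G: "set_integrable lborel {0..real n} (\<lambda>s. G (X s \<omega>))"
          by (intro borel_integrable_atLeastAtMost' continuous_on_subset[OF pc[OF \<omega>]]) auto
        have c: "set_integrable lborel {0..real n} (\<lambda>_. 3 * m / 4)"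
          by (intro borel_integrable_atLeastAtMost') auto
        have "(LBINT s:{0..real n}. 3 * m / 4) = 3 * m / 4 * real n"
          by (simp add: set_lebesgue_integral_def)
        then show ?thesis using C[of n] unfolding I_def set_integral_diff(2)[OF c G] by linarith
      qed
      have "\<forall>\<^sub>F n in sequentially. (3 * m / 4 + C) * 8 / m \<le> T n"
        using h(3) unfolding T_def filterlim_at_top by blast
      then show "\<forall>\<^sub>F n in sequentially. \<not> I (T n) \<omega> < 5 * m / 8 * T n"
      proof eventually_elim
        case (elim n)
        define N where "N = nat \<lfloor>T n\<rfloor>"
        have N: "real N \<le> T n" "T n - 1 \<le> real N" unfolding N_def using T0[of n] by linarith+
        have "I (T n) \<omega> = I (real N) \<omega> + (LBINT s:{real N..T n}. G (X s \<omega>))"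
          unfolding I_def using N by (intro LBINT_split pc \<omega>) auto
        moreover have "0 \<le> (LBINT s:{real N..T n}. G (X s \<omega>))"
          unfolding set_lebesgue_integral_def using G by (intro integral_nonneg_AE) auto
        ultimately have "I (real N) \<omega> \<le> I (T n) \<omega>" by simp
        moreover have "3 * m / 4 * (T n - 1) \<le> 3 * m / 4 * real N" using N m by (intro mult_left_mono) auto
        moreover have "3 * m / 4 + C \<le> T n * m / 8" using elim m by (simp add: field_simps)
        ultimately show ?case using low[of N] by (simp add: algebra_simps)
      qed
    qed
  qed measurable
  have mesh: "(\<integral>\<^sup>+\<omega>. ennreal \<bar>h n * (\<Sum>i<n. G (X (real i * h n) \<omega>)) - I (T n) \<omega>\<bar> \<partial>M)
      \<le> ennreal (T n * (\<Lambda> * ((1 + C1) * sqrt (h n))))" if hn: "h n \<le> 1" for n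
  proof -
    have h0: "0 < h n" by (rule h)
    define c where "c = \<Lambda> * ((1 + C1) * sqrt (h n))"
    have c0: "0 \<le> c" unfolding c_def using G(4) C1(1) h0 by simp
    have inc: "(\<integral>\<^sup>+\<omega>. ennreal \<bar>G (X u \<omega>) - G (X r \<omega>)\<bar> \<partial>M) \<le> ennreal c" if r: "0 \<le> u" "u \<le> r" "r \<le> u + h n" for u r
    proof -
      have C: "integrable M (\<lambda>\<omega>. (X r \<omega> - X u \<omega>)\<^sup>2)" "expectation (\<lambda>\<omega>. (X r \<omega> - X u \<omega>)\<^sup>2) \<le> C1 * h n"
        using C1(2,3)[of u r] r hn mult_left_mono[of "r - u" "h n" C1] C1(1) by auto
      have s: "0 < sqrt (h n)" using h0 by simp
      have dm: "(\<lambda>\<omega>. X r \<omega> - X u \<omega>) \<in> borel_measurable M" by measurable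
      note mom = first_moment_le[OF dm C(1) s]
      have "(\<integral>\<^sup>+\<omega>. ennreal \<bar>G (X u \<omega>) - G (X r \<omega>)\<bar> \<partial>M) \<le> (\<integral>\<^sup>+\<omega>. ennreal (\<Lambda> * \<bar>X r \<omega> - X u \<omega>\<bar>) \<partial>M)"
      proof (intro nn_integral_mono ennreal_leI)
        show "\<bar>G (X u \<omega>) - G (X r \<omega>)\<bar> \<le> \<Lambda> * \<bar>X r \<omega> - X u \<omega>\<bar>" for \<omega>
          using G(3)[of "X u \<omega>" "X r \<omega>"] by (simp add: abs_minus_commute)
      qed
      also have "\<dots> = ennreal (\<Lambda> * expectation (\<lambda>\<omega>. \<bar>X r \<omega> - X u \<omega>\<bar>))"
        using mom(1) G(4) by (subst nn_integral_eq_integral) auto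
      also have "\<dots> \<le> ennreal (\<Lambda> * (sqrt (h n) + expectation (\<lambda>\<omega>. (X r \<omega> - X u \<omega>)\<^sup>2) / sqrt (h n)))"
        by (intro ennreal_leI mult_left_mono mom(2) G(4))
      also have "\<dots> \<le> ennreal (\<Lambda> * (sqrt (h n) + C1 * h n / sqrt (h n)))"
        using C(2) G(4) h0 by (intro ennreal_leI mult_left_mono add_left_mono divide_right_mono) auto
      also have "\<Lambda> * (sqrt (h n) + C1 * h n / sqrt (h n)) = c"
      proof -
        have "h n / sqrt (h n) = sqrt (h n)" using h0 by (simp add: real_div_sqrt)
        then have "C1 * h n / sqrt (h n) = C1 * sqrt (h n)" by (simp only: times_divide_eq_right[symmetric])
        then show ?thesis unfolding c_def by (simp add: algebra_simps)
      qed
      finally show ?thesis .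
    qed
    have "(\<integral>\<^sup>+\<omega>. ennreal \<bar>h n * (\<Sum>i<n. G (X (real i * h n) \<omega>)) - I (T n) \<omega>\<bar> \<partial>M) \<le>
      (\<integral>\<^sup>+\<omega>. (\<Sum>i<n. \<integral>\<^sup>+r\<in>{real i * h n..real i * h n + h n}. ennreal \<bar>G (X (real i * h n) \<omega>) - G (X r \<omega>)\<bar> \<partial>lborel) \<partial>M)"
    proof (intro nn_integral_mono)
      fix \<omega> assume \<omega>: "\<omega> \<in> space M"
      let ?F = "\<lambda>i r. G (X (real i * h n) \<omega>) - G (X r \<omega>)"
      have "\<bar>h n * (\<Sum>i<n. G (X (real i * h n) \<omega>)) - I (T n) \<omega>\<bar> =
        \<bar>\<Sum>i<n. LBINT r:{real i * h n..real i * h n + h n}. ?F i r\<bar>"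
        unfolding I_def T_def using riemann_sum_error[OF pc[OF \<omega>], of "h n" n] h0 by simp
      also have "\<dots> \<le> (\<Sum>i<n. \<bar>LBINT r:{real i * h n..real i * h n + h n}. ?F i r\<bar>)" by (rule sum_abs)
      finally have "ennreal \<bar>h n * (\<Sum>i<n. G (X (real i * h n) \<omega>)) - I (T n) \<omega>\<bar> \<le>
        (\<Sum>i<n. ennreal \<bar>LBINT r:{real i * h n..real i * h n + h n}. ?F i r\<bar>)"
        by (simp add: ennreal_leI)
      also have "\<dots> \<le> (\<Sum>i<n. \<integral>\<^sup>+r\<in>{real i * h n..real i * h n + h n}. ennreal \<bar>?F i r\<bar> \<partial>lborel)"
      proof (rule sum_mono)
        fix i
        let ?S = "{real i * h n..real i * h n + h n}"
        have "set_integrable lborel ?S (?F i)"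
          by (intro borel_integrable_atLeastAtMost' continuous_on_diff continuous_on_const continuous_on_subset[OF pc[OF \<omega>]]) auto
        then have "ennreal \<bar>LBINT r:?S. ?F i r\<bar> \<le> (\<integral>\<^sup>+r. ennreal (norm (indicat_real ?S r *\<^sub>R ?F i r)) \<partial>lborel)"
          unfolding set_integrable_def set_lebesgue_integral_def real_norm_def[symmetric]
          by (rule integral_norm_bound_ennreal)
        also have "\<dots> = (\<integral>\<^sup>+r\<in>?S. ennreal \<bar>?F i r\<bar> \<partial>lborel)"
          by (intro nn_integral_cong) (simp add: indicator_def)
        finally show "ennreal \<bar>LBINT r:?S. ?F i r\<bar> \<le> (\<integral>\<^sup>+r\<in>?S. ennreal \<bar>?F i r\<bar> \<partial>lborel)" .
      qed
      finally show "ennreal \<bar>h n * (\<Sum>i<n. G (X (real i * h n) \<omega>)) - I (T n) \<omega>\<bar> \<le>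
        (\<Sum>i<n. \<integral>\<^sup>+r\<in>{real i * h n..real i * h n + h n}. ennreal \<bar>?F i r\<bar> \<partial>lborel)" .
    qed
    also have "\<dots> = (\<Sum>i<n. \<integral>\<^sup>+\<omega>. (\<integral>\<^sup>+r\<in>{real i * h n..real i * h n + h n}. ennreal \<bar>G (X (real i * h n) \<omega>) - G (X r \<omega>)\<bar> \<partial>lborel) \<partial>M)"
      by (intro nn_integral_sum) measurable
    also have "\<dots> \<le> (\<Sum>i<n. ennreal (h n * c))"
    proof (rule sum_mono)
      fix i
      have "(\<integral>\<^sup>+\<omega>. (\<integral>\<^sup>+r\<in>{real i * h n..real i * h n + h n}. ennreal \<bar>G (X (real i * h n) \<omega>) - G (X r \<omega>)\<bar> \<partial>lborel) \<partial>M)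
        \<le> ennreal ((real i * h n + h n - real i * h n) * c)"
      proof (rule nn_integral_time_le)
        show "(\<integral>\<^sup>+\<omega>. ennreal \<bar>G (X (real i * h n) \<omega>) - G (X r \<omega>)\<bar> \<partial>M) \<le> ennreal c"
          if "real i * h n \<le> r" "r \<le> real i * h n + h n" for r
          using that h0 by (intro inc) auto
      qed (use h0 in auto)
      then show "(\<integral>\<^sup>+\<omega>. (\<integral>\<^sup>+r\<in>{real i * h n..real i * h n + h n}. ennreal \<bar>G (X (real i * h n) \<omega>) - G (X r \<omega>)\<bar> \<partial>lborel) \<partial>M)
        \<le> ennreal (h n * c)" by simp
    qed
    also have "\<dots> = ennreal (T n * c)"
      using h0 c0 unfolding T_def by (simp add: ennreal_of_nat_eq_real_of_nat ennreal_mult[symmetric] mult.assoc)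
    finally show ?thesis unfolding c_def .
  qed
  let ?Z = "\<lambda>n \<omega>. h n * (\<Sum>i<n. G (X (real i * h n) \<omega>)) - I (T n) \<omega>"
  (* Mean 3/4 for the integrand, 5/8 for the time integral, and an eighth for the discretization leave 1/2. *)
  let ?k = "8 * \<Lambda> * (1 + C1) / m"
  have le: "\<forall>\<^sub>F n in sequentially. measure M {\<omega> \<in> space M. (\<Sum>i<n. G (X (real i * h n) \<omega>)) < m / 2 * real n}
      \<le> measure M {\<omega> \<in> space M. I (T n) \<omega> < 5 * m / 8 * T n} + ?k * sqrt (h n)"
    using order_tendstoD(2)[OF h(2), of 1, simplified] eventually_gt_at_top[of 0]
  proof eventually_elim
    case (elim n)
    have Tp: "0 < T n" unfolding T_def using h(1)[of n] elim by simp
    have "measure M {\<omega> \<in> space M. (\<Sum>i<n. G (X (real i * h n) \<omega>)) < m / 2 * real n} \<le>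
      measure M ({\<omega> \<in> space M. I (T n) \<omega> < 5 * m / 8 * T n} \<union> {\<omega> \<in> space M. m * T n / 8 \<le> \<bar>?Z n \<omega>\<bar>})"
    proof (intro finite_measure_mono)
      show "{\<omega> \<in> space M. (\<Sum>i<n. G (X (real i * h n) \<omega>)) < m / 2 * real n} \<subseteq>
        {\<omega> \<in> space M. I (T n) \<omega> < 5 * m / 8 * T n} \<union> {\<omega> \<in> space M. m * T n / 8 \<le> \<bar>?Z n \<omega>\<bar>}"
      proof safe
        fix \<omega> assume less: "(\<Sum>i<n. G (X (real i * h n) \<omega>)) < m / 2 * real n"
          and a: "\<not> m * T n / 8 \<le> \<bar>?Z n \<omega>\<bar>"
        have "h n * (\<Sum>i<n. G (X (real i * h n) \<omega>)) < h n * (m / 2 * real n)"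
          using less h(1) by (intro mult_strict_left_mono)
        also have "\<dots> = m * T n / 2" unfolding T_def by simp
        finally have "I (T n) \<omega> < m * T n / 2 + m * T n / 8" using a by linarith
        then show "I (T n) \<omega> < 5 * m / 8 * T n" by simp
      qed
    qed measurable
    also have "\<dots> \<le> measure M {\<omega> \<in> space M. I (T n) \<omega> < 5 * m / 8 * T n} + measure M {\<omega> \<in> space M. m * T n / 8 \<le> \<bar>?Z n \<omega>\<bar>}"
      by (intro measure_subadditive) auto
    also have "measure M {\<omega> \<in> space M. m * T n / 8 \<le> \<bar>?Z n \<omega>\<bar>} \<le> T n * (\<Lambda> * ((1 + C1) * sqrt (h n))) / (m * T n / 8)"
      using mesh[of n] elim Tp m G(4) C1(1) h(1)[of n] by (intro prob_abs_ge_le) auto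
    also have "\<dots> = ?k * sqrt (h n)" using Tp m by (simp add: field_simps)
    finally show ?case by simp
  qed
  have "(\<lambda>n. measure M {\<omega> \<in> space M. I (T n) \<omega> < 5 * m / 8 * T n} + ?k * sqrt (h n)) \<longlonglongrightarrow> 0 + ?k * sqrt 0"
    by (intro tendsto_add time tendsto_mult tendsto_const tendsto_real_sqrt h(2))
  then have lim: "(\<lambda>n. measure M {\<omega> \<in> space M. I (T n) \<omega> < 5 * m / 8 * T n} + ?k * sqrt (h n)) \<longlonglongrightarrow> 0"
    by simp
  show ?thesis
    by (rule tendsto_sandwich[OF _ le tendsto_const lim]) simp
qed

end

section \<open>Fluctuations of the quadratic contrast\<close>

text \<open>
  At a Brownian increment over a time step \<open>h\<close> this has mean \<open>0\<close> and variance \<open>2\<close>.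
\<close>

definition normalized_square :: "real \<Rightarrow> real \<Rightarrow> real" where
  "normalized_square h y = y\<^sup>2 / h - 1"

lemma normalized_square_measurable [measurable]: "normalized_square h \<in> borel_measurable borel"
  unfolding normalized_square_def by measurable

context brownian_filtration
begin

lemma normalized_square_moments:
  assumes "0 \<le> s" "0 < h"
  shows "integrable M (\<lambda>\<omega>. normalized_square h (W (s + h) \<omega> - W s \<omega>))"
    and "integrable M (\<lambda>\<omega>. (normalized_square h (W (s + h) \<omega> - W s \<omega>))\<^sup>2)"
    and "expectation (\<lambda>\<omega>. normalized_square h (W (s + h) \<omega> - W s \<omega>)) = 0"
    and "expectation (\<lambda>\<omega>. (normalized_square h (W (s + h) \<omega> - W s \<omega>))\<^sup>2) = 2"
proof -
  let ?V = "\<lambda>\<omega>. W (s + h) \<omega> - W s \<omega>"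
  have i2: "integrable M (\<lambda>\<omega>. (?V \<omega>)\<^sup>2)" and i4: "integrable M (\<lambda>\<omega>. (?V \<omega>) ^ 4)"
    using increment_moment(1)[of s "s + h"] assms by auto
  have e2: "expectation (\<lambda>\<omega>. (?V \<omega>)\<^sup>2) = h" and e4: "expectation (\<lambda>\<omega>. (?V \<omega>) ^ 4) = 3 * h\<^sup>2"
    using increment_moment(3,4)[of s "s + h"] assms by auto
  have sq: "(normalized_square h y)\<^sup>2 = y ^ 4 / h\<^sup>2 - 2 * (y\<^sup>2 / h) + 1" for y
    unfolding normalized_square_def by (simp add: power2_diff power_divide)
  show "integrable M (\<lambda>\<omega>. normalized_square h (?V \<omega>))"
    unfolding normalized_square_def using i2 by simp
  show "expectation (\<lambda>\<omega>. normalized_square h (?V \<omega>)) = 0"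
    unfolding normalized_square_def using i2 e2 assms by (simp add: prob_space)
  show "integrable M (\<lambda>\<omega>. (normalized_square h (?V \<omega>))\<^sup>2)"
    unfolding sq using i2 i4 by simp
  show "expectation (\<lambda>\<omega>. (normalized_square h (?V \<omega>))\<^sup>2) = 2"
    unfolding sq using i2 e2 i4 e4 assms by (simp add: prob_space)
qed

end

context stationary_diffusion
begin

text \<open>Martingale differences are orthogonal, so the second moments add up.\<close>

lemma martingale_sum_square:
  assumes h: "0 < h" and \<phi> [measurable]: "\<phi> \<in> borel_measurable borel" and \<phi>2: "integrable \<nu> (\<lambda>x. (\<phi> x)\<^sup>2)"
  defines "S \<equiv> \<lambda>n \<omega>. (\<Sum>i<n. \<phi> (X (real i * h) \<omega>) * normalized_square h (W (real i * h + h) \<omega> - W (real i * h) \<omega>))"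
  shows "S n \<in> borel_measurable (F (real n * h)) \<and> integrable M (\<lambda>\<omega>. (S n \<omega>)\<^sup>2) \<and>
    expectation (\<lambda>\<omega>. (S n \<omega>)\<^sup>2) = real n * (2 * (\<integral>x. (\<phi> x)\<^sup>2 \<partial>\<nu>))"
proof (induction n)
  case 0
  show ?case unfolding S_def by simp
next
  case (Suc n)
  let ?t = "real n * h"
  let ?\<xi> = "\<lambda>\<omega>. normalized_square h (W (?t + h) \<omega> - W ?t \<omega>)"
  let ?d = "\<lambda>\<omega>. \<phi> (X ?t \<omega>) * ?\<xi> \<omega>"
  have t: "0 \<le> ?t" using h by simp
  have tS: "real (Suc n) * h = ?t + h" by (simp add: algebra_simps)
  have SF: "S n \<in> borel_measurable (F ?t)" and S2: "integrable M (\<lambda>\<omega>. (S n \<omega>)\<^sup>2)"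
    and ES: "expectation (\<lambda>\<omega>. (S n \<omega>)\<^sup>2) = real n * (2 * (\<integral>x. (\<phi> x)\<^sup>2 \<partial>\<nu>))"
    using Suc by auto
  have SM: "S n \<in> borel_measurable M" using SF by (rule measurable_from_F)
  have \<phi>F: "(\<lambda>\<omega>. \<phi> (X ?t \<omega>)) \<in> borel_measurable (F ?t)"
    using measurable_compose[OF X_adapted[OF t] \<phi>] .
  have \<phi>i: "integrable M (\<lambda>\<omega>. (\<phi> (X ?t \<omega>))\<^sup>2)" using integrable_X[OF t _ \<phi>2] by simp
  note \<xi> = normalized_square_moments[OF t h]
  have d2: "integrable M (\<lambda>\<omega>. (?d \<omega>)\<^sup>2)" "expectation (\<lambda>\<omega>. (?d \<omega>)\<^sup>2) = 2 * (\<integral>x. (\<phi> x)\<^sup>2 \<partial>\<nu>)"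
    using expectation_X_times_increment[OF t _ _ \<phi>2, of "?t + h" "\<lambda>y. (normalized_square h y)\<^sup>2"] \<xi> h
    by (auto simp: power_mult_distrib)
  have Y: "(\<lambda>\<omega>. S n \<omega> * \<phi> (X ?t \<omega>)) \<in> borel_measurable (F ?t)"
    using SF \<phi>F by (rule borel_measurable_times)
  have Yi: "integrable M (\<lambda>\<omega>. S n \<omega> * \<phi> (X ?t \<omega>))"
    using SM S2 \<phi>i measurable_from_F[OF \<phi>F] by (intro integrable_mult_of_squares) auto
  have cross: "integrable M (\<lambda>\<omega>. (S n \<omega> * \<phi> (X ?t \<omega>)) * ?\<xi> \<omega>)"
    "expectation (\<lambda>\<omega>. (S n \<omega> * \<phi> (X ?t \<omega>)) * ?\<xi> \<omega>) = 0"
    using expectation_times_increment[OF t _ Y Yi normalized_square_measurable[of h], of "?t + h"] \<xi> h by auto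
  have SSuc: "S (Suc n) = (\<lambda>\<omega>. S n \<omega> + ?d \<omega>)" unfolding S_def by simp
  have sq: "(S (Suc n) \<omega>)\<^sup>2 = (S n \<omega>)\<^sup>2 + 2 * ((S n \<omega> * \<phi> (X ?t \<omega>)) * ?\<xi> \<omega>) + (?d \<omega>)\<^sup>2" for \<omega>
    unfolding SSuc by (simp add: power2_sum)
  have "S (Suc n) \<in> borel_measurable (F (?t + h))"
    unfolding SSuc
  proof (intro borel_measurable_add borel_measurable_times)
    show "S n \<in> borel_measurable (F (?t + h))" "(\<lambda>\<omega>. \<phi> (X ?t \<omega>)) \<in> borel_measurable (F (?t + h))"
      using h by (auto intro!: measurable_F_mono[OF _ SF] measurable_F_mono[OF _ \<phi>F])
    have "(\<lambda>\<omega>. W (?t + h) \<omega> - W ?t \<omega>) \<in> borel_measurable (F (?t + h))"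
      using h t by (intro borel_measurable_diff W_measurable_F) auto
    then show "?\<xi> \<in> borel_measurable (F (?t + h))"
      by (rule measurable_compose) measurable
  qed
  moreover have "integrable M (\<lambda>\<omega>. (S (Suc n) \<omega>)\<^sup>2)"
    unfolding sq by (intro Bochner_Integration.integrable_add integrable_mult_right S2 cross d2)
  moreover have "expectation (\<lambda>\<omega>. (S (Suc n) \<omega>)\<^sup>2) = real (Suc n) * (2 * (\<integral>x. (\<phi> x)\<^sup>2 \<partial>\<nu>))"
  proof -
    have "expectation (\<lambda>\<omega>. (S (Suc n) \<omega>)\<^sup>2) = expectation (\<lambda>\<omega>. (S n \<omega>)\<^sup>2)
      + 2 * expectation (\<lambda>\<omega>. (S n \<omega> * \<phi> (X ?t \<omega>)) * ?\<xi> \<omega>) + expectation (\<lambda>\<omega>. (?d \<omega>)\<^sup>2)"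
      unfolding sq using S2 cross(1) d2(1) by simp
    then show ?thesis unfolding cross(2) d2(2) ES by (simp add: algebra_simps)
  qed
  ultimately show ?case unfolding tS by blast
qed

lemma finite_net:
  fixes \<Theta> :: "real set"
  assumes "compact \<Theta>" "0 < \<delta>"
  obtains D where "finite D" "D \<subseteq> \<Theta>" "\<And>\<theta>. \<theta> \<in> \<Theta> \<Longrightarrow> \<exists>d\<in>D. \<bar>\<theta> - d\<bar> \<le> \<delta>"
proof -
  have "\<Theta> \<subseteq> (\<Union>d\<in>\<Theta>. ball d \<delta>)" using assms(2) by auto
  from compactE_image[OF assms(1) _ this] obtain D where D: "D \<subseteq> \<Theta>" "finite D" "\<Theta> \<subseteq> (\<Union>d\<in>D. ball d \<delta>)"
    by auto
  show thesis
  proof (rule that[OF D(2,1)])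
    fix \<theta> assume "\<theta> \<in> \<Theta>"
    then obtain d where "d \<in> D" "\<theta> \<in> ball d \<delta>" using D(3) by auto
    then show "\<exists>d\<in>D. \<bar>\<theta> - d\<bar> \<le> \<delta>"
      by (intro bexI[of _ d]) (auto simp: dist_real_def abs_minus_commute)
  qed
qed

text \<open>
  The centred quadratic part of the contrast, divided by \<open>n\<close>, is dominated uniformly in the
  parameter by variables of small mean. Replacing \<open>(\<Delta>X)\<^sup>2 / h\<close> by \<open>\<sigma>\<^sup>2 (\<Delta>W)\<^sup>2 / h\<close> costs
  \<open>O(sqrt h)\<close>, collected in \<open>E1\<close>. The condition on the right end point, which is not known at the
  left end point, fails only if the increment is at least the gap \<open>\<tau>s n - \<tau>\<close>; dropping it costs \<open>E2\<close>,
  by Chebyshev's inequality. What remains is a martingale sum \<open>Z\<close>, controlled on a finite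
  \<open>\<delta>\<close>-net \<open>D\<close> of parameters, and \<open>\<delta> E3\<close> bounds its variation between the points of the net.
\<close>

lemma uniform_error:
  fixes h \<tau>s :: "nat \<Rightarrow> real" and Q :: "real \<Rightarrow> real \<Rightarrow> real"
  assumes h: "\<And>n. 0 < h n" "h \<longlonglongrightarrow> 0"
    and \<tau>s: "\<And>n. \<tau> < \<tau>s n" "(\<lambda>n. h n / (\<tau>s n - \<tau>)\<^sup>2) \<longlonglongrightarrow> 0"
    and \<Theta>: "compact \<Theta>"
    and Q [measurable]: "\<And>\<theta>. \<theta> \<in> \<Theta> \<Longrightarrow> (\<lambda>x. Q x \<theta>) \<in> borel_measurable borel"
    and Qb: "\<And>x \<theta>. \<theta> \<in> \<Theta> \<Longrightarrow> \<bar>Q x \<theta>\<bar> \<le> B" and B0: "0 \<le> B"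
    and Ql: "\<And>x \<theta> \<theta>'. \<theta> \<in> \<Theta> \<Longrightarrow> \<theta>' \<in> \<Theta> \<Longrightarrow> (\<sigma> x)\<^sup>2 * \<bar>Q x \<theta> - Q x \<theta>'\<bar> \<le> \<Lambda> x * \<bar>\<theta> - \<theta>'\<bar>"
    and \<Lambda> [measurable]: "\<Lambda> \<in> borel_measurable borel" "integrable \<nu> (\<lambda>x. (\<Lambda> x)\<^sup>2)" "\<And>x. 0 \<le> \<Lambda> x"
    and e: "0 < e"
  defines "kept \<equiv> \<lambda>n i \<omega>. (of_bool (X (real i * h n) \<omega> > \<tau>s n \<and> X (real i * h n + h n) \<omega> > \<tau>) :: real)"
  defines "R \<equiv> \<lambda>n \<theta> \<omega>. (\<Sum>i<n. kept n i \<omega> *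
      (((X (real i * h n + h n) \<omega> - X (real i * h n) \<omega>)\<^sup>2 / h n - (\<sigma> (X (real i * h n) \<omega>))\<^sup>2) * Q (X (real i * h n) \<omega>) \<theta>))"
  shows "\<exists>V. (\<forall>n. V n \<in> borel_measurable M) \<and>
    (\<forall>n. \<forall>\<omega>\<in>space M. 0 \<le> V n \<omega>) \<and>
    (\<forall>n. \<forall>\<omega>\<in>space M. \<forall>\<theta>\<in>\<Theta>. \<bar>R n \<theta> \<omega>\<bar> \<le> real n * V n \<omega>) \<and>
    (\<forall>\<^sub>F n in sequentially. integrable M (V n) \<and> expectation (V n) \<le> e)"
proof -
  obtain C1 where C1: "0 \<le> C1"
    "\<And>s t. 0 \<le> s \<Longrightarrow> s \<le> t \<Longrightarrow> t \<le> s + 1 \<Longrightarrow> integrable M (\<lambda>\<omega>. (X t \<omega> - X s \<omega>)\<^sup>2)"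
    "\<And>s t. 0 \<le> s \<Longrightarrow> s \<le> t \<Longrightarrow> t \<le> s + 1 \<Longrightarrow> expectation (\<lambda>\<omega>. (X t \<omega> - X s \<omega>)\<^sup>2) \<le> C1 * (t - s)"
    by (rule increment_square) (rule that)
  obtain C3 where C3: "0 \<le> C3"
    "\<And>s t. 0 \<le> s \<Longrightarrow> s < t \<Longrightarrow> t \<le> s + 1 \<Longrightarrow>
       integrable M (\<lambda>\<omega>. (X t \<omega> - X s \<omega>)\<^sup>2 - (\<sigma> (X s \<omega>))\<^sup>2 * (W t \<omega> - W s \<omega>)\<^sup>2)"
    "\<And>s t. 0 \<le> s \<Longrightarrow> s < t \<Longrightarrow> t \<le> s + 1 \<Longrightarrow>
       expectation (\<lambda>\<omega>. \<bar>(X t \<omega> - X s \<omega>)\<^sup>2 - (\<sigma> (X s \<omega>))\<^sup>2 * (W t \<omega> - W s \<omega>)\<^sup>2\<bar>) \<le> C3 * ((t - s) * sqrt (t - s))"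
    by (rule squared_increment) (rule that)
  define m4 where "m4 = (\<integral>x. (\<sigma> x) ^ 4 \<partial>\<nu>)"
  define m\<Lambda> where "m\<Lambda> = (\<integral>x. (\<Lambda> x)\<^sup>2 \<partial>\<nu>)"
  have m0: "0 \<le> m4" "0 \<le> m\<Lambda>" unfolding m4_def m\<Lambda>_def by auto
  define \<delta> where "\<delta> = e / (2 * (m\<Lambda> + 2))"
  have \<delta>: "0 < \<delta>" "\<delta> * (m\<Lambda> + 2) = e / 2" unfolding \<delta>_def using e m0 by (auto simp: field_simps)
  obtain D where D: "finite D" "D \<subseteq> \<Theta>" "\<And>\<theta>. \<theta> \<in> \<Theta> \<Longrightarrow> \<exists>d\<in>D. \<bar>\<theta> - d\<bar> \<le> \<delta>"
    using finite_net[OF \<Theta> \<delta>(1)] by metis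
  define p where "p n = (C1 + 1) * (h n / (\<tau>s n - \<tau>)\<^sup>2)" for n
  have p0: "0 < p n" for n
    unfolding p_def using C1(1) h(1)[of n] \<tau>s(1)[of n] by (intro mult_pos_pos divide_pos_pos) auto
  define dX where "dX n i \<omega> = X (real i * h n + h n) \<omega> - X (real i * h n) \<omega>" for n i \<omega>
  define dW where "dW n i \<omega> = W (real i * h n + h n) \<omega> - W (real i * h n) \<omega>" for n i \<omega>
  define S where "S n i \<omega> = (\<sigma> (X (real i * h n) \<omega>))\<^sup>2" for n i \<omega>
  define \<xi> where "\<xi> n i \<omega> = normalized_square (h n) (dW n i \<omega>)" for n i \<omega>
  define E1 where "E1 n i \<omega> = \<bar>(dX n i \<omega>)\<^sup>2 - S n i \<omega> * (dW n i \<omega>)\<^sup>2\<bar> / h n" for n i \<omega>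
  define E2 where "E2 n i \<omega> = sqrt (p n) * (S n i \<omega> * \<xi> n i \<omega>)\<^sup>2 + (dX n i \<omega>)\<^sup>2 / (\<tau>s n - \<tau>)\<^sup>2 / sqrt (p n)" for n i \<omega>
  define E3 where "E3 n i \<omega> = (\<Lambda> (X (real i * h n) \<omega>))\<^sup>2 + (\<xi> n i \<omega>)\<^sup>2" for n i \<omega>
  define \<phi> where "\<phi> n \<theta> x = of_bool (x > \<tau>s n) * ((\<sigma> x)\<^sup>2 * Q x \<theta>)" for n \<theta> x
  define Z where "Z n \<theta> \<omega> = (\<Sum>i<n. \<phi> n \<theta> (X (real i * h n) \<omega>) * \<xi> n i \<omega>)" for n \<theta> \<omega>
  define V where "V n \<omega> = (\<Sum>i<n. B * E1 n i \<omega> + B * E2 n i \<omega> + \<delta> * E3 n i \<omega>) / real n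
    + (\<Sum>d\<in>D. \<bar>Z n d \<omega>\<bar> / real n)" for n \<omega>
  have t0: "0 \<le> real i * h n" for i n using h(1)[of n] by simp
  have dWm [measurable]: "dW n i \<in> borel_measurable M" for n i
    unfolding dW_def using t0[of i n] h(1)[of n] by (intro borel_measurable_diff W_measurable) auto
  have dXm [measurable]: "dX n i \<in> borel_measurable M" for n i unfolding dX_def by measurable
  have Sm [measurable]: "S n i \<in> borel_measurable M" for n i unfolding S_def by measurable
  have \<xi>m [measurable]: "\<xi> n i \<in> borel_measurable M" for n i unfolding \<xi>_def by measurable
  have E1m [measurable]: "E1 n i \<in> borel_measurable M" for n i unfolding E1_def by measurable
  have E2m [measurable]: "E2 n i \<in> borel_measurable M" for n i unfolding E2_def by measurable
  have E3m [measurable]: "E3 n i \<in> borel_measurable M" for n i unfolding E3_def by measurable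
  have \<phi>m: "\<phi> n \<theta> \<in> borel_measurable borel" if "\<theta> \<in> \<Theta>" for n \<theta>
    unfolding \<phi>_def using Q[OF that] by measurable
  have Zm: "Z n \<theta> \<in> borel_measurable M" if "\<theta> \<in> \<Theta>" for n \<theta>
  proof -
    note [measurable] = \<phi>m[OF that]
    show ?thesis unfolding Z_def by measurable
  qed
  have Vm: "V n \<in> borel_measurable M" for n
  proof -
    have [measurable]: "Z n d \<in> borel_measurable M" if "d \<in> D" for d using Zm D(2) that by auto
    show ?thesis unfolding V_def by measurable
  qed
  have Enn: "0 \<le> E1 n i \<omega>" "0 \<le> E2 n i \<omega>" "0 \<le> E3 n i \<omega>" for n i \<omega>
    unfolding E1_def E2_def E3_def using h(1)[of n] p0[of n] by auto
  have V0: "0 \<le> V n \<omega>" for n \<omega>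
    unfolding V_def using Enn B0 \<delta>(1)
    by (intro add_nonneg_nonneg divide_nonneg_nonneg sum_nonneg mult_nonneg_nonneg) auto
  have dom: "\<bar>R n \<theta> \<omega>\<bar> \<le> real n * V n \<omega>" if \<theta>: "\<theta> \<in> \<Theta>" for n \<theta> \<omega>
  proof (cases "n = 0")
    case True
    then show ?thesis unfolding R_def by simp
  next
    case n: False
    obtain d where d: "d \<in> D" "\<bar>\<theta> - d\<bar> \<le> \<delta>" using D(3)[OF \<theta>] by auto
    have d\<Theta>: "d \<in> \<Theta>" using d D(2) by auto
    have summand: "\<bar>kept n i \<omega> * (((dX n i \<omega>)\<^sup>2 / h n - S n i \<omega>) * Q (X (real i * h n) \<omega>) \<theta>)
        - \<phi> n d (X (real i * h n) \<omega>) * \<xi> n i \<omega>\<bar> \<le> B * E1 n i \<omega> + B * E2 n i \<omega> + \<delta> * E3 n i \<omega>" for i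
    proof -
      let ?x = "X (real i * h n) \<omega>" and ?y = "X (real i * h n + h n) \<omega>"
      let ?a = "of_bool (?x > \<tau>s n) :: real" and ?A = "of_bool (?x > \<tau>s n \<and> \<not> ?y > \<tau>) :: real"
      have kept: "kept n i \<omega> = ?a - ?A" unfolding kept_def by auto
      have kept1: "\<bar>kept n i \<omega>\<bar> \<le> 1" unfolding kept_def by simp
      have hn: "0 < h n" by (rule h)
      have eq: "(dX n i \<omega>)\<^sup>2 / h n - S n i \<omega> = ((dX n i \<omega>)\<^sup>2 - S n i \<omega> * (dW n i \<omega>)\<^sup>2) / h n + S n i \<omega> * \<xi> n i \<omega>"
        unfolding \<xi>_def normalized_square_def using hn by (simp add: field_simps)
      have split: "kept n i \<omega> * (((dX n i \<omega>)\<^sup>2 / h n - S n i \<omega>) * Q ?x \<theta>) - \<phi> n d ?x * \<xi> n i \<omega> =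
        kept n i \<omega> * Q ?x \<theta> * (((dX n i \<omega>)\<^sup>2 - S n i \<omega> * (dW n i \<omega>)\<^sup>2) / h n)
        + (- (Q ?x \<theta>)) * (?A * (S n i \<omega> * \<xi> n i \<omega>))
        + ?a * (S n i \<omega> * (Q ?x \<theta> - Q ?x d)) * \<xi> n i \<omega>"
      proof -
        have "(a - A) * ((t + v * y) * q) - a * (v * q') * y = (a - A) * q * t + - q * (A * (v * y)) + a * (v * (q - q')) * y"
          for a A t v y q q' :: real
          by (simp add: algebra_simps)
        then show ?thesis unfolding eq \<phi>_def kept unfolding S_def .
      qed
      have 1: "\<bar>kept n i \<omega> * Q ?x \<theta> * (((dX n i \<omega>)\<^sup>2 - S n i \<omega> * (dW n i \<omega>)\<^sup>2) / h n)\<bar> \<le> B * E1 n i \<omega>"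
      proof -
        have "\<bar>kept n i \<omega>\<bar> * \<bar>Q ?x \<theta>\<bar> \<le> 1 * B" using kept1 Qb[OF \<theta>] by (intro mult_mono) auto
        then have "\<bar>kept n i \<omega>\<bar> * \<bar>Q ?x \<theta>\<bar> * E1 n i \<omega> \<le> B * E1 n i \<omega>" using Enn(1) by (intro mult_right_mono) auto
        then show ?thesis unfolding E1_def using hn by (simp add: abs_mult)
      qed
      have 2: "\<bar>(- (Q ?x \<theta>)) * (?A * (S n i \<omega> * \<xi> n i \<omega>))\<bar> \<le> B * E2 n i \<omega>"
      proof -
        have "\<bar>?A * (S n i \<omega> * \<xi> n i \<omega>)\<bar> \<le> E2 n i \<omega>"
        proof (cases "?x > \<tau>s n \<and> \<not> ?y > \<tau>")
          case True
          then have "\<tau>s n - \<tau> \<le> \<bar>dX n i \<omega>\<bar>" unfolding dX_def by auto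
          then have "(\<tau>s n - \<tau>)\<^sup>2 \<le> \<bar>dX n i \<omega>\<bar>\<^sup>2" using \<tau>s(1)[of n] by (intro power_mono) auto
          then have "1 \<le> (dX n i \<omega>)\<^sup>2 / (\<tau>s n - \<tau>)\<^sup>2" using \<tau>s(1)[of n] by simp
          then have "1 / sqrt (p n) \<le> (dX n i \<omega>)\<^sup>2 / (\<tau>s n - \<tau>)\<^sup>2 / sqrt (p n)"
            using p0[of n] by (intro divide_right_mono) auto
          moreover have "\<bar>(S n i \<omega> * \<xi> n i \<omega>) * 1\<bar> \<le> sqrt (p n) * (S n i \<omega> * \<xi> n i \<omega>)\<^sup>2 + 1\<^sup>2 / sqrt (p n)"
            using p0[of n] by (intro abs_mult_le_weighted) simp
          ultimately show ?thesis using True unfolding E2_def by simp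
        next
          case False
          then show ?thesis using Enn(2)[of n i \<omega>] by auto
        qed
        then show ?thesis unfolding abs_mult[of "- (Q ?x \<theta>)"] abs_minus_cancel
          using Qb[OF \<theta>] B0 by (intro mult_mono) auto
      qed
      have 3: "\<bar>?a * (S n i \<omega> * (Q ?x \<theta> - Q ?x d)) * \<xi> n i \<omega>\<bar> \<le> \<delta> * E3 n i \<omega>"
      proof -
        have "\<bar>?a * (S n i \<omega> * (Q ?x \<theta> - Q ?x d)) * \<xi> n i \<omega>\<bar> \<le> (S n i \<omega> * \<bar>Q ?x \<theta> - Q ?x d\<bar>) * \<bar>\<xi> n i \<omega>\<bar>"
          unfolding S_def by (simp add: abs_mult)
        also have "\<dots> \<le> (\<Lambda> ?x * \<bar>\<theta> - d\<bar>) * \<bar>\<xi> n i \<omega>\<bar>"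
          unfolding S_def by (intro mult_right_mono Ql \<theta> d\<Theta>) auto
        also have "\<dots> \<le> (\<Lambda> ?x * \<delta>) * \<bar>\<xi> n i \<omega>\<bar>"
          using d(2) \<Lambda>(3) by (intro mult_right_mono mult_left_mono) auto
        also have "\<dots> = \<delta> * \<bar>\<Lambda> ?x * \<xi> n i \<omega>\<bar>" using \<Lambda>(3)[of ?x] by (simp add: abs_mult)
        also have "\<dots> \<le> \<delta> * E3 n i \<omega>"
          unfolding E3_def using \<delta>(1) by (intro mult_left_mono abs_mult_le_sum_squares) auto
        finally show ?thesis .
      qed
      show ?thesis unfolding split using 1 2 3 by linarith
    qed
    have "\<bar>R n \<theta> \<omega> - Z n d \<omega>\<bar> \<le> (\<Sum>i<n. B * E1 n i \<omega> + B * E2 n i \<omega> + \<delta> * E3 n i \<omega>)"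
    proof -
      have "R n \<theta> \<omega> - Z n d \<omega> = (\<Sum>i<n. kept n i \<omega> * (((dX n i \<omega>)\<^sup>2 / h n - S n i \<omega>) * Q (X (real i * h n) \<omega>) \<theta>)
        - \<phi> n d (X (real i * h n) \<omega>) * \<xi> n i \<omega>)"
        unfolding R_def Z_def dX_def S_def by (simp add: sum_subtractf)
      then show ?thesis using summand by (simp add: order_trans[OF sum_abs sum_mono])
    qed
    moreover have "\<bar>Z n d \<omega>\<bar> \<le> (\<Sum>d\<in>D. \<bar>Z n d \<omega>\<bar>)"
      using d(1) D(1) member_le_sum[of d D "\<lambda>d. \<bar>Z n d \<omega>\<bar>"] by simp
    moreover have "real n * V n \<omega> = (\<Sum>i<n. B * E1 n i \<omega> + B * E2 n i \<omega> + \<delta> * E3 n i \<omega>) + (\<Sum>d\<in>D. \<bar>Z n d \<omega>\<bar>)"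
      unfolding V_def using n by (simp add: distrib_left sum_divide_distrib[symmetric])
    ultimately show ?thesis by linarith
  qed
  let ?bound = "\<lambda>n. (B * (C3 * sqrt (h n)) + B * ((2 * m4 + 1) * sqrt (p n)) + \<delta> * (m\<Lambda> + 2))
      + real (card D) * ((1 + 2 * B\<^sup>2 * m4) / sqrt (real n))"
  have mean: "integrable M (V n) \<and> expectation (V n) \<le> ?bound n" if n: "0 < n" and hn1: "h n \<le> 1" for n
  proof -
    have hn: "0 < h n" by (rule h)
    have \<xi>mom: "integrable M (\<lambda>\<omega>. (\<xi> n i \<omega>)\<^sup>2)" "expectation (\<lambda>\<omega>. (\<xi> n i \<omega>)\<^sup>2) = 2" for i
      unfolding \<xi>_def dW_def using normalized_square_moments[OF t0 hn] by auto
    have e1: "integrable M (E1 n i)" "expectation (E1 n i) \<le> C3 * sqrt (h n)" for i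
    proof -
      have "integrable M (\<lambda>\<omega>. (dX n i \<omega>)\<^sup>2 - S n i \<omega> * (dW n i \<omega>)\<^sup>2)"
        unfolding dX_def S_def dW_def using hn hn1 t0 by (intro C3(2)) auto
      then show "integrable M (E1 n i)" unfolding E1_def by auto
      have "expectation (\<lambda>\<omega>. \<bar>(dX n i \<omega>)\<^sup>2 - S n i \<omega> * (dW n i \<omega>)\<^sup>2\<bar>) \<le> C3 * (h n * sqrt (h n))"
        unfolding dX_def S_def dW_def using hn hn1 t0 C3(3)[of "real i * h n" "real i * h n + h n"] by simp
      then have "expectation (\<lambda>\<omega>. \<bar>(dX n i \<omega>)\<^sup>2 - S n i \<omega> * (dW n i \<omega>)\<^sup>2\<bar>) / h n \<le> C3 * (h n * sqrt (h n)) / h n"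
        using hn by (intro divide_right_mono) auto
      moreover have "expectation (E1 n i) = expectation (\<lambda>\<omega>. \<bar>(dX n i \<omega>)\<^sup>2 - S n i \<omega> * (dW n i \<omega>)\<^sup>2\<bar>) / h n"
        unfolding E1_def by simp
      ultimately show "expectation (E1 n i) \<le> C3 * sqrt (h n)" using hn by simp
    qed
    have e2: "integrable M (E2 n i)" "expectation (E2 n i) \<le> (2 * m4 + 1) * sqrt (p n)" for i
    proof -
      have s: "integrable M (\<lambda>\<omega>. (S n i \<omega> * \<xi> n i \<omega>)\<^sup>2)" "expectation (\<lambda>\<omega>. (S n i \<omega> * \<xi> n i \<omega>)\<^sup>2) = m4 * 2"
        using expectation_X_times_increment[OF t0, of i n "real i * h n + h n" "\<lambda>x. (\<sigma> x) ^ 4" "\<lambda>y. (normalized_square (h n) y)\<^sup>2"]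
          integrable_\<nu>_powers(2)[of 4] normalized_square_moments[OF t0 hn, of i n] hn
        unfolding S_def \<xi>_def dW_def m4_def by (auto simp: power_mult_distrib)
      have x: "integrable M (\<lambda>\<omega>. (dX n i \<omega>)\<^sup>2)" "expectation (\<lambda>\<omega>. (dX n i \<omega>)\<^sup>2) \<le> C1 * h n"
        unfolding dX_def using C1(2,3)[OF t0, of i n "real i * h n + h n"] hn hn1 by auto
      show "integrable M (E2 n i)" unfolding E2_def using s x by simp
      have "expectation (E2 n i) = sqrt (p n) * (m4 * 2) + expectation (\<lambda>\<omega>. (dX n i \<omega>)\<^sup>2) / (\<tau>s n - \<tau>)\<^sup>2 / sqrt (p n)"
        unfolding E2_def using s x by simp
      also have "\<dots> \<le> sqrt (p n) * (m4 * 2) + p n / sqrt (p n)"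
      proof -
        have "expectation (\<lambda>\<omega>. (dX n i \<omega>)\<^sup>2) \<le> (C1 + 1) * h n" using x(2) hn by (simp add: algebra_simps)
        then have "expectation (\<lambda>\<omega>. (dX n i \<omega>)\<^sup>2) / (\<tau>s n - \<tau>)\<^sup>2 \<le> (C1 + 1) * h n / (\<tau>s n - \<tau>)\<^sup>2"
          by (rule divide_right_mono) simp
        then have "expectation (\<lambda>\<omega>. (dX n i \<omega>)\<^sup>2) / (\<tau>s n - \<tau>)\<^sup>2 \<le> p n" unfolding p_def by simp
        then show ?thesis using p0[of n] by (intro add_left_mono divide_right_mono) auto
      qed
      also have "p n / sqrt (p n) = sqrt (p n)" using p0[of n] by (simp add: real_div_sqrt)
      finally show "expectation (E2 n i) \<le> (2 * m4 + 1) * sqrt (p n)" by (simp add: algebra_simps)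
    qed
    have e3: "integrable M (E3 n i)" "expectation (E3 n i) \<le> m\<Lambda> + 2" for i
      using integrable_X[OF t0 _ \<Lambda>(2), of i n] expectation_X[OF t0, of "\<lambda>x. (\<Lambda> x)\<^sup>2" i n] \<xi>mom[of i]
      unfolding E3_def m\<Lambda>_def by auto
    have z: "integrable M (\<lambda>\<omega>. \<bar>Z n d \<omega>\<bar>)" "expectation (\<lambda>\<omega>. \<bar>Z n d \<omega>\<bar> / real n) \<le> (1 + 2 * B\<^sup>2 * m4) / sqrt (real n)"
      if d: "d \<in> \<Theta>" for d
    proof -
      have sq: "(\<phi> n d x)\<^sup>2 \<le> B\<^sup>2 * (\<sigma> x) ^ 4" for x
      proof -
        have "\<bar>Q x d\<bar>\<^sup>2 \<le> B\<^sup>2" using Qb[OF d] by (intro power_mono) auto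
        then have "(\<sigma> x) ^ 4 * (Q x d)\<^sup>2 \<le> (\<sigma> x) ^ 4 * B\<^sup>2" by (intro mult_left_mono) auto
        then show ?thesis unfolding \<phi>_def by (auto simp: power_mult_distrib mult.commute)
      qed
      have \<phi>2: "integrable \<nu> (\<lambda>x. (\<phi> n d x)\<^sup>2)"
        by (rule Bochner_Integration.integrable_bound[OF integrable_mult_right[OF integrable_\<nu>_powers(2)[of 4], of "B\<^sup>2"]])
           (use \<phi>m[OF d] sq in \<open>auto intro!: AE_I2\<close>)
      have "(\<integral>x. (\<phi> n d x)\<^sup>2 \<partial>\<nu>) \<le> (\<integral>x. B\<^sup>2 * (\<sigma> x) ^ 4 \<partial>\<nu>)"
        using \<phi>2 integrable_\<nu>_powers(2)[of 4] sq by (intro integral_mono) auto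
      then have v: "(\<integral>x. (\<phi> n d x)\<^sup>2 \<partial>\<nu>) \<le> B\<^sup>2 * m4" unfolding m4_def by simp
      have Zsq: "integrable M (\<lambda>\<omega>. (Z n d \<omega>)\<^sup>2)" "expectation (\<lambda>\<omega>. (Z n d \<omega>)\<^sup>2) = real n * (2 * (\<integral>x. (\<phi> n d x)\<^sup>2 \<partial>\<nu>))"
        using martingale_sum_square[OF hn \<phi>m[OF d] \<phi>2, of n] unfolding Z_def \<xi>_def dW_def by auto
      let ?c = "sqrt (real n)"
      have c: "0 < ?c" using n by simp
      show "integrable M (\<lambda>\<omega>. \<bar>Z n d \<omega>\<bar>)"
        using first_moment_le(1)[OF Zm[OF d] Zsq(1) c] by simp
      have "expectation (\<lambda>\<omega>. \<bar>Z n d \<omega>\<bar>) \<le> ?c + real n * (2 * (\<integral>x. (\<phi> n d x)\<^sup>2 \<partial>\<nu>)) / ?c"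
        using first_moment_le(2)[OF Zm[OF d] Zsq(1) c] unfolding Zsq(2) .
      also have "\<dots> \<le> ?c + real n * (2 * (B\<^sup>2 * m4)) / ?c"
        using v c by (intro add_left_mono divide_right_mono mult_left_mono) auto
      finally have "expectation (\<lambda>\<omega>. \<bar>Z n d \<omega>\<bar>) / real n \<le> (?c + real n * (2 * (B\<^sup>2 * m4)) / ?c) / real n"
        by (rule divide_right_mono) simp
      also have "\<dots> = (1 + 2 * B\<^sup>2 * m4) / ?c"
      proof -
        have "?c / real n = 1 / ?c" using n by (simp add: field_simps)
        then show ?thesis using n by (simp add: add_divide_distrib)
      qed
      finally show "expectation (\<lambda>\<omega>. \<bar>Z n d \<omega>\<bar> / real n) \<le> (1 + 2 * B\<^sup>2 * m4) / sqrt (real n)" by simp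
    qed
    have Vi: "integrable M (V n)"
      unfolding V_def using e1(1) e2(1) e3(1) z(1) D(2)
      by (intro Bochner_Integration.integrable_add Bochner_Integration.integrable_sum integrable_divide integrable_mult_right) auto
    have "expectation (V n) = (\<Sum>i<n. B * expectation (E1 n i) + B * expectation (E2 n i) + \<delta> * expectation (E3 n i)) / real n
      + (\<Sum>d\<in>D. expectation (\<lambda>\<omega>. \<bar>Z n d \<omega>\<bar> / real n))"
    proof -
      have "expectation (V n) = expectation (\<lambda>\<omega>. (\<Sum>i<n. B * E1 n i \<omega> + B * E2 n i \<omega> + \<delta> * E3 n i \<omega>) / real n)
        + expectation (\<lambda>\<omega>. \<Sum>d\<in>D. \<bar>Z n d \<omega>\<bar> / real n)"
        unfolding V_def using e1(1) e2(1) e3(1) z(1) D(2)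
        by (intro Bochner_Integration.integral_add Bochner_Integration.integrable_add Bochner_Integration.integrable_sum integrable_divide integrable_mult_right) auto
      moreover have "expectation (\<lambda>\<omega>. \<Sum>d\<in>D. \<bar>Z n d \<omega>\<bar> / real n) = (\<Sum>d\<in>D. expectation (\<lambda>\<omega>. \<bar>Z n d \<omega>\<bar> / real n))"
        using z(1) D(2) by (intro Bochner_Integration.integral_sum) auto
      moreover have "expectation (\<lambda>\<omega>. (\<Sum>i<n. B * E1 n i \<omega> + B * E2 n i \<omega> + \<delta> * E3 n i \<omega>) / real n) =
        (\<Sum>i<n. B * expectation (E1 n i) + B * expectation (E2 n i) + \<delta> * expectation (E3 n i)) / real n"
        using e1(1) e2(1) e3(1) by (simp add: Bochner_Integration.integral_sum Bochner_Integration.integrable_sum Bochner_Integration.integral_add)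
      ultimately show ?thesis by simp
    qed
    also have "\<dots> \<le> (\<Sum>i<n. B * (C3 * sqrt (h n)) + B * ((2 * m4 + 1) * sqrt (p n)) + \<delta> * (m\<Lambda> + 2)) / real n
      + (\<Sum>d\<in>D. (1 + 2 * B\<^sup>2 * m4) / sqrt (real n))"
      using e1(2) e2(2) e3(2) z(2) D(2) B0 \<delta>(1)
      by (intro add_mono divide_right_mono sum_mono mult_left_mono) auto
    also have "\<dots> = ?bound n" using n by simp
    finally show ?thesis using Vi by blast
  qed
  have plim: "p \<longlonglongrightarrow> 0" unfolding p_def using tendsto_mult[OF tendsto_const \<tau>s(2), of "C1 + 1"] by simp
  have "?bound \<longlonglongrightarrow> (B * (C3 * sqrt 0) + B * ((2 * m4 + 1) * sqrt 0) + \<delta> * (m\<Lambda> + 2)) + real (card D) * 0"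
  proof (intro tendsto_add tendsto_mult tendsto_const tendsto_real_sqrt h(2) plim)
    show "(\<lambda>n. (1 + 2 * B\<^sup>2 * m4) / sqrt (real n)) \<longlonglongrightarrow> 0"
      by (rule tendsto_divide_0[OF tendsto_const])
         (intro filterlim_at_top_imp_at_infinity filterlim_compose[OF sqrt_at_top filterlim_real_sequentially])
  qed
  then have lim: "?bound \<longlonglongrightarrow> \<delta> * (m\<Lambda> + 2)" by simp
  have "\<delta> * (m\<Lambda> + 2) < e" unfolding \<delta>(2) using e by simp
  from order_tendstoD(2)[OF lim this] have ev: "\<forall>\<^sub>F n in sequentially. integrable M (V n) \<and> expectation (V n) \<le> e"
    using order_tendstoD(2)[OF h(2), of 1, simplified] eventually_gt_at_top[of 0]
  proof eventually_elim
    case (elim n)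
    then show ?case using mean[of n] by linarith
  qed
  show ?thesis
    by (intro exI[of _ V] conjI allI ballI Vm V0 dom ev)
qed

end

section \<open>Identification on the observed half line\<close>

text \<open>
  Twice the Kullback-Leibler divergence between centred normal laws with variances \<open>v\<^sub>0\<close> and \<open>v\<close>.
\<close>

definition divergence :: "real \<Rightarrow> real \<Rightarrow> real" where
  "divergence v\<^sub>0 v = ln v - ln v\<^sub>0 + v\<^sub>0 / v - 1"

lemma divergence_nonneg:
  assumes "0 < v\<^sub>0" "0 < v"
  shows "0 \<le> divergence v\<^sub>0 v"
proof -
  have "ln (v\<^sub>0 / v) \<le> v\<^sub>0 / v - 1" using assms by (intro ln_le_minus_one) simp
  then show ?thesis unfolding divergence_def using assms by (simp add: ln_div)
qed

lemma divergence_pos: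
  assumes "0 < v\<^sub>0" "0 < v" "v \<noteq> v\<^sub>0"
  shows "0 < divergence v\<^sub>0 v"
proof -
  have "divergence v\<^sub>0 v \<noteq> 0"
  proof
    assume "divergence v\<^sub>0 v = 0"
    then have "ln (v\<^sub>0 / v) = v\<^sub>0 / v - 1" unfolding divergence_def using assms by (simp add: ln_div)
    then have "v\<^sub>0 / v = 1" using assms by (intro ln_eq_minus_one) auto
    then show False using assms by simp
  qed
  then show ?thesis using divergence_nonneg[OF assms(1,2)] by simp
qed

text \<open>
  Replacing the normalized squared increment by the true variance turns the difference of two
  contrasts into a sum of divergences; the error is weighted by the difference of the
  inverse variances.
\<close>

lemma contrast_difference:
  fixes \<sigma> :: "real \<Rightarrow> real \<Rightarrow> real" and X :: "real \<Rightarrow> 'a \<Rightarrow> real" and h \<tau>s :: "nat \<Rightarrow> real"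
    and \<tau> \<theta> \<theta>\<^sub>0 :: real and n :: nat and \<omega> :: 'a
  assumes v: "\<And>x. \<sigma> x \<theta> \<noteq> 0" "\<And>x. \<sigma> x \<theta>\<^sub>0 \<noteq> 0"
    and h: "0 < h n"
  defines "kept \<equiv> \<lambda>i. (of_bool (X (real i * h n) \<omega> > \<tau>s n \<and> X (real i * h n + h n) \<omega> > \<tau>) :: real)"
  shows "contrast \<sigma> X h \<tau> \<tau>s n \<theta> \<omega> - contrast \<sigma> X h \<tau> \<tau>s n \<theta>\<^sub>0 \<omega> =
    (\<Sum>i<n. kept i * divergence ((\<sigma> (X (real i * h n) \<omega>) \<theta>\<^sub>0)\<^sup>2) ((\<sigma> (X (real i * h n) \<omega>) \<theta>)\<^sup>2))
    + (\<Sum>i<n. kept i * (((X (real i * h n + h n) \<omega> - X (real i * h n) \<omega>)\<^sup>2 / h n - (\<sigma> (X (real i * h n) \<omega>) \<theta>\<^sub>0)\<^sup>2)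
        * (1 / (\<sigma> (X (real i * h n) \<omega>) \<theta>)\<^sup>2 - 1 / (\<sigma> (X (real i * h n) \<omega>) \<theta>\<^sub>0)\<^sup>2)))"
proof -
  let ?x = "\<lambda>i. X (real i * h n) \<omega>" and ?y = "\<lambda>i. X (real i * h n + h n) \<omega>"
  have step: "real (Suc i) * h n = real i * h n + h n" for i by (simp add: algebra_simps)
  have c: "contrast \<sigma> X h \<tau> \<tau>s n t \<omega> =
    (\<Sum>i<n. (ln ((\<sigma> (?x i) t)\<^sup>2) + (?y i - ?x i)\<^sup>2 / ((\<sigma> (?x i) t)\<^sup>2 * h n)) * kept i)" for t
    unfolding contrast_def sampled_def kept_def One_nat_def sum.atLeast1_atMost_eq by (simp only: diff_Suc_Suc diff_zero step)
  have alg: "(ln v + d / (v * h n)) * k - (ln w + d / (w * h n)) * k =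
    k * divergence w v + k * ((d / h n - w) * (1 / v - 1 / w))" if "0 < v" "0 < w" for v w d k :: real
    unfolding divergence_def using that h by (simp add: field_simps)
  show ?thesis
    unfolding c sum_subtractf[symmetric] sum.distrib[symmetric]
    using v by (intro sum.cong refl alg) auto
qed

text \<open>
  Nonvanishing continuous functions on an interval keep their sign, so that distinct diffusion
  coefficients have distinct squares.
\<close>

lemma squares_differ:
  fixes f :: "real \<Rightarrow> real"
  assumes "continuous_on {l..u} f" "\<And>t. t \<in> {l..u} \<Longrightarrow> f t \<noteq> 0"
    and st: "s \<in> {l..u}" "t \<in> {l..u}" "f s \<noteq> f t"
  shows "(f s)\<^sup>2 \<noteq> (f t)\<^sup>2"
proof
  assume "(f s)\<^sup>2 = (f t)\<^sup>2"
  then have eq: "f s = - f t" using st(3) by (simp add: power2_eq_iff)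
  have conn: "connected (f ` {l..u})" using assms(1) by (intro connected_continuous_image) auto
  have im: "f s \<in> f ` {l..u}" "f t \<in> f ` {l..u}" using st by auto
  have "0 \<in> f ` {l..u}"
  proof (cases "0 \<le> f t")
    case True
    then have "f s \<le> 0" using eq by simp
    from connectedD_interval[OF conn im(1,2) this True] show ?thesis .
  next
    case False
    then have "f t \<le> 0" "0 \<le> f s" using eq by auto
    from connectedD_interval[OF conn im(2,1) this] show ?thesis .
  qed
  then show False using assms(2) by auto
qed

lemma jointly_continuous:
  fixes f :: "real \<Rightarrow> real \<Rightarrow> real"
  assumes cont: "\<And>\<theta>. \<theta> \<in> \<Theta> \<Longrightarrow> continuous_on UNIV (\<lambda>x. f x \<theta>)"
    and lip: "\<And>x \<theta> \<theta>'. \<theta> \<in> \<Theta> \<Longrightarrow> \<theta>' \<in> \<Theta> \<Longrightarrow> \<bar>f x \<theta> - f x \<theta>'\<bar> \<le> C * (1 + \<bar>x\<bar>) ^ k * \<bar>\<theta> - \<theta>'\<bar>"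
  shows "continuous_on (UNIV \<times> \<Theta>) (\<lambda>z. f (fst z) (snd z))"
  unfolding continuous_on_def
proof
  fix z :: "real \<times> real" assume z: "z \<in> UNIV \<times> \<Theta>"
  let ?F = "at z within UNIV \<times> \<Theta>"
  have id: "((\<lambda>y. y) \<longlongrightarrow> z) ?F" by (rule tendsto_ident_at)
  have 1: "((\<lambda>y. f (fst y) (snd z)) \<longlongrightarrow> f (fst z) (snd z)) ?F"
  proof -
    have "isCont (\<lambda>x. f x (snd z)) (fst z)"
      using cont[of "snd z"] z by (auto simp: continuous_on_eq_continuous_at)
    then show ?thesis by (rule isCont_tendsto_compose[OF _ tendsto_fst[OF id]])
  qed
  have 2: "((\<lambda>y. f (fst y) (snd y) - f (fst y) (snd z)) \<longlongrightarrow> 0) ?F"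
  proof (rule Lim_null_comparison)
    show "\<forall>\<^sub>F y in ?F. norm (f (fst y) (snd y) - f (fst y) (snd z)) \<le> C * (1 + \<bar>fst y\<bar>) ^ k * \<bar>snd y - snd z\<bar>"
      unfolding eventually_at_filter
    proof (intro always_eventually allI impI)
      fix y :: "real \<times> real" assume "y \<in> UNIV \<times> \<Theta>"
      then show "norm (f (fst y) (snd y) - f (fst y) (snd z)) \<le> C * (1 + \<bar>fst y\<bar>) ^ k * \<bar>snd y - snd z\<bar>"
        using lip[of "snd y" "snd z" "fst y"] z by auto
    qed
    have "((\<lambda>y. C * (1 + \<bar>fst y\<bar>) ^ k * \<bar>snd y - snd z\<bar>) \<longlongrightarrow> C * (1 + \<bar>fst z\<bar>) ^ k * \<bar>snd z - snd z\<bar>) ?F"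
      by (intro tendsto_intros id)
    then show "((\<lambda>y. C * (1 + \<bar>fst y\<bar>) ^ k * \<bar>snd y - snd z\<bar>) \<longlongrightarrow> 0) ?F" by simp
  qed
  from tendsto_add[OF 2 1] show "((\<lambda>y. f (fst y) (snd y)) \<longlongrightarrow> f (fst z) (snd z)) ?F" by simp
qed

text \<open>
  By compactness, finitely many intervals inside the observed half line suffice to tell the true
  parameter from all parameters at a given distance.
\<close>

lemma separating_intervals:
  fixes f :: "real \<Rightarrow> real \<Rightarrow> real"
  assumes joint: "continuous_on (UNIV \<times> \<Theta>) (\<lambda>z. f (fst z) (snd z))"
    and nz: "\<And>x \<theta>. \<theta> \<in> \<Theta> \<Longrightarrow> f x \<theta> \<noteq> 0" and \<theta>0: "\<theta>\<^sub>0 \<in> \<Theta>"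
    and N: "compact N" "N \<subseteq> \<Theta>"
    and sep: "\<And>\<theta>. \<theta> \<in> N \<Longrightarrow> \<exists>x>\<tau>. (f x \<theta>)\<^sup>2 \<noteq> (f x \<theta>\<^sub>0)\<^sup>2"
  obtains D :: "real set" and p r c where "finite D" "\<And>d. d \<in> D \<Longrightarrow> 0 < r d \<and> 0 < c d \<and> \<tau> + r d \<le> p d - r d"
    "\<And>\<theta>. \<theta> \<in> N \<Longrightarrow> \<exists>d\<in>D. \<forall>x. \<bar>x - p d\<bar> < r d \<longrightarrow> c d \<le> divergence ((f x \<theta>\<^sub>0)\<^sup>2) ((f x \<theta>)\<^sup>2)"
proof -
  let ?g = "\<lambda>z. divergence ((f (fst z) \<theta>\<^sub>0)\<^sup>2) ((f (fst z) (snd z))\<^sup>2)"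
  have c0: "continuous_on (UNIV \<times> \<Theta>) (\<lambda>z. f (fst z) \<theta>\<^sub>0)"
  proof -
    have "continuous_on (UNIV \<times> \<Theta>) (\<lambda>z. (fst z, \<theta>\<^sub>0))" by (intro continuous_intros)
    from continuous_on_compose2[OF joint this] \<theta>0 show ?thesis by auto
  qed
  have gc: "continuous_on (UNIV \<times> \<Theta>) ?g"
    unfolding divergence_def using nz \<theta>0 by (intro continuous_intros joint c0) auto
  have "\<exists>x r c. 0 < r \<and> 0 < c \<and> \<tau> + r \<le> x - r \<and>
      (\<forall>y \<theta>'. \<theta>' \<in> \<Theta> \<longrightarrow> \<bar>y - x\<bar> < r \<longrightarrow> \<bar>\<theta>' - \<theta>\<bar> < r \<longrightarrow> c \<le> ?g (y, \<theta>'))" if \<theta>: "\<theta> \<in> N" for \<theta>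
  proof -
    have \<theta>\<Theta>: "\<theta> \<in> \<Theta>" using \<theta> N(2) by auto
    obtain x where x: "\<tau> < x" "(f x \<theta>)\<^sup>2 \<noteq> (f x \<theta>\<^sub>0)\<^sup>2" using sep[OF \<theta>] by auto
    define c where "c = ?g (x, \<theta>) / 2"
    have "0 < ?g (x, \<theta>)" using divergence_pos[of "(f x \<theta>\<^sub>0)\<^sup>2" "(f x \<theta>)\<^sup>2"] nz[OF \<theta>0] nz[OF \<theta>\<Theta>] x by simp
    then have c: "0 < c" "?g (x, \<theta>) = 2 * c" unfolding c_def by auto
    obtain d where d: "0 < d" "\<And>z. z \<in> UNIV \<times> \<Theta> \<Longrightarrow> dist z (x, \<theta>) < d \<Longrightarrow> dist (?g z) (?g (x, \<theta>)) < c"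
      using gc[unfolded continuous_on_iff, rule_format, of "(x, \<theta>)" c] \<theta>\<Theta> c(1) by auto
    define r where "r = min (d / 2) ((x - \<tau>) / 2)"
    have r: "0 < r" "r \<le> d / 2" "\<tau> + r \<le> x - r" unfolding r_def using d x by (auto simp: min_def field_simps)
    have "c \<le> ?g (y, \<theta>')" if y: "\<theta>' \<in> \<Theta>" "\<bar>y - x\<bar> < r" "\<bar>\<theta>' - \<theta>\<bar> < r" for y \<theta>'
    proof -
      have "dist (y, \<theta>') (x, \<theta>) \<le> \<bar>y - x\<bar> + \<bar>\<theta>' - \<theta>\<bar>"
        unfolding dist_Pair_Pair dist_real_def using sqrt_sum_squares_le_sum_abs[of "\<bar>y - x\<bar>" "\<bar>\<theta>' - \<theta>\<bar>"] by simp
      also have "\<dots> < d" using y r by linarith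
      finally have "dist (?g (y, \<theta>')) (?g (x, \<theta>)) < c" using y(1) by (intro d(2)) auto
      then show ?thesis using c(2) unfolding dist_real_def by linarith
    qed
    then show ?thesis using r c by blast
  qed
  then obtain x r c where xrc: "\<And>\<theta>. \<theta> \<in> N \<Longrightarrow> 0 < r \<theta> \<and> 0 < c \<theta> \<and> \<tau> + r \<theta> \<le> x \<theta> - r \<theta> \<and>
      (\<forall>y \<theta>'. \<theta>' \<in> \<Theta> \<longrightarrow> \<bar>y - x \<theta>\<bar> < r \<theta> \<longrightarrow> \<bar>\<theta>' - \<theta>\<bar> < r \<theta> \<longrightarrow> c \<theta> \<le> ?g (y, \<theta>'))"
    by metis
  have "N \<subseteq> (\<Union>\<theta>\<in>N. ball \<theta> (r \<theta>))" using xrc by auto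
  from compactE_image[OF N(1) _ this] obtain D where D: "D \<subseteq> N" "finite D" "N \<subseteq> (\<Union>\<theta>\<in>D. ball \<theta> (r \<theta>))"
    by auto
  show thesis
  proof (rule that[of D r c x])
    show "finite D" by (rule D)
    show "0 < r d \<and> 0 < c d \<and> \<tau> + r d \<le> x d - r d" if "d \<in> D" for d
      using xrc[of d] D(1) that by auto
    show "\<exists>d\<in>D. \<forall>y. \<bar>y - x d\<bar> < r d \<longrightarrow> c d \<le> divergence ((f y \<theta>\<^sub>0)\<^sup>2) ((f y \<theta>)\<^sup>2)" if \<theta>: "\<theta> \<in> N" for \<theta>
    proof -
      obtain d where d: "d \<in> D" "\<theta> \<in> ball d (r d)" using D(3) \<theta> by auto
      have "\<bar>\<theta> - d\<bar> < r d" using d(2) by (simp add: dist_real_def abs_minus_commute)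
      moreover have "\<theta> \<in> \<Theta>" using \<theta> N(2) by auto
      moreover have "d \<in> N" using d(1) D(1) by auto
      ultimately show ?thesis using xrc[of d] d(1) by (intro bexI[of _ d]) auto
    qed
  qed
qed

lemma finite_positive_lower_bound:
  fixes g :: "'b \<Rightarrow> real"
  assumes "finite D" "\<And>d. d \<in> D \<Longrightarrow> 0 < g d"
  obtains v where "0 < v" "\<And>d. d \<in> D \<Longrightarrow> v \<le> g d"
proof (rule that)
  show "0 < Min (insert 1 (g ` D))" using assms by (subst Min_gr_iff) auto
  show "Min (insert 1 (g ` D)) \<le> g d" if "d \<in> D" for d using assms(1) that by (intro Min_le) auto
qed

section \<open>Consistency under uniform regularity\<close>

context stationary_diffusion
begin

text \<open>
  The mean of the tent is positive because the invariant law charges the middle half of its base.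
\<close>

lemma bump_function:
  fixes p r x y :: real
  assumes nondeg: "0 < \<kappa>" "\<And>x. \<kappa> \<le> (\<sigma> x)\<^sup>2" and r: "0 < r"
  defines "G \<equiv> \<lambda>x. max 0 (1 - \<bar>x - p\<bar> / r)"
  shows "0 \<le> G x" "G x \<le> 1" "\<bar>G x - G y\<bar> \<le> 1 / r * \<bar>x - y\<bar>" "\<not> \<bar>x - p\<bar> < r \<Longrightarrow> G x = 0"
    and "0 < (\<integral>x. G x \<partial>\<nu>)"
proof -
  show G01: "0 \<le> G x" "G x \<le> 1" for x unfolding G_def using r by auto
  show "\<bar>G x - G y\<bar> \<le> 1 / r * \<bar>x - y\<bar>"
  proof -
    have "\<bar>G x - G y\<bar> \<le> \<bar>(1 - \<bar>x - p\<bar> / r) - (1 - \<bar>y - p\<bar> / r)\<bar>" unfolding G_def by linarith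
    also have "\<dots> = \<bar>\<bar>y - p\<bar> - \<bar>x - p\<bar>\<bar> / r" using r by (simp add: diff_divide_distrib[symmetric])
    also have "\<dots> \<le> \<bar>x - y\<bar> / r" using r by (intro divide_right_mono) auto
    finally show ?thesis by simp
  qed
  show "\<not> \<bar>x - p\<bar> < r \<Longrightarrow> G x = 0" unfolding G_def using r by (simp add: field_simps)
  interpret \<nu>: prob_space \<nu> by (rule prob_space_\<nu>)
  have Gi: "integrable \<nu> G"
  proof (rule integrable_growth[of _ 1 0])
    show "G \<in> borel_measurable borel" unfolding G_def by measurable
    show "\<bar>G x\<bar> \<le> 1 * (1 + \<bar>x\<bar>) ^ 0" for x using G01[of x] by simp
  qed
  have "0 < measure \<nu> (ball p (r / 2)) / 2" using full_support[OF nondeg, of "r / 2" p] r by simp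
  also have "\<dots> = (\<integral>x. indicator (ball p (r / 2)) x / 2 \<partial>\<nu>)" by simp
  also have "\<dots> \<le> (\<integral>x. G x \<partial>\<nu>)"
  proof (rule integral_mono[OF _ Gi])
    show "integrable \<nu> (\<lambda>x. indicator (ball p (r / 2)) x / 2 :: real)"
      by (intro integrable_divide integrable_real_indicator) (auto simp: \<nu>.emeasure_eq_measure)
    show "indicator (ball p (r / 2)) x / 2 \<le> G x" for x
    proof (cases "x \<in> ball p (r / 2)")
      case True
      then have "\<bar>x - p\<bar> / r \<le> 1 / 2" using r by (simp add: dist_real_def field_simps abs_minus_commute)
      then have "1 / 2 \<le> G x" unfolding G_def le_max_iff_disj by linarith
      then show ?thesis using True by simp
    qed (use G01[of x] in simp)
  qed
  finally show "0 < (\<integral>x. G x \<partial>\<nu>)" .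
qed

text \<open>
  Suppose that the estimate is at distance \<open>\<epsilon>\<close> or more from the true value. One of finitely many
  intervals then separates it, and the contrast at the estimate exceeds that at the true value by a
  multiple of the number of visits to the interval, up to the fluctuations. As it is no larger,
  one of three unlikely events occurs: few visits, large fluctuations, or large squared increments
  (the last accounts for visits that are discarded because the next observation is lost).
\<close>

lemma contrast_consistency:
  fixes f :: "real \<Rightarrow> real \<Rightarrow> real" and h \<tau>s :: "nat \<Rightarrow> real" and \<theta>hat :: "nat \<Rightarrow> 'a \<Rightarrow> real"
  assumes stat: "stationary M X" and erg: "ergodic M X"
    and h: "\<And>n. 0 < h n" "h \<longlonglongrightarrow> 0" "filterlim (\<lambda>n. real n * h n) at_top sequentially"
    and \<tau>s: "\<And>n. \<tau> < \<tau>s n" "\<tau>s \<longlonglongrightarrow> \<tau>" "(\<lambda>n. h n / (\<tau>s n - \<tau>)\<^sup>2) \<longlonglongrightarrow> 0"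
    and \<theta>0: "\<theta>\<^sub>0 \<in> {l..u}" "\<And>x. f x \<theta>\<^sub>0 = \<sigma> x"
    and \<kappa>: "0 < \<kappa>" "\<And>x \<theta>. \<theta> \<in> {l..u} \<Longrightarrow> \<kappa> \<le> (f x \<theta>)\<^sup>2"
    and cont: "\<And>\<theta>. \<theta> \<in> {l..u} \<Longrightarrow> continuous_on UNIV (\<lambda>x. f x \<theta>)"
    and growth: "\<And>x \<theta>. \<theta> \<in> {l..u} \<Longrightarrow> \<bar>f x \<theta>\<bar> \<le> C * (1 + \<bar>x\<bar>) ^ k"
    and lip: "\<And>x \<theta> \<theta>'. \<theta> \<in> {l..u} \<Longrightarrow> \<theta>' \<in> {l..u} \<Longrightarrow> \<bar>f x \<theta> - f x \<theta>'\<bar> \<le> C * (1 + \<bar>x\<bar>) ^ k * \<bar>\<theta> - \<theta>'\<bar>"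
    and C0: "0 \<le> C"
    and ident: "\<And>\<theta>. \<theta> \<in> {l..u} \<Longrightarrow> (\<forall>x>\<tau>. f x \<theta> = f x \<theta>\<^sub>0) \<Longrightarrow> \<theta> = \<theta>\<^sub>0"
    and est: "\<And>n. \<theta>hat n \<in> borel_measurable M"
      "\<And>n. AE \<omega> in M. \<theta>hat n \<omega> \<in> {l..u} \<and> contrast f X h \<tau> \<tau>s n (\<theta>hat n \<omega>) \<omega> \<le> contrast f X h \<tau> \<tau>s n \<theta>\<^sub>0 \<omega>"
  shows "tendsto_in_prob M \<theta>hat \<theta>\<^sub>0"
  unfolding tendsto_in_prob_def
proof (intro allI impI)
  fix \<epsilon> :: real assume \<epsilon>: "0 < \<epsilon>"
  let ?\<Theta> = "{l..u}"
  have nz: "f x \<theta> \<noteq> 0" if "\<theta> \<in> ?\<Theta>" for x \<theta> using \<kappa>(1) \<kappa>(2)[OF that, of x] by auto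
  have \<kappa>\<sigma>: "\<kappa> \<le> (\<sigma> x)\<^sup>2" for x using \<kappa>(2)[OF \<theta>0(1), of x] \<theta>0(2) by simp
  have joint: "continuous_on (UNIV \<times> ?\<Theta>) (\<lambda>z. f (fst z) (snd z))"
    using cont lip by (rule jointly_continuous)
  have contp: "continuous_on ?\<Theta> (f x)" for x
  proof -
    have "continuous_on ?\<Theta> (\<lambda>\<theta>. (x, \<theta>))" by (intro continuous_intros)
    from continuous_on_compose2[OF joint this] show ?thesis by auto
  qed
  define N where "N = {\<theta> \<in> ?\<Theta>. \<epsilon> \<le> \<bar>\<theta> - \<theta>\<^sub>0\<bar>}"
  have N: "compact N" "N \<subseteq> ?\<Theta>"
  proof -
    have "N = ?\<Theta> \<inter> {\<theta>. \<epsilon> \<le> \<bar>\<theta> - \<theta>\<^sub>0\<bar>}" unfolding N_def by auto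
    moreover have "closed {\<theta>. \<epsilon> \<le> \<bar>\<theta> - \<theta>\<^sub>0\<bar>}" by (intro closed_Collect_le continuous_intros)
    ultimately show "compact N" using compact_Int_closed[of ?\<Theta>] by simp
    show "N \<subseteq> ?\<Theta>" unfolding N_def by auto
  qed
  have sep: "\<exists>x>\<tau>. (f x \<theta>)\<^sup>2 \<noteq> (f x \<theta>\<^sub>0)\<^sup>2" if \<theta>: "\<theta> \<in> N" for \<theta>
  proof -
    have "\<theta> \<noteq> \<theta>\<^sub>0" "\<theta> \<in> ?\<Theta>" using \<theta> \<epsilon> unfolding N_def by auto
    then obtain x where x: "\<tau> < x" "f x \<theta> \<noteq> f x \<theta>\<^sub>0" using ident[of \<theta>] by auto
    have "(f x \<theta>)\<^sup>2 \<noteq> (f x \<theta>\<^sub>0)\<^sup>2"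
      by (rule squares_differ[OF contp nz \<open>\<theta> \<in> ?\<Theta>\<close> \<theta>0(1) x(2)])
    then show ?thesis using x(1) by auto
  qed
  obtain D :: "real set" and p r c where D: "finite D" "\<And>d. d \<in> D \<Longrightarrow> 0 < r d \<and> 0 < c d \<and> \<tau> + r d \<le> p d - r d"
    and Dsep: "\<And>\<theta>. \<theta> \<in> N \<Longrightarrow> \<exists>d\<in>D. \<forall>x. \<bar>x - p d\<bar> < r d \<longrightarrow> c d \<le> divergence ((f x \<theta>\<^sub>0)\<^sup>2) ((f x \<theta>)\<^sup>2)"
    by (rule separating_intervals[OF joint nz \<theta>0(1) N sep]) (assumption, assumption, rule that)
  define G where "G d x = max 0 (1 - \<bar>x - p d\<bar> / r d)" for d x
  define m where "m d = (\<integral>x. G d x \<partial>\<nu>)" for d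
  have G: "0 \<le> G d x" "G d x \<le> 1" "\<bar>G d x - G d y\<bar> \<le> 1 / r d * \<bar>x - y\<bar>" "\<not> \<bar>x - p d\<bar> < r d \<Longrightarrow> G d x = 0"
    and mpos: "0 < m d" if "d \<in> D" for d x y
    unfolding m_def G_def using bump_function[OF \<kappa>(1) \<kappa>\<sigma>, of "r d"] D(2)[OF that] by auto
  have lev: "0 < c d * m d / 8" "0 < (r d)\<^sup>2 * m d / 8" if "d \<in> D" for d
    using mpos[OF that] D(2)[OF that] by auto
  obtain v where v: "0 < v" "\<And>d. d \<in> D \<Longrightarrow> v \<le> c d * m d / 8"
    using finite_positive_lower_bound[OF D(1), of "\<lambda>d. c d * m d / 8"] lev(1) by blast
  obtain w where w: "0 < w" "\<And>d. d \<in> D \<Longrightarrow> w \<le> (r d)\<^sup>2 * m d / 8"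
    using finite_positive_lower_bound[OF D(1), of "\<lambda>d. (r d)\<^sup>2 * m d / 8"] lev(2) by blast
  obtain C1 where C1: "0 \<le> C1"
    "\<And>s t. 0 \<le> s \<Longrightarrow> s \<le> t \<Longrightarrow> t \<le> s + 1 \<Longrightarrow> integrable M (\<lambda>\<omega>. (X t \<omega> - X s \<omega>)\<^sup>2)"
    "\<And>s t. 0 \<le> s \<Longrightarrow> s \<le> t \<Longrightarrow> t \<le> s + 1 \<Longrightarrow> expectation (\<lambda>\<omega>. (X t \<omega> - X s \<omega>)\<^sup>2) \<le> C1 * (t - s)"
    by (rule increment_square) (rule that)
  define U where "U n \<omega> = (\<Sum>i<n. (X (real i * h n + h n) \<omega> - X (real i * h n) \<omega>)\<^sup>2) / real n" for n \<omega>
  have Um [measurable]: "U n \<in> borel_measurable M" for n unfolding U_def by measurable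
  have U0: "0 \<le> U n \<omega>" for n \<omega> unfolding U_def by (intro divide_nonneg_nonneg sum_nonneg) auto
  have EU: "integrable M (U n)" "expectation (U n) \<le> C1 * h n" if n: "0 < n" "h n \<le> 1" for n
  proof -
    have i: "integrable M (\<lambda>\<omega>. (X (real i * h n + h n) \<omega> - X (real i * h n) \<omega>)\<^sup>2)"
      "expectation (\<lambda>\<omega>. (X (real i * h n + h n) \<omega> - X (real i * h n) \<omega>)\<^sup>2) \<le> C1 * h n" for i
      using C1(2,3)[of "real i * h n" "real i * h n + h n"] h(1)[of n] n by auto
    show "integrable M (U n)" unfolding U_def using i(1) by (intro integrable_divide Bochner_Integration.integrable_sum) auto
    have "expectation (U n) = (\<Sum>i<n. expectation (\<lambda>\<omega>. (X (real i * h n + h n) \<omega> - X (real i * h n) \<omega>)\<^sup>2)) / real n"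
      unfolding U_def using i(1) by (simp add: Bochner_Integration.integral_sum)
    also have "\<dots> \<le> (\<Sum>i<n. C1 * h n) / real n" using i(2) by (intro divide_right_mono sum_mono) auto
    also have "\<dots> = C1 * h n" using n by simp
    finally show "expectation (U n) \<le> C1 * h n" .
  qed
  define Q where "Q x \<theta> = 1 / (f x \<theta>)\<^sup>2 - 1 / (f x \<theta>\<^sub>0)\<^sup>2" for x \<theta>
  define \<Lambda> where "\<Lambda> x = 2 * C ^ 4 / \<kappa>\<^sup>2 * (1 + \<bar>x\<bar>) ^ (4 * k)" for x
  define Err where "Err n \<theta> \<omega> = (\<Sum>i<n. (of_bool (X (real i * h n) \<omega> > \<tau>s n \<and> X (real i * h n + h n) \<omega> > \<tau>) :: real) *
      (((X (real i * h n + h n) \<omega> - X (real i * h n) \<omega>)\<^sup>2 / h n - (\<sigma> (X (real i * h n) \<omega>))\<^sup>2) * Q (X (real i * h n) \<omega>) \<theta>))" for n \<theta> \<omega>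
  have error: "\<exists>V. (\<forall>n. V n \<in> borel_measurable M) \<and> (\<forall>n. \<forall>\<omega>\<in>space M. 0 \<le> V n \<omega>) \<and>
    (\<forall>n. \<forall>\<omega>\<in>space M. \<forall>\<theta>\<in>?\<Theta>. \<bar>Err n \<theta> \<omega>\<bar> \<le> real n * V n \<omega>) \<and>
    (\<forall>\<^sub>F n in sequentially. integrable M (V n) \<and> expectation (V n) \<le> e)" if e: "0 < e" for e
    unfolding Err_def
  proof (rule uniform_error[OF h(1,2) \<tau>s(1,3) compact_Icc, where B="1 / \<kappa>" and \<Lambda>=\<Lambda>])
    fix \<theta> assume \<theta>: "\<theta> \<in> ?\<Theta>"
    have [measurable]: "(\<lambda>x. f x t) \<in> borel_measurable borel" if "t \<in> ?\<Theta>" for t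
      using cont[OF that] by (rule borel_measurable_continuous_onI)
    show "(\<lambda>x. Q x \<theta>) \<in> borel_measurable borel" unfolding Q_def using \<theta> \<theta>0(1) by measurable
    fix x
    have b: "0 \<le> 1 / (f x t)\<^sup>2" "1 / (f x t)\<^sup>2 \<le> 1 / \<kappa>" if "t \<in> ?\<Theta>" for t
      using \<kappa>(1) \<kappa>(2)[OF that, of x] by (auto simp: frac_le)
    show "\<bar>Q x \<theta>\<bar> \<le> 1 / \<kappa>" unfolding Q_def using b[OF \<theta>] b[OF \<theta>0(1)] by linarith
  next
    fix x \<theta> \<theta>' assume \<theta>: "\<theta> \<in> ?\<Theta>" "\<theta>' \<in> ?\<Theta>"
    let ?P = "C * (1 + \<bar>x\<bar>) ^ k" and ?a = "f x \<theta>" and ?b = "f x \<theta>'"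
    have P0: "0 \<le> ?P" using C0 by simp
    have s: "\<kappa> \<le> ?a\<^sup>2" "\<kappa> \<le> ?b\<^sup>2" "0 < ?a\<^sup>2" "0 < ?b\<^sup>2" using \<kappa>(2) nz \<theta> by auto
    have "Q x \<theta> - Q x \<theta>' = (?b\<^sup>2 - ?a\<^sup>2) / (?a\<^sup>2 * ?b\<^sup>2)" unfolding Q_def using s by (simp add: field_simps)
    also have "?b\<^sup>2 - ?a\<^sup>2 = (?b - ?a) * (?b + ?a)" by (simp add: power2_eq_square algebra_simps)
    finally have "\<bar>Q x \<theta> - Q x \<theta>'\<bar> = \<bar>?b - ?a\<bar> * \<bar>?b + ?a\<bar> / (?a\<^sup>2 * ?b\<^sup>2)"
      by (simp add: abs_mult)
    also have "\<dots> \<le> (?P * \<bar>\<theta> - \<theta>'\<bar>) * (2 * ?P) / (\<kappa> * \<kappa>)"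
    proof (rule frac_le)
      show "\<bar>?b - ?a\<bar> * \<bar>?b + ?a\<bar> \<le> (?P * \<bar>\<theta> - \<theta>'\<bar>) * (2 * ?P)"
      proof (rule mult_mono)
        show "\<bar>?b - ?a\<bar> \<le> ?P * \<bar>\<theta> - \<theta>'\<bar>" using lip[OF \<theta>(2,1), of x] by (simp add: abs_minus_commute)
        show "\<bar>?b + ?a\<bar> \<le> 2 * ?P" using growth[OF \<theta>(1), of x] growth[OF \<theta>(2), of x] by linarith
      qed (use P0 in auto)
      show "\<kappa> * \<kappa> \<le> ?a\<^sup>2 * ?b\<^sup>2" using s \<kappa>(1) by (intro mult_mono) auto
    qed (use P0 \<kappa>(1) in auto)
    finally have q: "\<bar>Q x \<theta> - Q x \<theta>'\<bar> \<le> (?P * \<bar>\<theta> - \<theta>'\<bar>) * (2 * ?P) / (\<kappa> * \<kappa>)" .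
    have "\<bar>\<sigma> x\<bar>\<^sup>2 \<le> ?P\<^sup>2" using growth[OF \<theta>0(1), of x] \<theta>0(2) by (intro power_mono) auto
    then have "(\<sigma> x)\<^sup>2 * \<bar>Q x \<theta> - Q x \<theta>'\<bar> \<le> ?P\<^sup>2 * ((?P * \<bar>\<theta> - \<theta>'\<bar>) * (2 * ?P) / (\<kappa> * \<kappa>))"
      using q by (intro mult_mono) auto
    also have "\<dots> = 2 * ?P ^ 4 / \<kappa>\<^sup>2 * \<bar>\<theta> - \<theta>'\<bar>"
      by (simp add: power2_eq_square power4_eq_xxxx)
    also have "?P ^ 4 = C ^ 4 * (1 + \<bar>x\<bar>) ^ (4 * k)" by (simp add: power_mult_distrib power_mult[symmetric] mult.commute)
    finally show "(\<sigma> x)\<^sup>2 * \<bar>Q x \<theta> - Q x \<theta>'\<bar> \<le> \<Lambda> x * \<bar>\<theta> - \<theta>'\<bar>" unfolding \<Lambda>_def by simp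
  next
    show "0 \<le> 1 / \<kappa>" using \<kappa>(1) by simp
    show "\<Lambda> \<in> borel_measurable borel" unfolding \<Lambda>_def by measurable
    have "(\<Lambda> x)\<^sup>2 = (2 * C ^ 4 / \<kappa>\<^sup>2)\<^sup>2 * (1 + \<bar>x\<bar>) ^ (8 * k)" for x
    proof -
      have "((1 + \<bar>x\<bar>) ^ (4 * k))\<^sup>2 = (1 + \<bar>x\<bar>) ^ (8 * k)"
        unfolding power_mult[symmetric] by (rule arg_cong[where f="\<lambda>j. (1 + \<bar>x\<bar>) ^ j"]) simp
      then show ?thesis unfolding \<Lambda>_def by (simp only: power_mult_distrib[of _ "(1 + \<bar>x\<bar>) ^ (4 * k)"])
    qed
    then show "integrable \<nu> (\<lambda>x. (\<Lambda> x)\<^sup>2)" using moments[of "8 * k"] by simp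
    show "0 \<le> \<Lambda> x" for x unfolding \<Lambda>_def using C0 by simp
  qed (rule e)
  have occ: "(\<lambda>n. measure M {\<omega> \<in> space M. (\<Sum>i<n. G d (X (real i * h n) \<omega>)) < m d / 2 * real n}) \<longlonglongrightarrow> 0" if d: "d \<in> D" for d
    using G[OF d] mpos[OF d] D(2)[OF d]
    by (intro occupation_lower_bound[OF stat erg _ _ _ _ m_def _ h, where \<Lambda>="1 / r d"]) auto
  have Gm [measurable]: "G d \<in> borel_measurable borel" for d unfolding G_def by measurable
  let ?O = "\<lambda>n d. {\<omega> \<in> space M. (\<Sum>i<n. G d (X (real i * h n) \<omega>)) < m d / 2 * real n}"
  have thr: "\<forall>\<^sub>F n in sequentially. \<forall>d\<in>D. \<tau>s n < \<tau> + r d"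
  proof (rule eventually_ball_finite[OF D(1)], rule ballI)
    fix d assume "d \<in> D"
    then have "\<tau> < \<tau> + r d" using D(2) by auto
    from order_tendstoD(2)[OF \<tau>s(2) this] show "\<forall>\<^sub>F n in sequentially. \<tau>s n < \<tau> + r d" .
  qed
  show "(\<lambda>n. measure M {\<omega> \<in> space M. \<epsilon> < \<bar>\<theta>hat n \<omega> - \<theta>\<^sub>0\<bar>}) \<longlonglongrightarrow> 0"
  proof (rule LIMSEQ_I)
    fix \<eta> :: real assume \<eta>: "0 < \<eta>"
    have "0 < v * \<eta> / 3" using v(1) \<eta> by simp
    from error[OF this] obtain V where V: "\<forall>n. V n \<in> borel_measurable M" "\<forall>n. \<forall>\<omega>\<in>space M. 0 \<le> V n \<omega>"
        "\<forall>n. \<forall>\<omega>\<in>space M. \<forall>\<theta>\<in>?\<Theta>. \<bar>Err n \<theta> \<omega>\<bar> \<le> real n * V n \<omega>"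
      and EV: "\<forall>\<^sub>F n in sequentially. integrable M (V n) \<and> expectation (V n) \<le> v * \<eta> / 3"
      by (elim exE conjE) (rule that)
    have Vm [measurable]: "V n \<in> borel_measurable M" for n using V(1) by (rule spec)
    have V0: "0 \<le> V n \<omega>" if "\<omega> \<in> space M" for n \<omega> using V(2)[rule_format, OF that] .
    have dom: "\<bar>Err n \<theta> \<omega>\<bar> \<le> real n * V n \<omega>" if "\<omega> \<in> space M" "\<theta> \<in> ?\<Theta>" for n \<omega> \<theta>
      using V(3)[rule_format, OF that] .
    have incl: "\<omega> \<in> (\<Union>d\<in>D. ?O n d) \<union> ({\<omega> \<in> space M. w \<le> U n \<omega>} \<union> {\<omega> \<in> space M. v \<le> V n \<omega>})"
      if n: "0 < n" and thr: "\<forall>d\<in>D. \<tau>s n < \<tau> + r d" and \<omega>: "\<omega> \<in> space M" and far: "\<epsilon> < \<bar>\<theta>hat n \<omega> - \<theta>\<^sub>0\<bar>"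
        and est\<omega>: "\<theta>hat n \<omega> \<in> ?\<Theta>" "contrast f X h \<tau> \<tau>s n (\<theta>hat n \<omega>) \<omega> \<le> contrast f X h \<tau> \<tau>s n \<theta>\<^sub>0 \<omega>" for n \<omega>
    proof (rule ccontr)
      let ?\<theta> = "\<theta>hat n \<omega>"
      let ?x = "\<lambda>i. X (real i * h n) \<omega>" and ?y = "\<lambda>i. X (real i * h n + h n) \<omega>"
      let ?\<chi> = "\<lambda>i. (of_bool (?x i > \<tau>s n \<and> ?y i > \<tau>) :: real)"
      let ?div = "\<lambda>i. divergence ((f (?x i) \<theta>\<^sub>0)\<^sup>2) ((f (?x i) ?\<theta>)\<^sup>2)"
      assume "\<not> ?thesis"
      then have nO: "\<And>d. d \<in> D \<Longrightarrow> m d / 2 * real n \<le> (\<Sum>i<n. G d (?x i))"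
        and nU: "U n \<omega> < w" and nV: "V n \<omega> < v" using \<omega> by (auto simp: not_le not_less)
      have "?\<theta> \<in> N" unfolding N_def using far est\<omega>(1) by auto
      then obtain d where d: "d \<in> D" "\<And>x. \<bar>x - p d\<bar> < r d \<Longrightarrow> c d \<le> divergence ((f x \<theta>\<^sub>0)\<^sup>2) ((f x ?\<theta>)\<^sup>2)"
        using Dsep by blast
      note dD = D(2)[OF d(1)]
      (* A discarded visit requires a step larger than r d, because the interval stays r d away from the threshold. *)
      have low: "c d * (G d (?x i) - (?y i - ?x i)\<^sup>2 / (r d)\<^sup>2) \<le> ?\<chi> i * ?div i" for i
      proof (cases "\<bar>?x i - p d\<bar> < r d")
        case True
        then have x: "\<tau> + r d < ?x i" using dD by linarith
        then have xs: "\<tau>s n < ?x i" using thr d(1) by force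
        show ?thesis
        proof (cases "\<tau> < ?y i")
          case y: True
          have "G d (?x i) - (?y i - ?x i)\<^sup>2 / (r d)\<^sup>2 \<le> 1"
          proof -
            have "0 \<le> (?y i - ?x i)\<^sup>2 / (r d)\<^sup>2" by simp
            then show ?thesis using G(2)[OF d(1), of "?x i"] by linarith
          qed
          then have "c d * (G d (?x i) - (?y i - ?x i)\<^sup>2 / (r d)\<^sup>2) \<le> c d * 1"
            using dD by (intro mult_left_mono) auto
          also have "\<dots> \<le> ?\<chi> i * ?div i" using d(2)[OF True] y xs by simp
          finally show ?thesis .
        next
          case y: False
          then have "r d \<le> \<bar>?y i - ?x i\<bar>" using x by linarith
          then have "(r d)\<^sup>2 \<le> \<bar>?y i - ?x i\<bar>\<^sup>2" using dD by (intro power_mono) auto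
          then have "1 \<le> (?y i - ?x i)\<^sup>2 / (r d)\<^sup>2" using dD by simp
          then have "G d (?x i) - (?y i - ?x i)\<^sup>2 / (r d)\<^sup>2 \<le> 0" using G(2)[OF d(1), of "?x i"] by linarith
          then have "c d * (G d (?x i) - (?y i - ?x i)\<^sup>2 / (r d)\<^sup>2) \<le> 0" using dD by (simp add: mult_nonneg_nonpos)
          then show ?thesis using y by simp
        qed
      next
        case False
        have "0 \<le> (?y i - ?x i)\<^sup>2 / (r d)\<^sup>2" by simp
        then have "G d (?x i) - (?y i - ?x i)\<^sup>2 / (r d)\<^sup>2 \<le> 0" using G(4)[OF d(1) False] by linarith
        then have "c d * (G d (?x i) - (?y i - ?x i)\<^sup>2 / (r d)\<^sup>2) \<le> 0" using dD by (simp add: mult_nonneg_nonpos)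
        moreover have "0 \<le> ?\<chi> i * ?div i"
          using nz[OF \<theta>0(1)] nz[OF est\<omega>(1)] by (intro mult_nonneg_nonneg divergence_nonneg) auto
        ultimately show ?thesis by linarith
      qed
      have "contrast f X h \<tau> \<tau>s n ?\<theta> \<omega> - contrast f X h \<tau> \<tau>s n \<theta>\<^sub>0 \<omega> = (\<Sum>i<n. ?\<chi> i * ?div i) + Err n ?\<theta> \<omega>"
        using contrast_difference[where \<sigma>=f and \<theta>="?\<theta>" and \<theta>\<^sub>0=\<theta>\<^sub>0 and h=h and n=n
            and X=X and \<omega>=\<omega> and \<tau>s=\<tau>s and \<tau>=\<tau>] nz[OF est\<omega>(1)] nz[OF \<theta>0(1)] h(1)[of n]
        unfolding Err_def Q_def \<theta>0(2) by simp
      then have "(\<Sum>i<n. ?\<chi> i * ?div i) \<le> - Err n ?\<theta> \<omega>" using est\<omega>(2) by linarith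
      also have "\<dots> \<le> real n * V n \<omega>" using dom[OF \<omega> est\<omega>(1), of n] by linarith
      also have "\<dots> < real n * v" using n nV by simp
      also have "\<dots> \<le> real n * (c d * m d / 8)" using v(2)[OF d(1)] by (intro mult_left_mono) auto
      finally have up: "(\<Sum>i<n. ?\<chi> i * ?div i) < real n * (c d * m d / 8)" .
      have "(\<Sum>i<n. c d * (G d (?x i) - (?y i - ?x i)\<^sup>2 / (r d)\<^sup>2)) = c d * ((\<Sum>i<n. G d (?x i)) - (\<Sum>i<n. (?y i - ?x i)\<^sup>2) / (r d)\<^sup>2)"
        by (simp add: sum_distrib_left[symmetric] sum_subtractf sum_divide_distrib[symmetric])
      also have "(\<Sum>i<n. (?y i - ?x i)\<^sup>2) = real n * U n \<omega>" unfolding U_def using n by simp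
      finally have eq: "(\<Sum>i<n. c d * (G d (?x i) - (?y i - ?x i)\<^sup>2 / (r d)\<^sup>2)) = c d * ((\<Sum>i<n. G d (?x i)) - real n * U n \<omega> / (r d)\<^sup>2)" .
      have "real n * U n \<omega> / (r d)\<^sup>2 \<le> real n * ((r d)\<^sup>2 * m d / 8) / (r d)\<^sup>2"
        using nU w(2)[OF d(1)] by (intro divide_right_mono mult_left_mono) auto
      also have "\<dots> = real n * m d / 8" using dD by simp
      finally have "real n * U n \<omega> / (r d)\<^sup>2 \<le> real n * m d / 8" .
      moreover have "real n * m d / 2 \<le> (\<Sum>i<n. G d (?x i))"
        using nO[OF d(1)] by (simp add: mult.commute)
      moreover have "0 \<le> real n * m d" using mpos[OF d(1)] by simp
      ultimately have "real n * m d / 8 \<le> (\<Sum>i<n. G d (?x i)) - real n * U n \<omega> / (r d)\<^sup>2"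
        by linarith
      then have "c d * (real n * m d / 8) \<le> c d * ((\<Sum>i<n. G d (?x i)) - real n * U n \<omega> / (r d)\<^sup>2)"
        using dD by (intro mult_left_mono) auto
      also have "\<dots> \<le> (\<Sum>i<n. ?\<chi> i * ?div i)" unfolding eq[symmetric] by (intro sum_mono low)
      finally show False using up by (simp add: mult.left_commute mult.commute)
    qed
    have bound: "\<forall>\<^sub>F n in sequentially. measure M {\<omega> \<in> space M. \<epsilon> < \<bar>\<theta>hat n \<omega> - \<theta>\<^sub>0\<bar>}
        \<le> (\<Sum>d\<in>D. measure M (?O n d)) + (C1 / w * h n + \<eta> / 3)"
      using EV thr order_tendstoD(2)[OF h(2), of 1, simplified] eventually_gt_at_top[of 0]
    proof eventually_elim
      case (elim n)
      have "measure M {\<omega> \<in> space M. \<epsilon> < \<bar>\<theta>hat n \<omega> - \<theta>\<^sub>0\<bar>} \<le>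
        measure M ((\<Union>d\<in>D. ?O n d) \<union> ({\<omega> \<in> space M. w \<le> U n \<omega>} \<union> {\<omega> \<in> space M. v \<le> V n \<omega>}))"
      proof (rule finite_measure_mono_AE)
        show "AE \<omega> in M. \<omega> \<in> {\<omega> \<in> space M. \<epsilon> < \<bar>\<theta>hat n \<omega> - \<theta>\<^sub>0\<bar>} \<longrightarrow>
          \<omega> \<in> (\<Union>d\<in>D. ?O n d) \<union> ({\<omega> \<in> space M. w \<le> U n \<omega>} \<union> {\<omega> \<in> space M. v \<le> V n \<omega>})"
          using est(2)[of n]
        proof eventually_elim
          case E: (elim \<omega>)
          show ?case
          proof
            assume "\<omega> \<in> {\<omega> \<in> space M. \<epsilon> < \<bar>\<theta>hat n \<omega> - \<theta>\<^sub>0\<bar>}"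
            then show "\<omega> \<in> (\<Union>d\<in>D. ?O n d) \<union> ({\<omega> \<in> space M. w \<le> U n \<omega>} \<union> {\<omega> \<in> space M. v \<le> V n \<omega>})"
              using E elim by (intro incl) auto
          qed
        qed
        show "(\<Union>d\<in>D. ?O n d) \<union> ({\<omega> \<in> space M. w \<le> U n \<omega>} \<union> {\<omega> \<in> space M. v \<le> V n \<omega>}) \<in> sets M"
          using D(1) by (intro sets.Un sets.finite_UN) measurable
      qed
      also have "\<dots> \<le> measure M (\<Union>d\<in>D. ?O n d) + measure M ({\<omega> \<in> space M. w \<le> U n \<omega>} \<union> {\<omega> \<in> space M. v \<le> V n \<omega>})"
        using D(1) by (intro measure_Un_le sets.Un sets.finite_UN) measurable
      also have "\<dots> \<le> (\<Sum>d\<in>D. measure M (?O n d)) + (measure M {\<omega> \<in> space M. w \<le> U n \<omega>} + measure M {\<omega> \<in> space M. v \<le> V n \<omega>})"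
        using D(1) by (intro add_mono measure_Un_le measure_UNION_le) measurable
      also have "\<dots> \<le> (\<Sum>d\<in>D. measure M (?O n d)) + (C1 / w * h n + \<eta> / 3)"
      proof (intro add_left_mono add_mono)
        have "measure M {\<omega> \<in> space M. w \<le> U n \<omega>} \<le> expectation (U n) / w"
          using EU(1)[of n] elim w(1) U0 by (intro integral_Markov_inequality_measure[where A="space M"]) auto
        also have "\<dots> \<le> C1 * h n / w" using EU(2)[of n] elim w(1) by (intro divide_right_mono) auto
        finally show "measure M {\<omega> \<in> space M. w \<le> U n \<omega>} \<le> C1 / w * h n" by simp
        have "measure M {\<omega> \<in> space M. v \<le> V n \<omega>} \<le> expectation (V n) / v"
          using elim v(1) V0 by (intro integral_Markov_inequality_measure[where A="space M"]) auto
        also have "\<dots> \<le> (v * \<eta> / 3) / v" using elim v(1) by (intro divide_right_mono) auto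
        finally show "measure M {\<omega> \<in> space M. v \<le> V n \<omega>} \<le> \<eta> / 3" using v(1) by simp
      qed
      finally show ?case .
    qed
    have "(\<lambda>n. (\<Sum>d\<in>D. measure M (?O n d)) + (C1 / w * h n + \<eta> / 3)) \<longlonglongrightarrow> (\<Sum>d\<in>D. 0) + (C1 / w * 0 + \<eta> / 3)"
      by (intro tendsto_add tendsto_sum tendsto_mult tendsto_const h(2) occ)
    then have lim: "(\<lambda>n. (\<Sum>d\<in>D. measure M (?O n d)) + (C1 / w * h n + \<eta> / 3)) \<longlonglongrightarrow> \<eta> / 3" by simp
    have "\<eta> / 3 < \<eta>" using \<eta> by simp
    from order_tendstoD(2)[OF lim this] bound
    have "\<forall>\<^sub>F n in sequentially. measure M {\<omega> \<in> space M. \<epsilon> < \<bar>\<theta>hat n \<omega> - \<theta>\<^sub>0\<bar>} < \<eta>"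
      by eventually_elim simp
    then show "\<exists>n0. \<forall>n\<ge>n0. norm (measure M {\<omega> \<in> space M. \<epsilon> < \<bar>\<theta>hat n \<omega> - \<theta>\<^sub>0\<bar>} - 0) < \<eta>"
      by (simp add: eventually_sequentially)
  qed
qed

end

section \<open>Verification for the diffusion model\<close>

lemma has_ito_integral_cong:
  assumes "\<And>s \<omega>. 0 \<le> s \<Longrightarrow> s \<le> t \<Longrightarrow> H s \<omega> = H' s \<omega>" and "has_ito_integral M F W H t I"
  shows "has_ito_integral M F W H' t I"
proof -
  have "(\<integral>\<^sup>+s\<in>{0..t}. ennreal ((H s \<omega> - e s)\<^sup>2) \<partial>lborel) = (\<integral>\<^sup>+s\<in>{0..t}. ennreal ((H' s \<omega> - e s)\<^sup>2) \<partial>lborel)"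
    for e :: "real \<Rightarrow> real" and \<omega>
    using assms(1) by (intro nn_integral_cong) (simp add: indicator_def)
  then show ?thesis using assms(2) unfolding has_ito_integral_def by simp
qed

lemma parameter_regularity:
  assumes ss: "state_smooth {l..u} f" and ps: "parameter_smooth {l..u} f"
  obtains C k where "0 \<le> C" "\<And>x \<theta>. \<theta> \<in> {l..u} \<Longrightarrow> \<bar>f x \<theta>\<bar> \<le> C * (1 + \<bar>x\<bar>) ^ k"
    "\<And>x \<theta> \<theta>'. \<theta> \<in> {l..u} \<Longrightarrow> \<theta>' \<in> {l..u} \<Longrightarrow> \<bar>f x \<theta> - f x \<theta>'\<bar> \<le> C * (1 + \<bar>x\<bar>) ^ k * \<bar>\<theta> - \<theta>'\<bar>"
proof -
  have sd0: "state_deriv 0 f = f" by (intro ext) (simp add: state_deriv_def)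
  have "polynomial_growth {l..u} (state_deriv 0 f)"
    using ss unfolding state_smooth_def by blast
  then obtain C1 k1 where g: "\<And>\<theta> x. \<theta> \<in> {l..u} \<Longrightarrow> \<bar>f x \<theta>\<bar> \<le> C1 * (1 + \<bar>x\<bar>) ^ k1"
    unfolding polynomial_growth_def sd0 by blast
  have "\<exists>D. (\<forall>x. continuous_derivatives 3 {l..u} (\<lambda>\<theta>. state_deriv 0 f x \<theta>) (\<lambda>j \<theta>. D j x \<theta>)) \<and>
        (\<forall>j\<in>{1..3}. polynomial_growth {l..u} (D j))"
    using ps unfolding parameter_smooth_def by blast
  then obtain D where D: "\<And>x. continuous_derivatives 3 {l..u} (\<lambda>\<theta>. f x \<theta>) (\<lambda>j \<theta>. D j x \<theta>)"
    and Dg: "\<forall>j\<in>{1..3::nat}. polynomial_growth {l..u} (D j)" unfolding sd0 by blast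
  have "polynomial_growth {l..u} (D (Suc 0))" using Dg by simp
  then obtain C2 k2 where d: "\<And>\<theta> x. \<theta> \<in> {l..u} \<Longrightarrow> \<bar>D (Suc 0) x \<theta>\<bar> \<le> C2 * (1 + \<bar>x\<bar>) ^ k2"
    unfolding polynomial_growth_def by blast
  define C where "C = max 0 (max C1 C2)"
  define k where "k = max k1 k2"
  have up: "A * (1 + \<bar>x\<bar>) ^ j \<le> C * (1 + \<bar>x\<bar>) ^ k" if "A \<le> C" "j \<le> k" for A j and x :: real
  proof -
    have "A * (1 + \<bar>x\<bar>) ^ j \<le> C * (1 + \<bar>x\<bar>) ^ j" using that by (intro mult_right_mono) auto
    also have "\<dots> \<le> C * (1 + \<bar>x\<bar>) ^ k"
      using that by (intro mult_left_mono power_increasing) (auto simp: C_def)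
    finally show ?thesis .
  qed
  show thesis
  proof (rule that)
    show "0 \<le> C" unfolding C_def by simp
    show "\<bar>f x \<theta>\<bar> \<le> C * (1 + \<bar>x\<bar>) ^ k" if "\<theta> \<in> {l..u}" for x \<theta>
      using order_trans[OF g[OF that] up[of C1 k1 x]] by (simp add: C_def k_def)
    show "\<bar>f x \<theta> - f x \<theta>'\<bar> \<le> C * (1 + \<bar>x\<bar>) ^ k * \<bar>\<theta> - \<theta>'\<bar>" if \<theta>: "\<theta> \<in> {l..u}" "\<theta>' \<in> {l..u}" for x \<theta> \<theta>'
    proof -
      have D0: "\<And>t. t \<in> {l..u} \<Longrightarrow> D 0 x t = f x t"
        and D1: "\<And>t. t \<in> {l..u} \<Longrightarrow> (D 0 x has_real_derivative D (Suc 0) x t) (at t within {l..u})"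
        using D[of x] unfolding continuous_derivatives_def by auto
      have "norm (D 0 x \<theta> - D 0 x \<theta>') \<le> C * (1 + \<bar>x\<bar>) ^ k * norm (\<theta> - \<theta>')"
      proof (rule field_differentiable_bound[where S="{l..u}" and f'="D (Suc 0) x"])
        show "norm (D (Suc 0) x t) \<le> C * (1 + \<bar>x\<bar>) ^ k" if "t \<in> {l..u}" for t
          using order_trans[OF d[OF that] up[of C2 k2 x]] by (simp add: C_def k_def)
      qed (use D1 \<theta> in auto)
      then show ?thesis using D0 \<theta> by simp
    qed
  qed
qed

lemma power_le_powr:
  fixes a :: real
  assumes "0 \<le> a"
  shows "(1 + a) ^ k \<le> 2 ^ k * (2 + a powr real k)"
proof -
  have "(1 + a) ^ k \<le> (2 * max 1 a) ^ k" using assms by (intro power_mono) auto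
  also have "\<dots> = 2 ^ k * (max 1 a) ^ k" by (rule power_mult_distrib)
  also have "(max 1 a) ^ k \<le> 2 + a powr real k"
  proof (cases "a \<le> 1")
    case True
    then have "max 1 a = 1" by simp
    moreover have "0 \<le> a powr real k" by simp
    ultimately show ?thesis by simp
  next
    case False
    then have "(max 1 a) ^ k = a powr real k" by (simp add: powr_realpow)
    then show ?thesis by simp
  qed
  finally show ?thesis by simp
qed

lemma contrast_bounded_below:
  assumes "0 < \<kappa>" "\<And>x. \<kappa> \<le> (\<sigma> x \<theta>)\<^sup>2" "0 < h n"
  shows "- (real n * \<bar>ln \<kappa>\<bar>) \<le> contrast \<sigma> X h \<tau> \<tau>s n \<theta> \<omega>"
proof -
  have "(\<Sum>i = 1..n. - \<bar>ln \<kappa>\<bar>) \<le> contrast \<sigma> X h \<tau> \<tau>s n \<theta> \<omega>"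
    unfolding contrast_def
  proof (rule sum_mono)
    fix i
    let ?x = "sampled X (h n) (i - 1) \<omega>" and ?y = "sampled X (h n) i \<omega>"
    have s: "0 < (\<sigma> ?x \<theta>)\<^sup>2" using assms(1) assms(2)[of ?x] by linarith
    have "ln \<kappa> \<le> ln ((\<sigma> ?x \<theta>)\<^sup>2)" using assms(1) assms(2)[of ?x] s by (subst ln_le_cancel_iff) auto
    moreover have "0 \<le> (?y - ?x)\<^sup>2 / ((\<sigma> ?x \<theta>)\<^sup>2 * h n)" using s assms(3) by simp
    ultimately have "- \<bar>ln \<kappa>\<bar> \<le> ln ((\<sigma> ?x \<theta>)\<^sup>2) + (?y - ?x)\<^sup>2 / ((\<sigma> ?x \<theta>)\<^sup>2 * h n)" by linarith
    then show "- \<bar>ln \<kappa>\<bar> \<le> (ln ((\<sigma> ?x \<theta>)\<^sup>2) + (?y - ?x)\<^sup>2 / ((\<sigma> ?x \<theta>)\<^sup>2 * h n)) * of_bool (?x > \<tau>s n \<and> ?y > \<tau>)"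
      by (cases "?x > \<tau>s n \<and> ?y > \<tau>") auto
  qed
  then show ?thesis by simp
qed

text \<open>
  The quotient is the square of a bounded sequence times \<open>h\<close> to the positive power \<open>1 - 2 \<alpha>\<close>.
\<close>

lemma threshold_gap:
  fixes h \<tau>s :: "nat \<Rightarrow> real"
  assumes h: "\<And>n. 0 < h n" "h \<longlonglongrightarrow> 0" and \<alpha>: "\<alpha> < 1 / 2"
    and rate: "(\<lambda>n. h n powr \<alpha> / (\<tau>s n - \<tau>)) \<in> O(\<lambda>_. 1)"
  shows "(\<lambda>n. h n / (\<tau>s n - \<tau>)\<^sup>2) \<longlonglongrightarrow> 0"
proof -
  obtain c where c: "0 < c" "\<forall>\<^sub>F n in sequentially. norm (h n powr \<alpha> / (\<tau>s n - \<tau>)) \<le> c * norm (1 :: real)"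
    using landau_o.bigE[OF rate] by blast
  have eq: "h n / (\<tau>s n - \<tau>)\<^sup>2 = (h n powr \<alpha> / (\<tau>s n - \<tau>))\<^sup>2 * h n powr (1 - 2 * \<alpha>)" for n
  proof -
    have "(h n powr \<alpha>)\<^sup>2 * h n powr (1 - 2 * \<alpha>) = h n"
      using h(1)[of n] by (simp add: power2_eq_square powr_add[symmetric])
    then show ?thesis by (simp add: power_divide)
  qed
  show ?thesis
  proof (rule Lim_null_comparison)
    show "\<forall>\<^sub>F n in sequentially. norm (h n / (\<tau>s n - \<tau>)\<^sup>2) \<le> c\<^sup>2 * h n powr (1 - 2 * \<alpha>)"
      using c(2)
    proof eventually_elim
      case (elim n)
      have "\<bar>h n powr \<alpha> / (\<tau>s n - \<tau>)\<bar>\<^sup>2 \<le> c\<^sup>2" using elim by (intro power_mono) auto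
      then have "(h n powr \<alpha> / (\<tau>s n - \<tau>))\<^sup>2 * h n powr (1 - 2 * \<alpha>) \<le> c\<^sup>2 * h n powr (1 - 2 * \<alpha>)"
        unfolding power2_abs by (intro mult_right_mono) auto
      then show ?case unfolding eq[of n, symmetric] using h(1)[of n] by simp
    qed
    have "(\<lambda>n. h n powr (1 - 2 * \<alpha>)) \<longlonglongrightarrow> 0"
      using h(1) \<alpha> by (intro tendsto_zero_powrI[OF h(2) tendsto_const]) (auto intro: always_eventually less_imp_le)
    from tendsto_mult[OF tendsto_const this, of "c\<^sup>2"] show "(\<lambda>n. c\<^sup>2 * h n powr (1 - 2 * \<alpha>)) \<longlonglongrightarrow> 0" by simp
  qed
qed

theorem theorem3p1:
  fixes M :: "'a measure" and F :: "real \<Rightarrow> 'a measure"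
    and W X :: "real \<Rightarrow> 'a \<Rightarrow> real" and x\<^sub>0 :: "'a \<Rightarrow> real"
    and b \<sigma> :: "real \<Rightarrow> real \<Rightarrow> real"
    and l1 u1 l2 u2 \<theta>10 \<theta>20 :: real and \<Theta>1 \<Theta>2 :: "real set"
    and \<nu> :: "real measure"
    and h \<tau>s :: "nat \<Rightarrow> real" and \<tau> \<alpha> :: real
    and \<theta>hat :: "nat \<Rightarrow> 'a \<Rightarrow> real"
  defines "\<Theta>1 \<equiv> {l1..u1}" and "\<Theta>2 \<equiv> {l2..u2}"
  assumes true_value: "\<theta>10 \<in> interior \<Theta>1" "\<theta>20 \<in> interior \<Theta>2"
    and space: "filtered_prob_space M F"
    and brownian: "brownian_motion M F W"
    and solution: "diffusion_solution M F W (\<lambda>x. b x \<theta>20) (\<lambda>x. \<sigma> x \<theta>10) x\<^sub>0 X"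
    \<comment> \<open>observation scheme\<close>
    and h_pos: "\<And>n. h n > 0"
    and h_lim: "h \<longlonglongrightarrow> 0"
    and nh_lim: "filterlim (\<lambda>n. real n * h n) at_top sequentially"
    and nh2_lim: "(\<lambda>n. real n * (h n)\<^sup>2) \<longlonglongrightarrow> 0"
    and alpha: "0 < \<alpha>" "\<alpha> < 1/2"
    and tau_gt: "\<And>n. \<tau>s n > \<tau>"
    and tau_lim: "\<tau>s \<longlonglongrightarrow> \<tau>"
    and tau_rate: "(\<lambda>n. h n powr \<alpha> / (\<tau>s n - \<tau>)) \<in> O(\<lambda>_. 1)"
    \<comment> \<open>assumptions on the model\<close>
    and lipschitz: "\<exists>K>0. \<forall>x y. \<bar>b x \<theta>20 - b y \<theta>20\<bar> + \<bar>\<sigma> x \<theta>10 - \<sigma> y \<theta>10\<bar> \<le> K * \<bar>x - y\<bar>"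
    and stationary: "stationary M X"
    and ergodic: "ergodic M X"
    and invariant: "\<And>t. t \<ge> 0 \<Longrightarrow> distr M borel (X t) = \<nu>"
    and moments: "\<And>p::real. p \<ge> 0 \<Longrightarrow>
      (SUP t\<in>{0..}. \<integral>\<^sup>+\<omega>. ennreal (\<bar>X t \<omega>\<bar> powr p) \<partial>M) < \<infinity>"
    and nondegenerate: "(INF (x, \<theta>1)\<in>UNIV \<times> \<Theta>1. (\<sigma> x \<theta>1)\<^sup>2) > 0"
    and state_smooth: "state_smooth \<Theta>2 b" "state_smooth \<Theta>1 \<sigma>"
    and parameter_smooth: "parameter_smooth \<Theta>2 b" "parameter_smooth \<Theta>1 \<sigma>"
    and identifiable: "identifiable \<Theta>1 \<Theta>2 b \<sigma> \<theta>10 \<theta>20"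
    and identifiable_above: "identifiable_above \<tau> \<Theta>1 \<sigma> \<theta>10"
    \<comment> \<open>the estimator\<close>
    and estimator_measurable: "\<And>n. \<theta>hat n \<in> borel_measurable M"
    and estimator: "\<And>n. AE \<omega> in M. \<theta>hat n \<omega> \<in> \<Theta>1 \<and>
      contrast \<sigma> X h \<tau> \<tau>s n (\<theta>hat n \<omega>) \<omega> = (INF \<theta>1\<in>\<Theta>1. contrast \<sigma> X h \<tau> \<tau>s n \<theta>1 \<omega>)"
  shows "tendsto_in_prob M \<theta>hat \<theta>10"
proof -
  note \<Theta>1 = \<open>\<Theta>1 \<equiv> {l1..u1}\<close>
  have \<theta>10: "\<theta>10 \<in> \<Theta>1" using true_value(1) interior_subset by blast
  interpret B: brownian_filtration M F W
    using space brownian by (auto simp: brownian_filtration_def brownian_filtration_axioms_def filtered_prob_space_def)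
  obtain C k where C0: "0 \<le> C"
    and growth: "\<And>x \<theta>. \<theta> \<in> \<Theta>1 \<Longrightarrow> \<bar>\<sigma> x \<theta>\<bar> \<le> C * (1 + \<bar>x\<bar>) ^ k"
    and lip: "\<And>x \<theta> \<theta>'. \<theta> \<in> \<Theta>1 \<Longrightarrow> \<theta>' \<in> \<Theta>1 \<Longrightarrow> \<bar>\<sigma> x \<theta> - \<sigma> x \<theta>'\<bar> \<le> C * (1 + \<bar>x\<bar>) ^ k * \<bar>\<theta> - \<theta>'\<bar>"
    using parameter_regularity[OF state_smooth(2)[unfolded \<Theta>1] parameter_smooth(2)[unfolded \<Theta>1]]
    unfolding \<Theta>1 by blast
  have cont: "continuous_on UNIV (\<lambda>x. \<sigma> x \<theta>)" if "\<theta> \<in> \<Theta>1" for \<theta>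
  proof -
    have "continuous_derivatives 2 UNIV (\<lambda>x. \<sigma> x \<theta>) (\<lambda>i x. state_deriv i \<sigma> x \<theta>)"
      using state_smooth(2) that unfolding state_smooth_def by blast
    then have "continuous_on UNIV (\<lambda>x. state_deriv 0 \<sigma> x \<theta>)"
      unfolding continuous_derivatives_def by blast
    then show ?thesis by (simp add: state_deriv_def)
  qed
  define \<kappa> where "\<kappa> = (INF (x, \<theta>1)\<in>UNIV \<times> \<Theta>1. (\<sigma> x \<theta>1)\<^sup>2)"
  have \<kappa>0: "0 < \<kappa>" using nondegenerate unfolding \<kappa>_def .
  have \<kappa>: "\<kappa> \<le> (\<sigma> x \<theta>)\<^sup>2" if "\<theta> \<in> \<Theta>1" for x \<theta>
  proof -
    have "bdd_below ((\<lambda>(x, \<theta>1). (\<sigma> x \<theta>1)\<^sup>2) ` (UNIV \<times> \<Theta>1))"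
      by (rule bdd_belowI[of _ 0]) auto
    from cINF_lower[OF this, of "(x, \<theta>)"] show ?thesis unfolding \<kappa>_def using that by simp
  qed
  obtain K where K: "0 < K" "\<And>x y. \<bar>b x \<theta>20 - b y \<theta>20\<bar> + \<bar>\<sigma> x \<theta>10 - \<sigma> y \<theta>10\<bar> \<le> K * \<bar>x - y\<bar>"
    using lipschitz by blast
  have X_F: "X t \<in> borel_measurable (F t)" if "0 \<le> t" for t
    using solution that unfolding diffusion_solution_def adapted_def by simp
  (* Extended to negative times by the initial value, the process has continuous paths on the whole line. *)
  define Y where "Y t = X (max 0 t)" for t
  have Y_eq: "Y t = X t" if "0 \<le> t" for t unfolding Y_def using that by simp
  have shifted: "shifted_path Y t = shifted_path X t" if "0 \<le> t" for t
    unfolding shifted_path_def using that by (intro ext) (auto simp: Y_eq restrict_def)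
  have Y_M: "Y t \<in> borel_measurable M" for t
    unfolding Y_def by (intro B.measurable_from_F[OF X_F]) simp
  have X0_M: "X 0 \<in> borel_measurable M" using Y_M[of 0] Y_eq[of 0] by simp
  have moment: "integrable \<nu> (\<lambda>x. (1 + \<bar>x\<bar>) ^ j)" for j :: nat
  proof -
    have "(\<integral>\<^sup>+\<omega>. ennreal (\<bar>X 0 \<omega>\<bar> powr real j) \<partial>M) \<le> (SUP t\<in>{0..}. \<integral>\<^sup>+\<omega>. ennreal (\<bar>X t \<omega>\<bar> powr real j) \<partial>M)"
      by (rule SUP_upper) simp
    also have "\<dots> < \<infinity>" by (rule moments) simp
    finally have "integrable M (\<lambda>\<omega>. \<bar>X 0 \<omega>\<bar> powr real j)"
      using X0_M by (intro integrableI_nonneg) auto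
    then have i: "integrable M (\<lambda>\<omega>. 2 ^ j * (2 + \<bar>X 0 \<omega>\<bar> powr real j))" by simp
    have "integrable M (\<lambda>\<omega>. (1 + \<bar>X 0 \<omega>\<bar>) ^ j)"
    proof (rule Bochner_Integration.integrable_bound[OF i])
      show "(\<lambda>\<omega>. (1 + \<bar>X 0 \<omega>\<bar>) ^ j) \<in> borel_measurable M" using X0_M by measurable
      show "AE \<omega> in M. norm ((1 + \<bar>X 0 \<omega>\<bar>) ^ j) \<le> norm (2 ^ j * (2 + \<bar>X 0 \<omega>\<bar> powr real j))"
        using power_le_powr[of "\<bar>X 0 _\<bar>" j] by (intro AE_I2) (auto intro: order_trans[OF _ abs_ge_self])
    qed
    then have "integrable (distr M borel (X 0)) (\<lambda>x. (1 + \<bar>x\<bar>) ^ j)"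
      by (subst integrable_distr_eq[OF X0_M]) auto
    then show ?thesis using invariant[of 0] by simp
  qed
  interpret D: stationary_diffusion M F W Y "\<lambda>x. b x \<theta>20" "\<lambda>x. \<sigma> x \<theta>10" \<nu> K
  proof (unfold_locales)
    fix \<omega> assume "\<omega> \<in> space M"
    then have "continuous_on {0..} (\<lambda>t. X t \<omega>)" using solution unfolding diffusion_solution_def by blast
    then show "continuous_on UNIV (\<lambda>t. Y t \<omega>)"
      unfolding Y_def by (rule continuous_on_compose2) (auto intro!: continuous_intros)
  next
    fix t :: real assume t: "0 \<le> t"
    show "Y t \<in> borel_measurable (F t)" using X_F[OF t] Y_eq[OF t] by simp
    show "distr M borel (Y t) = \<nu>" using invariant[OF t] Y_eq[OF t] by simp
    have "has_ito_integral M F W (\<lambda>s \<omega>. \<sigma> (X s \<omega>) \<theta>10) t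
        (\<lambda>\<omega>. X t \<omega> - X 0 \<omega> - (LBINT s:{0..t}. b (X s \<omega>) \<theta>20))"
      using solution t unfolding diffusion_solution_def by simp
    moreover have "(LBINT s:{0..t}. b (X s \<omega>) \<theta>20) = (LBINT s:{0..t}. b (Y s \<omega>) \<theta>20)" for \<omega>
      by (rule set_lebesgue_integral_cong) (auto simp: Y_eq)
    ultimately have "has_ito_integral M F W (\<lambda>s \<omega>. \<sigma> (X s \<omega>) \<theta>10) t
        (\<lambda>\<omega>. Y t \<omega> - Y 0 \<omega> - (LBINT s:{0..t}. b (Y s \<omega>) \<theta>20))"
      using t by (simp add: Y_eq)
    then show "has_ito_integral M F W (\<lambda>s \<omega>. \<sigma> (Y s \<omega>) \<theta>10) t
        (\<lambda>\<omega>. Y t \<omega> - Y 0 \<omega> - (LBINT s:{0..t}. b (Y s \<omega>) \<theta>20))"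
      by (rule has_ito_integral_cong[rotated]) (simp add: Y_eq)
  next
    show "\<bar>b x \<theta>20 - b y \<theta>20\<bar> \<le> K * \<bar>x - y\<bar>" "\<bar>\<sigma> x \<theta>10 - \<sigma> y \<theta>10\<bar> \<le> K * \<bar>x - y\<bar>" for x y
      using K(2)[of x y] by linarith+
  qed (use Y_M moment K in auto)
  have sampledY: "sampled Y (h n) i \<omega> = sampled X (h n) i \<omega>" for n i \<omega>
    unfolding sampled_def using h_pos[of n] by (simp add: Y_eq)
  have contrastY: "contrast \<sigma> Y h \<tau> \<tau>s n \<theta> \<omega> = contrast \<sigma> X h \<tau> \<tau>s n \<theta> \<omega>" for n \<theta> \<omega>
    unfolding contrast_def sampledY ..
  show ?thesis
  proof (rule D.contrast_consistency[where f=\<sigma> and h=h and \<tau>s=\<tau>s and \<tau>=\<tau> and l=l1 and u=u1 and \<kappa>=\<kappa> and C=C and k=k])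
    show "stationary M Y"
      unfolding stationary_def
    proof (intro allI impI)
      fix t :: real assume t: "0 \<le> t"
      show "distr M path_space (shifted_path Y t) = distr M path_space (shifted_path Y 0)"
        unfolding shifted[OF t] shifted[OF order_refl]
        by (rule stationary[unfolded stationary_def, rule_format, OF t])
    qed
    show "ergodic M Y"
      unfolding ergodic_def shifted[OF order_refl]
    proof (intro ballI impI)
      fix A assume A: "A \<in> sets path_space"
        and inv: "\<forall>t\<ge>0. AE \<omega> in M. shifted_path Y t \<omega> \<in> A \<longleftrightarrow> shifted_path X 0 \<omega> \<in> A"
      have "\<forall>t\<ge>0. AE \<omega> in M. shifted_path X t \<omega> \<in> A \<longleftrightarrow> shifted_path X 0 \<omega> \<in> A"
      proof (intro allI impI)
        fix t :: real assume t: "0 \<le> t"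
        show "AE \<omega> in M. shifted_path X t \<omega> \<in> A \<longleftrightarrow> shifted_path X 0 \<omega> \<in> A"
          using inv[rule_format, OF t] unfolding shifted[OF t] .
      qed
      then show "measure M {\<omega> \<in> space M. shifted_path X 0 \<omega> \<in> A} \<in> {0, 1}"
        by (rule mp[OF bspec[OF ergodic[unfolded ergodic_def] A]])
    qed
    show "(\<lambda>n. h n / (\<tau>s n - \<tau>)\<^sup>2) \<longlonglongrightarrow> 0"
      by (rule threshold_gap[OF h_pos h_lim alpha(2) tau_rate])
    show "\<theta> = \<theta>10" if "\<theta> \<in> {l1..u1}" "\<forall>x>\<tau>. \<sigma> x \<theta> = \<sigma> x \<theta>10" for \<theta>
      using identifiable_above that unfolding identifiable_above_def \<Theta>1 by blast
    show "AE \<omega> in M. \<theta>hat n \<omega> \<in> {l1..u1} \<and> contrast \<sigma> Y h \<tau> \<tau>s n (\<theta>hat n \<omega>) \<omega> \<le> contrast \<sigma> Y h \<tau> \<tau>s n \<theta>10 \<omega>" for n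
      using estimator[of n]
    proof eventually_elim
      case (elim \<omega>)
      have "bdd_below ((\<lambda>\<theta>1. contrast \<sigma> X h \<tau> \<tau>s n \<theta>1 \<omega>) ` \<Theta>1)"
      proof (rule bdd_belowI2)
        fix \<theta> assume "\<theta> \<in> \<Theta>1"
        then show "- (real n * \<bar>ln \<kappa>\<bar>) \<le> contrast \<sigma> X h \<tau> \<tau>s n \<theta> \<omega>"
          by (intro contrast_bounded_below \<kappa>0 \<kappa> h_pos)
      qed
      from cINF_lower[OF this \<theta>10] show ?case using elim unfolding contrastY \<Theta>1 by simp
    qed
  qed (use h_pos h_lim nh_lim tau_gt tau_lim \<theta>10 \<kappa>0 \<kappa> cont growth lip C0 estimator_measurable in \<open>simp_all add: \<Theta>1\<close>)
qed

end
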